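(* Let $X$ be a normal surface over a field $k$. Then $Z(\operatorname{Ref}(X))=H^0(X,\mathcal{O}_X)$.
   Context: Fix a field $k$. A normal surface is an irreducible two-dimensional separated normal $k$-scheme of finite type. $\operatorname{Ref}(X)\subset\operatorname{Coh}(X)$ is the full subcategory of reflexive sheaves (those coherent $F$ for which $F\to F^{\vee\vee}$ is an isomorphism). For a category $\mathcal{E}$, its center is $Z(\mathcal{E})=\operatorname{End}(\operatorname{Id}_{\mathcal{E}})$, the ring of natural endomorphisms of the identity functor. The equality is the canonical identification in which a global function acts on each sheaf by multiplication. *)

theory Defs
  imports
    "HOL-Analysis.Abstract_Topology"
    "HOL-Library.Extended_Nat"
    "HOL-Algebra.Module"
    "HOL-Algebra.Generated_Rings"
begin

section \<open>Commutative algebra\<close>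

text \<open>The class of the fraction $a/s$ in the localization of \<open>R\<close> at a multiplicative set \<open>S\<close>.\<close>

definition fraction :: "('a, 'e) ring_scheme \<Rightarrow> 'a set \<Rightarrow> 'a \<Rightarrow> 'a \<Rightarrow> ('a \<times> 'a) set" where
  "fraction R S a s =
    {(b, t). b \<in> carrier R \<and> t \<in> S \<and>
       (\<exists>u\<in>S. u \<otimes>\<^bsub>R\<^esub> ((t \<otimes>\<^bsub>R\<^esub> a) \<ominus>\<^bsub>R\<^esub> (s \<otimes>\<^bsub>R\<^esub> b)) = \<zero>\<^bsub>R\<^esub>)}"

text \<open>The operations are the usual ones on representatives; the unions run over all
  representatives and each is a union of copies of one and the same class.\<close>

definition localization :: "('a, 'e) ring_scheme \<Rightarrow> 'a set \<Rightarrow> ('a \<times> 'a) set ring" where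
  "localization R S =
    \<lparr>carrier = {fraction R S a s | a s. a \<in> carrier R \<and> s \<in> S},
     mult = (\<lambda>x y. \<Union>(a, s)\<in>x. \<Union>(b, t)\<in>y. fraction R S (a \<otimes>\<^bsub>R\<^esub> b) (s \<otimes>\<^bsub>R\<^esub> t)),
     one = fraction R S \<one>\<^bsub>R\<^esub> \<one>\<^bsub>R\<^esub>,
     zero = fraction R S \<zero>\<^bsub>R\<^esub> \<one>\<^bsub>R\<^esub>,
     add = (\<lambda>x y. \<Union>(a, s)\<in>x. \<Union>(b, t)\<in>y.
       fraction R S ((t \<otimes>\<^bsub>R\<^esub> a) \<oplus>\<^bsub>R\<^esub> (s \<otimes>\<^bsub>R\<^esub> b)) (s \<otimes>\<^bsub>R\<^esub> t))\<rparr>"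

definition integrally_closed_domain :: "('a, 'e) ring_scheme \<Rightarrow> bool" where
  "integrally_closed_domain R \<longleftrightarrow> domain R \<and>
    (let S = carrier R - {\<zero>\<^bsub>R\<^esub>}; K = localization R S; \<iota> = (\<lambda>a. fraction R S a \<one>\<^bsub>R\<^esub>) in
     \<forall>x\<in>carrier K.
       (\<exists>(n::nat) c. c \<in> {..<n} \<rightarrow> carrier R \<and>
          x [^]\<^bsub>K\<^esub> n \<oplus>\<^bsub>K\<^esub> (\<Oplus>\<^bsub>K\<^esub>i\<in>{..<n}. \<iota> (c i) \<otimes>\<^bsub>K\<^esub> x [^]\<^bsub>K\<^esub> i) = \<zero>\<^bsub>K\<^esub>)
       \<longrightarrow> x \<in> \<iota> ` carrier R)"


section \<open>Irreducibility and Krull dimension of topological spaces\<close>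

definition irreducible_subset :: "'x topology \<Rightarrow> 'x set \<Rightarrow> bool" where
  "irreducible_subset T Z \<longleftrightarrow> Z \<subseteq> topspace T \<and> Z \<noteq> {} \<and>
    (\<forall>A B. closedin T A \<longrightarrow> closedin T B \<longrightarrow> Z \<subseteq> A \<union> B \<longrightarrow> Z \<subseteq> A \<or> Z \<subseteq> B)"

definition krull_dim :: "'x topology \<Rightarrow> enat" where
  "krull_dim T = Sup {enat n | n. \<exists>Z :: nat \<Rightarrow> 'x set.
      (\<forall>i\<le>n. closedin T (Z i) \<and> irreducible_subset T (Z i)) \<and> (\<forall>i<n. Z i \<subset> Z (Suc i))}"


section \<open>Ringed spaces\<close>

text \<open>A space with a presheaf of rings: \<open>\<O> X U\<close> is the ring of sections over the open set \<open>U\<close>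
  and \<open>res X U V\<close> the restriction map from sections over \<open>U\<close> to sections over \<open>V \<subseteq> U\<close>.
  The values at sets that are not open are irrelevant.\<close>

record ('x, 'r) ringed_space =
  top_of :: "'x topology"
  \<O> :: "'x set \<Rightarrow> 'r ring"
  res :: "'x set \<Rightarrow> 'x set \<Rightarrow> 'r \<Rightarrow> 'r"

abbreviation opn :: "('x, 'r) ringed_space \<Rightarrow> 'x set \<Rightarrow> bool" where
  "opn X U \<equiv> openin (top_of X) U"

abbreviation pts :: "('x, 'r) ringed_space \<Rightarrow> 'x set" where
  "pts X \<equiv> topspace (top_of X)"

text \<open>The sheaf axiom (locality and gluing) for a presheaf of sets given by sections \<open>F\<close> and
  restrictions \<open>r\<close>. The empty cover is included, so there is exactly one section over \<open>{}\<close>.\<close>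

definition is_sheaf ::
    "'x topology \<Rightarrow> ('x set \<Rightarrow> 'm set) \<Rightarrow> ('x set \<Rightarrow> 'x set \<Rightarrow> 'm \<Rightarrow> 'm) \<Rightarrow> bool" where
  "is_sheaf T F r \<longleftrightarrow>
    (\<forall>U V. openin T U \<longrightarrow> openin T V \<longrightarrow> V \<subseteq> U \<longrightarrow> r U V \<in> F U \<rightarrow> F V) \<and>
    (\<forall>U s. openin T U \<longrightarrow> s \<in> F U \<longrightarrow> r U U s = s) \<and>
    (\<forall>U V W s. openin T U \<longrightarrow> openin T V \<longrightarrow> openin T W \<longrightarrow> W \<subseteq> V \<longrightarrow> V \<subseteq> U \<longrightarrow>
       s \<in> F U \<longrightarrow> r V W (r U V s) = r U W s) \<and>
    (\<forall>\<U> s. (\<forall>U\<in>\<U>. openin T U \<and> s U \<in> F U) \<longrightarrow>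
       (\<forall>U\<in>\<U>. \<forall>V\<in>\<U>. r U (U \<inter> V) (s U) = r V (U \<inter> V) (s V)) \<longrightarrow>
       (\<exists>!t. t \<in> F (\<Union>\<U>) \<and> (\<forall>U\<in>\<U>. r (\<Union>\<U>) U t = s U)))"

definition is_ringed_space :: "('x, 'r) ringed_space \<Rightarrow> bool" where
  "is_ringed_space X \<longleftrightarrow>
    (\<forall>U. opn X U \<longrightarrow> cring (\<O> X U)) \<and>
    (\<forall>U V. opn X U \<longrightarrow> opn X V \<longrightarrow> V \<subseteq> U \<longrightarrow> res X U V \<in> ring_hom (\<O> X U) (\<O> X V)) \<and>
    is_sheaf (top_of X) (\<lambda>U. carrier (\<O> X U)) (res X)"

definition open_subspace :: "('x, 'r) ringed_space \<Rightarrow> 'x set \<Rightarrow> ('x, 'r) ringed_space" where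
  "open_subspace X U = X\<lparr>top_of := subtopology (top_of X) U\<rparr>"

text \<open>The germ at \<open>x\<close> of a section \<open>s\<close> over a neighbourhood \<open>U\<close> of \<open>x\<close>, as an equivalence class,
  and the stalk; operations on representatives as for localizations.\<close>

definition germ :: "('x, 'r) ringed_space \<Rightarrow> 'x \<Rightarrow> 'x set \<Rightarrow> 'r \<Rightarrow> ('x set \<times> 'r) set" where
  "germ X x U s = {(V, t). opn X V \<and> x \<in> V \<and> t \<in> carrier (\<O> X V) \<and>
     (\<exists>W. opn X W \<and> x \<in> W \<and> W \<subseteq> U \<inter> V \<and> res X U W s = res X V W t)}"

definition stalk :: "('x, 'r) ringed_space \<Rightarrow> 'x \<Rightarrow> ('x set \<times> 'r) set ring" where
  "stalk X x =
    \<lparr>carrier = {germ X x U s | U s. opn X U \<and> x \<in> U \<and> s \<in> carrier (\<O> X U)},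
     mult = (\<lambda>g h. \<Union>(U, s)\<in>g. \<Union>(V, t)\<in>h.
       germ X x (U \<inter> V) (res X U (U \<inter> V) s \<otimes>\<^bsub>\<O> X (U \<inter> V)\<^esub> res X V (U \<inter> V) t)),
     one = germ X x (pts X) \<one>\<^bsub>\<O> X (pts X)\<^esub>,
     zero = germ X x (pts X) \<zero>\<^bsub>\<O> X (pts X)\<^esub>,
     add = (\<lambda>g h. \<Union>(U, s)\<in>g. \<Union>(V, t)\<in>h.
       germ X x (U \<inter> V) (res X U (U \<inter> V) s \<oplus>\<^bsub>\<O> X (U \<inter> V)\<^esub> res X V (U \<inter> V) t))\<rparr>"

text \<open>A morphism \<open>X \<rightarrow> Y\<close> consists of a map \<open>base\<close> on points and, for each open \<open>V\<close> of \<open>Y\<close>, a ring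
  homomorphism \<open>comor V\<close> from sections over \<open>V\<close> to sections over the preimage of \<open>V\<close>.\<close>

record ('x, 'r, 'y, 's) rs_mor =
  base :: "'x \<Rightarrow> 'y"
  comor :: "'y set \<Rightarrow> 's \<Rightarrow> 'r"

definition preim ::
    "('x, 'r) ringed_space \<Rightarrow> ('x, 'r, 'y, 's) rs_mor \<Rightarrow> 'y set \<Rightarrow> 'x set" where
  "preim X f V = {x \<in> pts X. base f x \<in> V}"

definition rs_morphism ::
    "('x, 'r) ringed_space \<Rightarrow> ('y, 's) ringed_space \<Rightarrow> ('x, 'r, 'y, 's) rs_mor \<Rightarrow> bool" where
  "rs_morphism X Y f \<longleftrightarrow>
    continuous_map (top_of X) (top_of Y) (base f) \<and>
    (\<forall>V. opn Y V \<longrightarrow> comor f V \<in> ring_hom (\<O> Y V) (\<O> X (preim X f V))) \<and>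
    (\<forall>V W s. opn Y V \<longrightarrow> opn Y W \<longrightarrow> W \<subseteq> V \<longrightarrow> s \<in> carrier (\<O> Y V) \<longrightarrow>
       comor f W (res Y V W s) = res X (preim X f V) (preim X f W) (comor f V s))"

definition rs_iso ::
    "('x, 'r) ringed_space \<Rightarrow> ('y, 's) ringed_space \<Rightarrow> ('x, 'r, 'y, 's) rs_mor \<Rightarrow> bool" where
  "rs_iso X Y f \<longleftrightarrow> rs_morphism X Y f \<and> homeomorphic_map (top_of X) (top_of Y) (base f) \<and>
    (\<forall>V. opn Y V \<longrightarrow> bij_betw (comor f V) (carrier (\<O> Y V)) (carrier (\<O> X (preim X f V))))"

text \<open>The condition that the induced maps on (local) stalks are local homomorphisms.\<close>

definition local_morphism ::
    "('x, 'r) ringed_space \<Rightarrow> ('y, 's) ringed_space \<Rightarrow> ('x, 'r, 'y, 's) rs_mor \<Rightarrow> bool" where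
  "local_morphism X Y f \<longleftrightarrow> rs_morphism X Y f \<and>
    (\<forall>x\<in>pts X. \<forall>V s. opn Y V \<longrightarrow> base f x \<in> V \<longrightarrow> s \<in> carrier (\<O> Y V) \<longrightarrow>
       germ X x (preim X f V) (comor f V s) \<in> Units (stalk X x) \<longrightarrow>
       germ Y (base f x) V s \<in> Units (stalk Y (base f x)))"

text \<open>Equality of morphisms, disregarding values outside the relevant carriers.\<close>

definition mor_eq ::
    "('x, 'r) ringed_space \<Rightarrow> ('y, 's) ringed_space \<Rightarrow>
     ('x, 'r, 'y, 's) rs_mor \<Rightarrow> ('x, 'r, 'y, 's) rs_mor \<Rightarrow> bool" where
  "mor_eq X Y f g \<longleftrightarrow> (\<forall>x\<in>pts X. base f x = base g x) \<and>
    (\<forall>V s. opn Y V \<longrightarrow> s \<in> carrier (\<O> Y V) \<longrightarrow> comor f V s = comor g V s)"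

definition mor_id :: "('x, 'r, 'x, 'r) rs_mor" where
  "mor_id = \<lparr>base = (\<lambda>x. x), comor = (\<lambda>V s. s)\<rparr>"

definition mor_comp ::
    "('y, 's) ringed_space \<Rightarrow> ('y, 's, 'z, 't) rs_mor \<Rightarrow> ('x, 'r, 'y, 's) rs_mor \<Rightarrow>
     ('x, 'r, 'z, 't) rs_mor" where
  "mor_comp Y g f =
    \<lparr>base = base g \<circ> base f, comor = (\<lambda>V. comor f (preim Y g V) \<circ> comor g V)\<rparr>"


section \<open>Schemes\<close>

definition spec_points :: "'a ring \<Rightarrow> 'a set set" where
  "spec_points R = {p. primeideal p R}"

definition zariski_open :: "'a ring \<Rightarrow> 'a set set \<Rightarrow> bool" where
  "zariski_open R U \<longleftrightarrow> (\<exists>E\<subseteq>carrier R. U = {p \<in> spec_points R. \<not> E \<subseteq> p})"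

lemma istopology_zariski_open: "istopology (zariski_open R)"
  unfolding istopology_def
proof (intro conjI allI impI)
  fix U V assume "zariski_open R U" "zariski_open R V"
  then obtain E F where EF: "E \<subseteq> carrier R" "U = {p \<in> spec_points R. \<not> E \<subseteq> p}"
      "F \<subseteq> carrier R" "V = {p \<in> spec_points R. \<not> F \<subseteq> p}"
    unfolding zariski_open_def by blast
  let ?G = "{a \<otimes>\<^bsub>R\<^esub> b | a b. a \<in> E \<and> b \<in> F}"
  have prime: "(\<not> ?G \<subseteq> p) = (\<not> E \<subseteq> p \<and> \<not> F \<subseteq> p)" if "primeideal p R" for p
  proof -
    interpret primeideal p R by (fact that)
    show ?thesis
      using EF(1,3) I_prime I_l_closed I_r_closed by blast
  qed
  have sub: "?G \<subseteq> carrier R" if "primeideal p R" for p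
  proof -
    interpret primeideal p R by (fact that)
    show ?thesis using EF(1,3) by blast
  qed
  show "zariski_open R (U \<inter> V)"
  proof (cases "spec_points R = {}")
    case True
    then show ?thesis unfolding zariski_open_def EF(2,4) by blast
  next
    case False
    then have "?G \<subseteq> carrier R" using sub unfolding spec_points_def by blast
    moreover have "U \<inter> V = {p \<in> spec_points R. \<not> ?G \<subseteq> p}"
    proof (rule Set.set_eqI)
      fix p
      show "p \<in> U \<inter> V \<longleftrightarrow> p \<in> {p \<in> spec_points R. \<not> ?G \<subseteq> p}"
        using prime[of p] unfolding EF(2,4) spec_points_def mem_Collect_eq Int_iff by argo
    qed
    ultimately show ?thesis unfolding zariski_open_def by blast
  qed
next
  fix K assume "\<forall>U\<in>K. zariski_open R U"
  then obtain E where E: "\<And>U. U \<in> K \<Longrightarrow> E U \<subseteq> carrier R \<and> U = {p \<in> spec_points R. \<not> E U \<subseteq> p}"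
    unfolding zariski_open_def by metis
  have "\<Union>K = {p \<in> spec_points R. \<not> (\<Union>U\<in>K. E U) \<subseteq> p}"
    using E by blast
  moreover have "(\<Union>U\<in>K. E U) \<subseteq> carrier R" using E by blast
  ultimately show "zariski_open R (\<Union>K)" unfolding zariski_open_def by blast
qed

abbreviation local_at :: "'a ring \<Rightarrow> 'a set \<Rightarrow> ('a \<times> 'a) set ring" where
  "local_at R p \<equiv> localization R (carrier R - p)"

text \<open>Sections of the structure sheaf over \<open>U\<close>: families of elements of the local rings
  that are locally given by a single fraction $a/f$.\<close>

definition spec_sections :: "'a ring \<Rightarrow> 'a set set \<Rightarrow> ('a set \<Rightarrow> ('a \<times> 'a) set) set" where
  "spec_sections R U = {s \<in> (\<Pi>\<^sub>E p\<in>U. carrier (local_at R p)).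
     \<forall>p\<in>U. \<exists>W a f. zariski_open R W \<and> p \<in> W \<and> W \<subseteq> U \<and> a \<in> carrier R \<and> f \<in> carrier R \<and>
       (\<forall>q\<in>W. f \<notin> q \<and> s q = fraction R (carrier R - q) a f)}"

definition Spec :: "'a ring \<Rightarrow> ('a set, 'a set \<Rightarrow> ('a \<times> 'a) set) ringed_space" where
  "Spec R =
    \<lparr>top_of = topology (zariski_open R),
     \<O> = (\<lambda>U. \<lparr>carrier = spec_sections R U,
                mult = (\<lambda>s t. \<lambda>p\<in>U. s p \<otimes>\<^bsub>local_at R p\<^esub> t p),
                one = (\<lambda>p\<in>U. \<one>\<^bsub>local_at R p\<^esub>),
                zero = (\<lambda>p\<in>U. \<zero>\<^bsub>local_at R p\<^esub>),
                add = (\<lambda>s t. \<lambda>p\<in>U. s p \<oplus>\<^bsub>local_at R p\<^esub> t p)\<rparr>),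
     res = (\<lambda>U V s. restrict s V)\<rparr>"

text \<open>It is no restriction to look for \<open>R\<close> among rings with elements of type \<open>'r\<close>:
  an affine scheme is the spectrum of its ring of global sections.\<close>

definition is_affine :: "('x, 'r) ringed_space \<Rightarrow> bool" where
  "is_affine X \<longleftrightarrow> is_ringed_space X \<and> (\<exists>(R :: 'r ring) f. cring R \<and> rs_iso X (Spec R) f)"

definition affine_open :: "('x, 'r) ringed_space \<Rightarrow> 'x set \<Rightarrow> bool" where
  "affine_open X U \<longleftrightarrow> opn X U \<and> is_affine (open_subspace X U)"

definition is_scheme :: "('x, 'r) ringed_space \<Rightarrow> bool" where
  "is_scheme X \<longleftrightarrow> is_ringed_space X \<and> (\<forall>x\<in>pts X. \<exists>U. x \<in> U \<and> affine_open X U)"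

definition is_fibre_square ::
    "('x, 'r) ringed_space \<Rightarrow> ('y, 's) ringed_space \<Rightarrow> ('x, 'r, 'y, 's) rs_mor \<Rightarrow>
     ('p, 'q) ringed_space \<Rightarrow> ('p, 'q, 'x, 'r) rs_mor \<Rightarrow> ('p, 'q, 'x, 'r) rs_mor \<Rightarrow> bool" where
  "is_fibre_square X S \<pi> P p1 p2 \<longleftrightarrow>
    is_scheme P \<and> local_morphism P X p1 \<and> local_morphism P X p2 \<and>
    mor_eq P S (mor_comp X \<pi> p1) (mor_comp X \<pi> p2) \<and>
    (\<forall>(T :: ('p, 'q) ringed_space) u v.
       is_scheme T \<longrightarrow> local_morphism T X u \<longrightarrow> local_morphism T X v \<longrightarrow>
       mor_eq T S (mor_comp X \<pi> u) (mor_comp X \<pi> v) \<longrightarrow>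
       (\<exists>w. (local_morphism T P w \<and> mor_eq T X (mor_comp P p1 w) u \<and>
                mor_eq T X (mor_comp P p2 w) v) \<and>
            (\<forall>w'. local_morphism T P w' \<and> mor_eq T X (mor_comp P p1 w') u \<and>
                mor_eq T X (mor_comp P p2 w') v \<longrightarrow> mor_eq T P w w')))"

definition closed_immersion ::
    "('x, 'r) ringed_space \<Rightarrow> ('y, 's) ringed_space \<Rightarrow> ('x, 'r, 'y, 's) rs_mor \<Rightarrow> bool" where
  "closed_immersion X Y f \<longleftrightarrow> local_morphism X Y f \<and>
    embedding_map (top_of X) (top_of Y) (base f) \<and> closedin (top_of Y) (base f ` pts X) \<and>
    (\<forall>V s. opn Y V \<longrightarrow> s \<in> carrier (\<O> X (preim X f V)) \<longrightarrow>
       (\<forall>y\<in>V. \<exists>W. opn Y W \<and> y \<in> W \<and> W \<subseteq> V \<and>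
          res X (preim X f V) (preim X f W) s \<in> comor f W ` carrier (\<O> Y W)))"

text \<open>The diagonal $X \to X \times_S X$ is a closed immersion. For \<open>X\<close> of finite type over a field,
  the fibre square is a noetherian scheme covered by finitely many spectra of quotients of
  tensor products of rings of type \<open>'r\<close>; for reasons of cardinality it
  has a copy with points of type \<open>'r list set\<close> and sections of type \<open>'r list\<close>. Hence the
  universal property among spaces of these types characterizes it.\<close>

definition separated_morphism ::
    "('x, 'r) ringed_space \<Rightarrow> ('y, 's) ringed_space \<Rightarrow> ('x, 'r, 'y, 's) rs_mor \<Rightarrow> bool" where
  "separated_morphism X S \<pi> \<longleftrightarrow>
    (\<exists>(P :: ('r list set, 'r list) ringed_space) p1 p2 \<Delta>.
       is_fibre_square X S \<pi> P p1 p2 \<and>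
       mor_eq X X (mor_comp P p1 \<Delta>) mor_id \<and> mor_eq X X (mor_comp P p2 \<Delta>) mor_id \<and>
       closed_immersion X P \<Delta>)"

definition finite_type_morphism ::
    "('x, 'r) ringed_space \<Rightarrow> ('y, 's) ringed_space \<Rightarrow> ('x, 'r, 'y, 's) rs_mor \<Rightarrow> bool" where
  "finite_type_morphism X S \<pi> \<longleftrightarrow>
    (\<exists>\<V>. (\<forall>V\<in>\<V>. affine_open S V) \<and> \<Union>\<V> = pts S \<and>
       (\<forall>V\<in>\<V>. \<exists>\<U>. finite \<U> \<and> (\<forall>U\<in>\<U>. affine_open X U) \<and> \<Union>\<U> = preim X \<pi> V \<and>
          (\<forall>U\<in>\<U>. \<exists>G. finite G \<and> G \<subseteq> carrier (\<O> X U) \<and>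
             carrier (\<O> X U) = generate_ring (\<O> X U)
               ((\<lambda>a. res X (preim X \<pi> V) U (comor \<pi> V a)) ` carrier (\<O> S V) \<union> G))))"

definition normal_scheme :: "('x, 'r) ringed_space \<Rightarrow> bool" where
  "normal_scheme X \<longleftrightarrow> is_scheme X \<and> (\<forall>x\<in>pts X. integrally_closed_domain (stalk X x))"

definition normal_surface ::
    "'k ring \<Rightarrow> ('x, 'r) ringed_space \<Rightarrow>
     ('x, 'r, 'k set, 'k set \<Rightarrow> ('k \<times> 'k) set) rs_mor \<Rightarrow> bool" where
  "normal_surface k X \<pi> \<longleftrightarrow>
    is_scheme X \<and> local_morphism X (Spec k) \<pi> \<and>
    irreducible_subset (top_of X) (pts X) \<and> krull_dim (top_of X) = 2 \<and>
    separated_morphism X (Spec k) \<pi> \<and> normal_scheme X \<and> finite_type_morphism X (Spec k) \<pi>"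


section \<open>Sheaves of modules\<close>

record ('x, 'r, 'm) mod_sheaf =
  sec :: "'x set \<Rightarrow> ('r, 'm) module"
  mres :: "'x set \<Rightarrow> 'x set \<Rightarrow> 'm \<Rightarrow> 'm"

definition sheaf_of_modules ::
    "('x, 'r) ringed_space \<Rightarrow> ('x, 'r, 'm) mod_sheaf \<Rightarrow> bool" where
  "sheaf_of_modules X F \<longleftrightarrow>
    (\<forall>U. opn X U \<longrightarrow> module (\<O> X U) (sec F U)) \<and>
    is_sheaf (top_of X) (\<lambda>U. carrier (sec F U)) (mres F) \<and>
    (\<forall>U V s t. opn X U \<longrightarrow> opn X V \<longrightarrow> V \<subseteq> U \<longrightarrow>
       s \<in> carrier (sec F U) \<longrightarrow> t \<in> carrier (sec F U) \<longrightarrow>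
       mres F U V (s \<oplus>\<^bsub>sec F U\<^esub> t) = mres F U V s \<oplus>\<^bsub>sec F V\<^esub> mres F U V t) \<and>
    (\<forall>U V a s. opn X U \<longrightarrow> opn X V \<longrightarrow> V \<subseteq> U \<longrightarrow>
       a \<in> carrier (\<O> X U) \<longrightarrow> s \<in> carrier (sec F U) \<longrightarrow>
       mres F U V (a \<odot>\<^bsub>sec F U\<^esub> s) = res X U V a \<odot>\<^bsub>sec F V\<^esub> mres F U V s)"

definition structure_module :: "('x, 'r) ringed_space \<Rightarrow> ('x, 'r, 'r) mod_sheaf" where
  "structure_module X =
    \<lparr>sec = (\<lambda>U. \<lparr>carrier = carrier (\<O> X U), mult = mult (\<O> X U), one = one (\<O> X U),
                  zero = zero (\<O> X U), add = add (\<O> X U), smult = mult (\<O> X U)\<rparr>),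
     mres = res X\<rparr>"

text \<open>A homomorphism \<open>h\<close> sends a section \<open>s\<close> over \<open>U\<close> to \<open>h U s\<close>. The normalization by
  \<open>undefined\<close> outside the domain makes equal homomorphisms equal as functions.\<close>

definition hom_ext ::
    "('x, 'r) ringed_space \<Rightarrow> ('x, 'r, 'm) mod_sheaf \<Rightarrow> ('x set \<Rightarrow> 'm \<Rightarrow> 'n) \<Rightarrow> 'x set \<Rightarrow> 'm \<Rightarrow> 'n" where
  "hom_ext X F h = (\<lambda>U s. if opn X U \<and> s \<in> carrier (sec F U) then h U s else undefined)"

definition sheaf_hom ::
    "('x, 'r) ringed_space \<Rightarrow> ('x, 'r, 'm) mod_sheaf \<Rightarrow> ('x, 'r, 'n) mod_sheaf \<Rightarrow>
     ('x set \<Rightarrow> 'm \<Rightarrow> 'n) set" where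
  "sheaf_hom X F G = {h. hom_ext X F h = h \<and>
    (\<forall>U. opn X U \<longrightarrow> h U \<in> carrier (sec F U) \<rightarrow> carrier (sec G U)) \<and>
    (\<forall>U s t. opn X U \<longrightarrow> s \<in> carrier (sec F U) \<longrightarrow> t \<in> carrier (sec F U) \<longrightarrow>
       h U (s \<oplus>\<^bsub>sec F U\<^esub> t) = h U s \<oplus>\<^bsub>sec G U\<^esub> h U t) \<and>
    (\<forall>U a s. opn X U \<longrightarrow> a \<in> carrier (\<O> X U) \<longrightarrow> s \<in> carrier (sec F U) \<longrightarrow>
       h U (a \<odot>\<^bsub>sec F U\<^esub> s) = a \<odot>\<^bsub>sec G U\<^esub> h U s) \<and>
    (\<forall>U V s. opn X U \<longrightarrow> opn X V \<longrightarrow> V \<subseteq> U \<longrightarrow> s \<in> carrier (sec F U) \<longrightarrow>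
       h V (mres F U V s) = mres G U V (h U s))}"

text \<open>The sheaf $F^\vee = \mathcal{H}om(F, \mathcal{O}_X)$; its sections over \<open>U\<close> are the
  homomorphisms from $F|_U$ to $\mathcal{O}_U$. The fields \<open>mult\<close> and \<open>one\<close> of a module record
  carry no meaning.\<close>

definition dual ::
    "('x, 'r) ringed_space \<Rightarrow> ('x, 'r, 'm) mod_sheaf \<Rightarrow> ('x, 'r, 'x set \<Rightarrow> 'm \<Rightarrow> 'r) mod_sheaf" where
  "dual X F =
    \<lparr>sec = (\<lambda>U. \<lparr>carrier = sheaf_hom (open_subspace X U) F (structure_module X),
         mult = undefined, one = undefined,
         zero = hom_ext (open_subspace X U) F (\<lambda>V s. \<zero>\<^bsub>\<O> X V\<^esub>),
         add = (\<lambda>g h. hom_ext (open_subspace X U) F (\<lambda>V s. g V s \<oplus>\<^bsub>\<O> X V\<^esub> h V s)),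
         smult = (\<lambda>a h. hom_ext (open_subspace X U) F (\<lambda>V s. res X U V a \<otimes>\<^bsub>\<O> X V\<^esub> h V s))\<rparr>),
     mres = (\<lambda>U V h. hom_ext (open_subspace X V) F h)\<rparr>"

text \<open>The canonical homomorphism $F \to F^{\vee\vee}$: evaluation of functionals.\<close>

definition to_bidual ::
    "('x, 'r) ringed_space \<Rightarrow> ('x, 'r, 'm) mod_sheaf \<Rightarrow>
     'x set \<Rightarrow> 'm \<Rightarrow> 'x set \<Rightarrow> ('x set \<Rightarrow> 'm \<Rightarrow> 'r) \<Rightarrow> 'r" where
  "to_bidual X F = hom_ext X F
     (\<lambda>U s. hom_ext (open_subspace X U) (dual X F) (\<lambda>V h. h V (mres F U V s)))"

definition sheaf_iso ::
    "('x, 'r) ringed_space \<Rightarrow> ('x, 'r, 'm) mod_sheaf \<Rightarrow> ('x, 'r, 'n) mod_sheaf \<Rightarrow>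
     ('x set \<Rightarrow> 'm \<Rightarrow> 'n) set" where
  "sheaf_iso X F G = {h \<in> sheaf_hom X F G.
     \<forall>U. opn X U \<longrightarrow> bij_betw (h U) (carrier (sec F U)) (carrier (sec G U))}"


subsection \<open>Coherent and reflexive sheaves\<close>

definition finite_type_sheaf ::
    "('x, 'r) ringed_space \<Rightarrow> ('x, 'r, 'm) mod_sheaf \<Rightarrow> bool" where
  "finite_type_sheaf X F \<longleftrightarrow>
    (\<forall>x\<in>pts X. \<exists>U (n::nat) g. opn X U \<and> x \<in> U \<and> g \<in> {..<n} \<rightarrow> carrier (sec F U) \<and>
       (\<forall>V s. opn X V \<longrightarrow> V \<subseteq> U \<longrightarrow> s \<in> carrier (sec F V) \<longrightarrow>
          (\<forall>y\<in>V. \<exists>W a. opn X W \<and> y \<in> W \<and> W \<subseteq> V \<and> a \<in> {..<n} \<rightarrow> carrier (\<O> X W) \<and>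
             mres F V W s = (\<Oplus>\<^bsub>sec F W\<^esub>i\<in>{..<n}. a i \<odot>\<^bsub>sec F W\<^esub> mres F U W (g i)))))"

text \<open>The kernel of the homomorphism $\mathcal{O}_U^n \to F|_U$ defined by $n$ sections \<open>g\<close> over \<open>U\<close>.\<close>

definition relation_sheaf ::
    "('x, 'r) ringed_space \<Rightarrow> ('x, 'r, 'm) mod_sheaf \<Rightarrow> 'x set \<Rightarrow> nat \<Rightarrow> (nat \<Rightarrow> 'm) \<Rightarrow>
     ('x, 'r, nat \<Rightarrow> 'r) mod_sheaf" where
  "relation_sheaf X F U n g =
    \<lparr>sec = (\<lambda>V. \<lparr>carrier = {a \<in> {..<n} \<rightarrow>\<^sub>E carrier (\<O> X V).
            (\<Oplus>\<^bsub>sec F V\<^esub>i\<in>{..<n}. a i \<odot>\<^bsub>sec F V\<^esub> mres F U V (g i)) = \<zero>\<^bsub>sec F V\<^esub>},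
         mult = undefined, one = undefined,
         zero = (\<lambda>i\<in>{..<n}. \<zero>\<^bsub>\<O> X V\<^esub>),
         add = (\<lambda>a b. \<lambda>i\<in>{..<n}. a i \<oplus>\<^bsub>\<O> X V\<^esub> b i),
         smult = (\<lambda>c a. \<lambda>i\<in>{..<n}. c \<otimes>\<^bsub>\<O> X V\<^esub> a i)\<rparr>),
     mres = (\<lambda>V W a. \<lambda>i\<in>{..<n}. res X V W (a i))\<rparr>"

definition coherent_sheaf ::
    "('x, 'r) ringed_space \<Rightarrow> ('x, 'r, 'm) mod_sheaf \<Rightarrow> bool" where
  "coherent_sheaf X F \<longleftrightarrow> sheaf_of_modules X F \<and> finite_type_sheaf X F \<and>
    (\<forall>U n g. opn X U \<longrightarrow> g \<in> {..<n} \<rightarrow> carrier (sec F U) \<longrightarrow>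
       finite_type_sheaf (open_subspace X U) (relation_sheaf X F U n g))"

definition reflexive_sheaf ::
    "('x, 'r) ringed_space \<Rightarrow> ('x, 'r, 'm) mod_sheaf \<Rightarrow> bool" where
  "reflexive_sheaf X F \<longleftrightarrow>
    coherent_sheaf X F \<and> to_bidual X F \<in> sheaf_iso X F (dual X (dual X F))"


section \<open>The center of a category\<close>

text \<open>Data of a category with additive structure on the sets of morphisms;
  \<open>Comp C A B D g f\<close> is the composite of \<open>f : A \<rightarrow> B\<close> and \<open>g : B \<rightarrow> D\<close>.\<close>

record ('o, 'h) precat =
  Obj :: "'o set"
  Hom :: "'o \<Rightarrow> 'o \<Rightarrow> 'h set"
  Comp :: "'o \<Rightarrow> 'o \<Rightarrow> 'o \<Rightarrow> 'h \<Rightarrow> 'h \<Rightarrow> 'h"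
  Ident :: "'o \<Rightarrow> 'h"
  Plus :: "'o \<Rightarrow> 'o \<Rightarrow> 'h \<Rightarrow> 'h \<Rightarrow> 'h"
  Null :: "'o \<Rightarrow> 'o \<Rightarrow> 'h"

text \<open>The ring of natural endomorphisms of the identity functor.\<close>

definition center :: "('o, 'h) precat \<Rightarrow> ('o \<Rightarrow> 'h) ring" where
  "center C =
    \<lparr>carrier = {z \<in> (\<Pi>\<^sub>E A\<in>Obj C. Hom C A A).
        \<forall>A\<in>Obj C. \<forall>B\<in>Obj C. \<forall>f\<in>Hom C A B. Comp C A B B (z B) f = Comp C A A B f (z A)},
     mult = (\<lambda>z w. \<lambda>A\<in>Obj C. Comp C A A A (z A) (w A)),
     one = (\<lambda>A\<in>Obj C. Ident C A),
     zero = (\<lambda>A\<in>Obj C. Null C A A),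
     add = (\<lambda>z w. \<lambda>A\<in>Obj C. Plus C A A (z A) (w A))\<rparr>"

text \<open>The type \<open>'m\<close> of sections of the sheaves plays the role of a universe. For a normal
  surface \<open>X\<close> the type \<open>'r\<close> is infinite (affine coordinate rings of dimension 2 are), and a
  coherent sheaf has at most as many sections over any open set as \<open>'r\<close> has elements, because
  \<open>X\<close> is noetherian. So as soon as \<open>'r\<close> embeds into \<open>'m\<close>, every coherent sheaf on \<open>X\<close> has an
  isomorphic copy with sections of type \<open>'m\<close>.\<close>

definition Ref ::
    "('x, 'r) ringed_space \<Rightarrow> (('x, 'r, 'm) mod_sheaf, 'x set \<Rightarrow> 'm \<Rightarrow> 'm) precat" where
  "Ref X =
    \<lparr>Obj = {F. reflexive_sheaf X F},
     Hom = sheaf_hom X,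
     Comp = (\<lambda>F G H g f. hom_ext X F (\<lambda>U s. g U (f U s))),
     Ident = (\<lambda>F. hom_ext X F (\<lambda>U s. s)),
     Plus = (\<lambda>F G f g. hom_ext X F (\<lambda>U s. f U s \<oplus>\<^bsub>sec G U\<^esub> g U s)),
     Null = (\<lambda>F G. hom_ext X F (\<lambda>U s. \<zero>\<^bsub>sec G U\<^esub>))\<rparr>"

definition scalar_action ::
    "('x, 'r) ringed_space \<Rightarrow> 'r \<Rightarrow> ('x, 'r, 'm) mod_sheaf \<Rightarrow> 'x set \<Rightarrow> 'm \<Rightarrow> 'm" where
  "scalar_action X a = (\<lambda>F\<in>Obj (Ref X).
     hom_ext X F (\<lambda>U s. res X (pts X) U a \<odot>\<^bsub>sec F U\<^esub> s))"

end

theory Submission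
  imports Defs "HOL-Algebra.Ring_Divisibility"
begin

text \<open>
  Let $z$ be in the center, and let it act on the structure sheaf as multiplication by the global
  function $a$. Given a reflexive sheaf $F$ and a section $s$ of $F$ over a nonempty open set $U$,
  consider the conductor $J$: the sections of $J$ over $V$ are the functions $b$ on $V$ for which
  $b s$ extends from $U \cap V$ to $V$. It is isomorphic to the kernel of a homomorphism from the
  reflexive sheaf $\mathcal{O} \oplus F$ to a torsion-free sheaf, and therefore reflexive, and it
  equals $\mathcal{O}$ over $U$. Naturality of $z$ for the inclusion $J \to \mathcal{O}$ and for the
  homomorphism $J \to F$, $b \mapsto b s$, evaluated at $1 \in J(U)$, gives $z_F(s) = a s$.

  All of this works on every integral, locally noetherian scheme. Since sections of reflexive
  sheaves are determined by their restriction to any nonempty open set, no theory of quasi-coherent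
  sheaves is needed for the coherence of $J$: one clears denominators and uses that the ring of
  functions on an affine open set of finite type is noetherian.
\<close>

section \<open>Noetherian rings and modules\<close>

text \<open>A section s over a small open set U is in general not the value at 1 of a homomorphism
  from the structure sheaf, so naturality says nothing about it directly. The conductor is the
  largest ideal sheaf on which multiplication by s makes sense, and the price is to show that it is
  an object of the category. Its reflexivity rests on the two homomorphisms in use: an element of
  its bidual over V goes to a function on V under the inclusion and, under the double transpose of
  multiplication by s, to a section of F over V; over U \<inter> V, where the conductor is
  everything, the second is s times the first, so the function lies in the conductor. Its coherence
  reduces to ideals and modules of relations over the ring of one noetherian open set: a local
  section enters them once multiplied by a function invertible nearby, and membership can be tested
  on a smaller nonempty open set. Since all sheaves of the category have sections of one type, the
  structure sheaf and its ideals enter as copies along an injection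
  \<open>\<epsilon>\<close>.\<close>

text \<open>That a finite set \<open>F\<close> generates \<open>N\<close> is expressed by the minimality of \<open>N\<close> among the submodules
  containing \<open>F\<close>, as for \<open>Idl\<close>.\<close>

definition noetherian_submodule ::
    "('a, 'e) ring_scheme \<Rightarrow> ('a, 'b, 'f) module_scheme \<Rightarrow> 'b set \<Rightarrow> bool" where
  "noetherian_submodule R M V \<longleftrightarrow>
    (\<forall>N. submodule N R M \<longrightarrow> N \<subseteq> V \<longrightarrow>
      (\<exists>F. finite F \<and> F \<subseteq> N \<and> (\<forall>H. submodule H R M \<longrightarrow> F \<subseteq> H \<longrightarrow> N \<subseteq> H)))"

lemma noetherian_submoduleD:
  assumes "noetherian_submodule R M V" "submodule N R M" "N \<subseteq> V"
  obtains F where "finite F" "F \<subseteq> N" "\<And>H. submodule H R M \<Longrightarrow> F \<subseteq> H \<Longrightarrow> N \<subseteq> H"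
  using assms unfolding noetherian_submodule_def by meson

context module
begin

lemma submodule_zero_mem: "submodule H R M \<Longrightarrow> \<zero>\<^bsub>M\<^esub> \<in> H"
  using submoduleE(2,4)[of H] smult_l_null submoduleE(1)[of H] R.zero_closed
  by (metis all_not_in_conv subsetD)

lemma submodule_minus_mem:
  "submodule H R M \<Longrightarrow> a \<in> H \<Longrightarrow> b \<in> H \<Longrightarrow> a \<ominus>\<^bsub>M\<^esub> b \<in> H"
  using submoduleE(3,5)[of H] by (simp add: M.minus_eq)

lemma submodule_singleton_zero: "submodule {\<zero>\<^bsub>M\<^esub>} R M"
  by (rule submoduleI) auto

lemma noetherian_submodule_zero: "noetherian_submodule R M {\<zero>\<^bsub>M\<^esub>}"
  unfolding noetherian_submodule_def
proof (intro allI impI)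
  fix N assume "submodule N R M" "N \<subseteq> {\<zero>\<^bsub>M\<^esub>}"
  then show "\<exists>F. finite F \<and> F \<subseteq> N \<and> (\<forall>H. submodule H R M \<longrightarrow> F \<subseteq> H \<longrightarrow> N \<subseteq> H)"
    by (intro exI[of _ "{}"]) (use submodule_zero_mem in auto)
qed

lemma submodule_Int: "submodule H R M \<Longrightarrow> submodule K R M \<Longrightarrow> submodule (H \<inter> K) R M"
  by (rule submoduleI) (use submoduleE submodule_zero_mem in auto)

lemma submodule_extend:
  assumes V: "submodule V R M" and e: "e \<in> carrier M"
  shows "submodule {v \<oplus>\<^bsub>M\<^esub> b \<odot>\<^bsub>M\<^esub> e | v b. v \<in> V \<and> b \<in> carrier R} R M" (is "submodule ?W R M")
proof (rule submoduleI)
  have c: "v \<in> V \<Longrightarrow> v \<in> carrier M" for v using submoduleE(1)[OF V] by auto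
  show "?W \<subseteq> carrier M" using c e by auto
  show "\<zero>\<^bsub>M\<^esub> \<in> ?W"
    using submodule_zero_mem[OF V] e by (auto intro!: exI[of _ "\<zero>\<^bsub>M\<^esub>"] exI[of _ "\<zero>"])
  show "\<ominus>\<^bsub>M\<^esub> a \<in> ?W" if "a \<in> ?W" for a
  proof -
    from that obtain v b where a: "a = v \<oplus>\<^bsub>M\<^esub> b \<odot>\<^bsub>M\<^esub> e" "v \<in> V" "b \<in> carrier R" by auto
    have "\<ominus>\<^bsub>M\<^esub> a = (\<ominus>\<^bsub>M\<^esub> v) \<oplus>\<^bsub>M\<^esub> (\<ominus> b) \<odot>\<^bsub>M\<^esub> e"
      using a c[OF a(2)] e by (simp add: M.minus_add smult_l_minus)
    then show ?thesis using a submoduleE(3)[OF V] by blast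
  qed
  show "a \<oplus>\<^bsub>M\<^esub> a' \<in> ?W" if "a \<in> ?W" "a' \<in> ?W" for a a'
  proof -
    from that obtain v b v' b' where a: "a = v \<oplus>\<^bsub>M\<^esub> b \<odot>\<^bsub>M\<^esub> e" "v \<in> V" "b \<in> carrier R"
      "a' = v' \<oplus>\<^bsub>M\<^esub> b' \<odot>\<^bsub>M\<^esub> e" "v' \<in> V" "b' \<in> carrier R" by auto
    have "a \<oplus>\<^bsub>M\<^esub> a' = (v \<oplus>\<^bsub>M\<^esub> v') \<oplus>\<^bsub>M\<^esub> (b \<oplus> b') \<odot>\<^bsub>M\<^esub> e"
      using a c e by (simp add: smult_l_distr M.a_ac)
    then show ?thesis using a submoduleE(5)[OF V] by blast
  qed
  show "r \<odot>\<^bsub>M\<^esub> a \<in> ?W" if "r \<in> carrier R" "a \<in> ?W" for r a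
  proof -
    from that obtain v b where a: "a = v \<oplus>\<^bsub>M\<^esub> b \<odot>\<^bsub>M\<^esub> e" "v \<in> V" "b \<in> carrier R" by auto
    have "r \<odot>\<^bsub>M\<^esub> a = (r \<odot>\<^bsub>M\<^esub> v) \<oplus>\<^bsub>M\<^esub> (r \<otimes> b) \<odot>\<^bsub>M\<^esub> e"
      using a c[OF a(2)] e that by (simp add: smult_r_distr smult_assoc1)
    then show ?thesis using a submoduleE(4)[OF V] that by blast
  qed
qed

text \<open>The argument for an extension by a cyclic module, without forming the quotient: N is
  generated by generators of N \<inter> V together with lifts of generators of the ideal of those b
  that occur as coefficients of e in N. The sum V + R e may fail to be direct, so coefficients are
  not unique and the ideal collects all of them.\<close>

lemma noetherian_submodule_extend:
  assumes R: "noetherian_ring R" and V: "submodule V R M" and nV: "noetherian_submodule R M V"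
    and e: "e \<in> carrier M"
  shows "noetherian_submodule R M {v \<oplus>\<^bsub>M\<^esub> b \<odot>\<^bsub>M\<^esub> e | v b. v \<in> V \<and> b \<in> carrier R}"
  unfolding noetherian_submodule_def
proof (intro allI impI)
  fix N assume N: "submodule N R M" "N \<subseteq> {v \<oplus>\<^bsub>M\<^esub> b \<odot>\<^bsub>M\<^esub> e | v b. v \<in> V \<and> b \<in> carrier R}"
  interpret noetherian_ring R by fact
  have c: "v \<in> V \<Longrightarrow> v \<in> carrier M" for v using submoduleE(1)[OF V] by auto
  \<comment> \<open>For arbitrary K, because the ideal is formed for N and, below, for H \<inter>
    N.\<close>
  have coeff_ideal: "ideal {b \<in> carrier R. \<exists>v\<in>V. v \<oplus>\<^bsub>M\<^esub> b \<odot>\<^bsub>M\<^esub> e \<in> K} R"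
    if K: "submodule K R M" for K
  proof (rule idealI)
    let ?I = "{b \<in> carrier R. \<exists>v\<in>V. v \<oplus>\<^bsub>M\<^esub> b \<odot>\<^bsub>M\<^esub> e \<in> K}"
    show "ring R" by (rule R.ring_axioms)
    have sm: "r \<otimes> b \<in> ?I" if "b \<in> ?I" "r \<in> carrier R" for r b
    proof -
      from that obtain v where v: "v \<in> V" "v \<oplus>\<^bsub>M\<^esub> b \<odot>\<^bsub>M\<^esub> e \<in> K" and b: "b \<in> carrier R" by auto
      have "r \<odot>\<^bsub>M\<^esub> v \<oplus>\<^bsub>M\<^esub> (r \<otimes> b) \<odot>\<^bsub>M\<^esub> e = r \<odot>\<^bsub>M\<^esub> (v \<oplus>\<^bsub>M\<^esub> b \<odot>\<^bsub>M\<^esub> e)"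
        using v c b e that by (simp add: smult_r_distr smult_assoc1)
      also have "\<dots> \<in> K" using submoduleE(4)[OF K] v that by blast
      finally show ?thesis using submoduleE(4)[OF V] v that b by blast
    qed
    then show "r \<otimes> b \<in> ?I" "b \<otimes> r \<in> ?I" if "b \<in> ?I" "r \<in> carrier R" for r b
      using that by (auto simp: m_comm)
    have add: "b \<oplus> b' \<in> ?I" if h: "b \<in> ?I" "b' \<in> ?I" for b b'
    proof -
      from h obtain v v' where v: "v \<in> V" "v \<oplus>\<^bsub>M\<^esub> b \<odot>\<^bsub>M\<^esub> e \<in> K" "v' \<in> V" "v' \<oplus>\<^bsub>M\<^esub> b' \<odot>\<^bsub>M\<^esub> e \<in> K"
        and b: "b \<in> carrier R" "b' \<in> carrier R" by auto
      have "(v \<oplus>\<^bsub>M\<^esub> v') \<oplus>\<^bsub>M\<^esub> (b \<oplus> b') \<odot>\<^bsub>M\<^esub> e = (v \<oplus>\<^bsub>M\<^esub> b \<odot>\<^bsub>M\<^esub> e) \<oplus>\<^bsub>M\<^esub> (v' \<oplus>\<^bsub>M\<^esub> b' \<odot>\<^bsub>M\<^esub> e)"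
        using v c b e by (simp add: smult_l_distr M.a_ac)
      also have "\<dots> \<in> K" using submoduleE(5)[OF K] v by blast
      finally show ?thesis using submoduleE(5)[OF V] v b by blast
    qed
    show "subgroup ?I (add_monoid R)"
    proof (rule R.add.subgroupI)
      show "?I \<noteq> {}"
      proof -
        have "\<zero>\<^bsub>M\<^esub> \<oplus>\<^bsub>M\<^esub> \<zero> \<odot>\<^bsub>M\<^esub> e \<in> K" using submodule_zero_mem[OF K] e by simp
        then show ?thesis using submodule_zero_mem[OF V] by blast
      qed
      show "\<ominus> b \<in> ?I" if "b \<in> ?I" for b
      proof -
        have "\<ominus> b = (\<ominus> \<one>) \<otimes> b" using that by (simp add: l_minus)
        then show ?thesis using sm[OF that, of "\<ominus> \<one>"] by simp
      qed
      show "?I \<subseteq> carrier R" by auto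
      show "b \<oplus> b' \<in> ?I" if "b \<in> ?I" "b' \<in> ?I" for b b'
        by (rule add[OF that])
    qed
  qed
  let ?I = "\<lambda>K. {b \<in> carrier R. \<exists>v\<in>V. v \<oplus>\<^bsub>M\<^esub> b \<odot>\<^bsub>M\<^esub> e \<in> K}"
  obtain A where A: "finite A" "A \<subseteq> carrier R" "?I N = Idl A"
    using finetely_gen[OF coeff_ideal[OF N(1)]] by blast
  have "\<forall>a\<in>A. \<exists>v\<in>V. v \<oplus>\<^bsub>M\<^esub> a \<odot>\<^bsub>M\<^esub> e \<in> N"
    using genideal_self[OF A(2)] A(3) by blast
  then obtain w where w: "\<And>a. a \<in> A \<Longrightarrow> w a \<in> V \<and> w a \<oplus>\<^bsub>M\<^esub> a \<odot>\<^bsub>M\<^esub> e \<in> N" by metis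
  obtain F where F: "finite F" "F \<subseteq> N \<inter> V" "\<And>H. submodule H R M \<Longrightarrow> F \<subseteq> H \<Longrightarrow> N \<inter> V \<subseteq> H"
    using noetherian_submoduleD[OF nV submodule_Int[OF N(1) V]] by blast
  let ?F = "F \<union> (\<lambda>a. w a \<oplus>\<^bsub>M\<^esub> a \<odot>\<^bsub>M\<^esub> e) ` A"
  have "N \<subseteq> H" if H: "submodule H R M" "?F \<subseteq> H" for H
  proof
    fix n assume n: "n \<in> N"
    then obtain v b where vb: "n = v \<oplus>\<^bsub>M\<^esub> b \<odot>\<^bsub>M\<^esub> e" "v \<in> V" "b \<in> carrier R" using N(2) by blast
    \<comment> \<open>With H \<inter> N in place of H the element with the same coefficient as n
      lies in N too, so that its difference from n lands in N \<inter> V, over which F has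
      control.\<close>
    have HN: "submodule (H \<inter> N) R M" by (rule submodule_Int[OF H(1) N(1)])
    have "A \<subseteq> ?I (H \<inter> N)" using w H(2) A(2) by blast
    then have "Idl A \<subseteq> ?I (H \<inter> N)" by (rule genideal_minimal[OF coeff_ideal[OF HN]])
    moreover have "b \<in> Idl A" using A(3) vb n by blast
    ultimately obtain v' where v': "v' \<in> V" "v' \<oplus>\<^bsub>M\<^esub> b \<odot>\<^bsub>M\<^esub> e \<in> H \<inter> N" by blast
    let ?y = "v' \<oplus>\<^bsub>M\<^esub> b \<odot>\<^bsub>M\<^esub> e"
    have d: "n \<ominus>\<^bsub>M\<^esub> ?y = v \<ominus>\<^bsub>M\<^esub> v'"
    proof -
      have "n \<ominus>\<^bsub>M\<^esub> ?y = (v \<ominus>\<^bsub>M\<^esub> v') \<oplus>\<^bsub>M\<^esub> (b \<odot>\<^bsub>M\<^esub> e \<ominus>\<^bsub>M\<^esub> b \<odot>\<^bsub>M\<^esub> e)"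
        using vb v' c e by (simp add: M.minus_eq M.minus_add M.a_ac)
      then show ?thesis using vb v' c e by (simp add: M.minus_eq M.r_neg)
    qed
    have "n \<ominus>\<^bsub>M\<^esub> ?y \<in> N" using submodule_minus_mem[OF N(1) n] v' by blast
    moreover have "v \<ominus>\<^bsub>M\<^esub> v' \<in> V" using submodule_minus_mem[OF V] vb v' by blast
    ultimately have "n \<ominus>\<^bsub>M\<^esub> ?y \<in> H" using F(3)[OF H(1)] H(2) d by auto
    then have "(n \<ominus>\<^bsub>M\<^esub> ?y) \<oplus>\<^bsub>M\<^esub> ?y \<in> H" using submoduleE(5)[OF H(1)] v' by blast
    moreover have "(n \<ominus>\<^bsub>M\<^esub> ?y) \<oplus>\<^bsub>M\<^esub> ?y = n"
      using vb v' c e by (simp add: M.minus_eq M.a_assoc M.l_neg)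
    ultimately show "n \<in> H" by simp
  qed
  moreover have "finite ?F" "?F \<subseteq> N" using F w A(1) by auto
  ultimately show "\<exists>F. finite F \<and> F \<subseteq> N \<and> (\<forall>H. submodule H R M \<longrightarrow> F \<subseteq> H \<longrightarrow> N \<subseteq> H)"
    by blast
qed

lemma submodule_combinations:
  assumes g: "g \<in> {..<m::nat} \<rightarrow> carrier M"
  shows "submodule {\<Oplus>\<^bsub>M\<^esub>j\<in>{..<m}. a j \<odot>\<^bsub>M\<^esub> g j | a. a \<in> {..<m} \<rightarrow> carrier R} R M"
    (is "submodule ?H R M")
proof (rule submoduleI)
  have t: "(\<lambda>j. a j \<odot>\<^bsub>M\<^esub> g j) \<in> {..<m} \<rightarrow> carrier M" if "a \<in> {..<m} \<rightarrow> carrier R" for a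
    using g that by auto
  show "?H \<subseteq> carrier M" using t by (auto intro!: M.finsum_closed)
  have sm: "r \<odot>\<^bsub>M\<^esub> x \<in> ?H" if "r \<in> carrier R" "x \<in> ?H" for r x
  proof -
    from that obtain a where a: "a \<in> {..<m} \<rightarrow> carrier R" "x = (\<Oplus>\<^bsub>M\<^esub>j\<in>{..<m}. a j \<odot>\<^bsub>M\<^esub> g j)"
      by auto
    have "r \<odot>\<^bsub>M\<^esub> x = (\<Oplus>\<^bsub>M\<^esub>j\<in>{..<m}. r \<odot>\<^bsub>M\<^esub> (a j \<odot>\<^bsub>M\<^esub> g j))"
      unfolding a(2) by (rule finsum_smult_ldistr) (use t[OF a(1)] that in auto)
    also have "\<dots> = (\<Oplus>\<^bsub>M\<^esub>j\<in>{..<m}. (r \<otimes> a j) \<odot>\<^bsub>M\<^esub> g j)"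
      by (rule M.finsum_cong') (use a g that in \<open>auto simp: smult_assoc1 Pi_iff\<close>)
    finally show ?thesis using a(1) that(1) by (fastforce intro: exI[of _ "\<lambda>j. r \<otimes> a j"])
  qed
  show "r \<odot>\<^bsub>M\<^esub> x \<in> ?H" if "r \<in> carrier R" "x \<in> ?H" for r x by (rule sm[OF that])
  show "\<zero>\<^bsub>M\<^esub> \<in> ?H"
  proof -
    have "(\<Oplus>\<^bsub>M\<^esub>j\<in>{..<m}. \<zero> \<odot>\<^bsub>M\<^esub> g j) = (\<Oplus>\<^bsub>M\<^esub>j\<in>{..<m}. \<zero>\<^bsub>M\<^esub>)"
      by (rule M.finsum_cong') (use g in \<open>auto simp: Pi_iff\<close>)
    then have "\<zero>\<^bsub>M\<^esub> = (\<Oplus>\<^bsub>M\<^esub>j\<in>{..<m}. \<zero> \<odot>\<^bsub>M\<^esub> g j)" by (simp add: M.finsum_zero)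
    then show ?thesis by (auto intro!: exI[of _ "\<lambda>j. \<zero>"])
  qed
  show "\<ominus>\<^bsub>M\<^esub> x \<in> ?H" if "x \<in> ?H" for x
  proof -
    have "x \<in> carrier M" using that t by (auto intro!: M.finsum_closed)
    then have "\<ominus>\<^bsub>M\<^esub> x = (\<ominus> \<one>) \<odot>\<^bsub>M\<^esub> x" by (simp add: smult_l_minus)
    then show ?thesis using sm[OF _ that, of "\<ominus> \<one>"] by simp
  qed
  show "x \<oplus>\<^bsub>M\<^esub> y \<in> ?H" if xy: "x \<in> ?H" "y \<in> ?H" for x y
  proof -
    from xy obtain a b where a: "a \<in> {..<m} \<rightarrow> carrier R" "x = (\<Oplus>\<^bsub>M\<^esub>j\<in>{..<m}. a j \<odot>\<^bsub>M\<^esub> g j)"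
      and b: "b \<in> {..<m} \<rightarrow> carrier R" "y = (\<Oplus>\<^bsub>M\<^esub>j\<in>{..<m}. b j \<odot>\<^bsub>M\<^esub> g j)" by auto
    have "x \<oplus>\<^bsub>M\<^esub> y = (\<Oplus>\<^bsub>M\<^esub>j\<in>{..<m}. a j \<odot>\<^bsub>M\<^esub> g j \<oplus>\<^bsub>M\<^esub> b j \<odot>\<^bsub>M\<^esub> g j)"
      unfolding a(2) b(2) by (rule M.finsum_addf[symmetric]) (use t a b in auto)
    also have "\<dots> = (\<Oplus>\<^bsub>M\<^esub>j\<in>{..<m}. (a j \<oplus> b j) \<odot>\<^bsub>M\<^esub> g j)"
      by (rule M.finsum_cong') (use a b g in \<open>auto simp: smult_l_distr Pi_iff\<close>)
    finally show ?thesis using a(1) b(1) by (fastforce intro: exI[of _ "\<lambda>j. a j \<oplus> b j"])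
  qed
qed

lemma combination_generator:
  assumes g: "g \<in> {..<m::nat} \<rightarrow> carrier M" and j: "j < m"
  shows "g j = (\<Oplus>\<^bsub>M\<^esub>i\<in>{..<m}. (if i = j then \<one> else \<zero>) \<odot>\<^bsub>M\<^esub> g i)"
proof -
  have "(\<Oplus>\<^bsub>M\<^esub>i\<in>{..<m}. (if i = j then \<one> else \<zero>) \<odot>\<^bsub>M\<^esub> g i)
      = (\<Oplus>\<^bsub>M\<^esub>i\<in>{..<m}. if j = i then g i else \<zero>\<^bsub>M\<^esub>)"
    by (rule M.finsum_cong') (use g in \<open>auto simp: Pi_iff\<close>)
  also have "\<dots> = g j" by (rule M.add.finprod_singleton) (use g j in auto)
  finally show ?thesis by simp
qed

text \<open>Minimality is tested against the submodule of all linear combinations of an enumeration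
  of F. Explicit combinations are the form that \<open>finite_type_sheaf\<close> asks for.\<close>

lemma noetherian_submodule_generators:
  assumes "noetherian_submodule R M V" "submodule N R M" "N \<subseteq> V"
  obtains m :: nat and g where "g \<in> {..<m} \<rightarrow> N"
    "\<And>t. t \<in> N \<Longrightarrow> \<exists>a \<in> {..<m} \<rightarrow> carrier R. t = (\<Oplus>\<^bsub>M\<^esub>j\<in>{..<m}. a j \<odot>\<^bsub>M\<^esub> g j)"
proof -
  obtain F where F: "finite F" "F \<subseteq> N" "\<And>H. submodule H R M \<Longrightarrow> F \<subseteq> H \<Longrightarrow> N \<subseteq> H"
    using noetherian_submoduleD[OF assms] by blast
  obtain g where g: "bij_betw g {0..<card F} F" using ex_bij_betw_nat_finite[OF F(1)] by blast
  then have img: "g ` {..<card F} = F" by (simp add: bij_betw_def atLeast0LessThan)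
  then have gN: "g \<in> {..<card F} \<rightarrow> N" using F(2) by auto
  then have gM: "g \<in> {..<card F} \<rightarrow> carrier M" using submoduleE(1)[OF assms(2)] by auto
  let ?H = "{\<Oplus>\<^bsub>M\<^esub>j\<in>{..<card F}. a j \<odot>\<^bsub>M\<^esub> g j | a. a \<in> {..<card F} \<rightarrow> carrier R}"
  have "F \<subseteq> ?H"
  proof
    fix x assume "x \<in> F"
    then obtain j where j: "j < card F" "x = g j" using img by auto
    show "x \<in> ?H" unfolding j(2)
      by (subst combination_generator[OF gM j(1)]) (auto intro!: exI[of _ "\<lambda>i. if i = j then \<one> else \<zero>"])
  qed
  then have "N \<subseteq> ?H" by (rule F(3)[OF submodule_combinations[OF gM]])
  then show thesis using that[OF gN] by blast
qed

end

section \<open>Hilbert's basis theorem\<close>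

definition self_module :: "('a, 'e) ring_scheme \<Rightarrow> ('a, 'a) module" where
  "self_module A = \<lparr>carrier = carrier A, monoid.mult = monoid.mult A, one = one A, zero = zero A, add = add A,
     smult = monoid.mult A\<rparr>"

lemma self_module_simps [simp]:
  "carrier (self_module A) = carrier A" "\<zero>\<^bsub>self_module A\<^esub> = \<zero>\<^bsub>A\<^esub>"
  "x \<oplus>\<^bsub>self_module A\<^esub> y = x \<oplus>\<^bsub>A\<^esub> y" "x \<odot>\<^bsub>self_module A\<^esub> y = x \<otimes>\<^bsub>A\<^esub> y"
  by (simp_all add: self_module_def)

text \<open>A module record does not contain its scalars, so the one record
  \<open>self_module R\<close> is a module over every subring B, and B may vary while the elements
  stay in R.\<close>

lemma (in cring) module_self_module:
  assumes B: "subring B R"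
  shows "module (R\<lparr>carrier := B\<rparr>) (self_module R)"
proof (rule moduleI)
  have sub: "B \<subseteq> carrier R" by (rule subringE(1)[OF B])
  show "cring (R\<lparr>carrier := B\<rparr>)"
    using subcring_iff[OF sub] subcringI'[OF B] by simp
  show "abelian_group (self_module R)"
    by (rule abelian_groupI) (auto simp: a_ac intro: bexI[of _ "\<ominus> x" for x] l_neg)
qed (use subringE(1)[OF B] in \<open>auto simp: l_distr r_distr m_assoc subset_iff\<close>)

context cring
begin

text \<open>The values at x of the polynomials over B of degree below d, the strict bound making
  index 0 the zero module. Working with values avoids polynomial rings; x may well be algebraic over
  B, and coefficients are then not unique.\<close>

primrec poly_span :: "'a set \<Rightarrow> 'a \<Rightarrow> nat \<Rightarrow> 'a set" where
  "poly_span B x 0 = {\<zero>}"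
| "poly_span B x (Suc d) = {v \<oplus> b \<otimes> x [^] d | v b. v \<in> poly_span B x d \<and> b \<in> B}"

context
  fixes B x
  assumes B: "subring B R" and x: "x \<in> carrier R"
begin

interpretation BM: module "R\<lparr>carrier := B\<rparr>" "self_module R"
  by (rule module_self_module[OF B])

lemma poly_span_submodule: "submodule (poly_span B x d) (R\<lparr>carrier := B\<rparr>) (self_module R)"
proof (induction d)
  case 0
  show ?case using BM.submodule_singleton_zero by simp
next
  case (Suc d)
  show ?case using BM.submodule_extend[OF Suc, of "x [^] d"] x by simp
qed

lemma poly_span_noetherian:
  assumes "noetherian_ring (R\<lparr>carrier := B\<rparr>)"
  shows "noetherian_submodule (R\<lparr>carrier := B\<rparr>) (self_module R) (poly_span B x d)"
proof (induction d)
  case 0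
  show ?case using BM.noetherian_submodule_zero by simp
next
  case (Suc d)
  show ?case
    using BM.noetherian_submodule_extend[OF assms poly_span_submodule Suc, of "x [^] d"] x by simp
qed

lemma poly_span_carrier: "v \<in> poly_span B x d \<Longrightarrow> v \<in> carrier R"
  using BM.submoduleE(1)[OF poly_span_submodule] by auto

lemma poly_span_zero: "\<zero> \<in> poly_span B x d"
  using BM.submodule_zero_mem[OF poly_span_submodule] by simp

lemma poly_span_add: "v \<in> poly_span B x d \<Longrightarrow> w \<in> poly_span B x d \<Longrightarrow> v \<oplus> w \<in> poly_span B x d"
  using BM.submoduleE(5)[OF poly_span_submodule] by simp

lemma poly_span_smult: "b \<in> B \<Longrightarrow> w \<in> poly_span B x d \<Longrightarrow> b \<otimes> w \<in> poly_span B x d"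
  using BM.submoduleE(4)[OF poly_span_submodule] by simp

lemma poly_span_uminus: "w \<in> poly_span B x d \<Longrightarrow> \<ominus> w \<in> poly_span B x d"
  using poly_span_smult[of "\<ominus> \<one>" w d] subringE(3,5)[OF B] poly_span_carrier by (simp add: l_minus)

lemma poly_span_Suc: "v \<in> poly_span B x d \<Longrightarrow> v \<in> poly_span B x (Suc d)"
proof -
  assume v: "v \<in> poly_span B x d"
  then have "v = v \<oplus> \<zero> \<otimes> x [^] d" using x poly_span_carrier by simp
  then show ?thesis using v subringE(2)[OF B] by auto
qed

lemma poly_span_mono: "d \<le> e \<Longrightarrow> v \<in> poly_span B x d \<Longrightarrow> v \<in> poly_span B x e"
  by (induction rule: dec_induct) (use poly_span_Suc in blast)+

lemma poly_span_shift: "v \<in> poly_span B x d \<Longrightarrow> x \<otimes> v \<in> poly_span B x (Suc d)"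
proof (induction d arbitrary: v)
  case 0
  then show ?case using x poly_span_zero[of "Suc 0"] by simp
next
  case (Suc d)
  then obtain w b where w: "v = w \<oplus> b \<otimes> x [^] d" "w \<in> poly_span B x d" "b \<in> B" by auto
  have bR: "b \<in> carrier R" using w subringE(1)[OF B] by auto
  have "x \<otimes> v = x \<otimes> w \<oplus> b \<otimes> x [^] Suc d"
    using w bR x poly_span_carrier[OF w(2)] by (simp add: r_distr m_ac)
  then show ?case using Suc.IH[OF w(2)] w(3) by auto
qed

lemma poly_span_pow_shift: "v \<in> poly_span B x d \<Longrightarrow> x [^] k \<otimes> v \<in> poly_span B x (d + k)" for k :: nat
proof (induction k)
  case 0
  then show ?case using poly_span_carrier by simp
next
  case (Suc k)
  have "x [^] Suc k \<otimes> v = x \<otimes> (x [^] k \<otimes> v)"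
    using x poly_span_carrier[OF Suc.prems] by (simp add: m_ac)
  then show ?case using poly_span_shift[OF Suc.IH[OF Suc.prems]] by simp
qed

text \<open>Index d + e - 1 would do for positive d and e; the coarser bound keeps the induction
  free of a case distinction at 0.\<close>

lemma poly_span_mult:
  "v \<in> poly_span B x d \<Longrightarrow> w \<in> poly_span B x e \<Longrightarrow> v \<otimes> w \<in> poly_span B x (d + e)"
proof (induction d arbitrary: v)
  case 0
  then show ?case using poly_span_zero poly_span_carrier by simp
next
  case (Suc d)
  then obtain u b where u: "v = u \<oplus> b \<otimes> x [^] d" "u \<in> poly_span B x d" "b \<in> B" by auto
  have c: "u \<in> carrier R" "b \<in> carrier R" "w \<in> carrier R"
    using u subringE(1)[OF B] poly_span_carrier Suc.prems by auto
  have "v \<otimes> w = u \<otimes> w \<oplus> b \<otimes> (x [^] d \<otimes> w)" using u c x by (simp add: l_distr m_assoc)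
  moreover have "u \<otimes> w \<in> poly_span B x (Suc (d + e))"
    by (rule poly_span_Suc, rule Suc.IH[OF u(2) Suc.prems(2)])
  moreover have "b \<otimes> (x [^] d \<otimes> w) \<in> poly_span B x (Suc (d + e))"
    using poly_span_smult[OF u(3) poly_span_pow_shift[OF Suc.prems(2), of d]] poly_span_Suc
    by (simp add: add.commute)
  ultimately show ?case using poly_span_add by (simp del: poly_span.simps)
qed

text \<open>The union is B[x]; that it is a subring bounds the ring generated by B and x from
  above.\<close>

lemma subring_poly_span: "subring (\<Union>d. poly_span B x d) R"
proof (rule subringI)
  have max: "v \<in> poly_span B x (max d e)" if "v \<in> poly_span B x d \<or> v \<in> poly_span B x e" for v d e
    using that poly_span_mono[of d "max d e" v] poly_span_mono[of e "max d e" v] by auto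
  show "(\<Union>d. poly_span B x d) \<subseteq> carrier R" using poly_span_carrier by auto
  have "\<one> = \<zero> \<oplus> \<one> \<otimes> x [^] (0::nat)" by simp
  then have "\<one> \<in> poly_span B x (Suc 0)" using subringE(3)[OF B] unfolding poly_span.simps by blast
  then show "\<one> \<in> (\<Union>d. poly_span B x d)" by blast
  show "\<And>h. h \<in> (\<Union>d. poly_span B x d) \<Longrightarrow> \<ominus> h \<in> (\<Union>d. poly_span B x d)"
    using poly_span_uminus by blast
  show "h1 \<otimes> h2 \<in> (\<Union>d. poly_span B x d)"
    if "h1 \<in> (\<Union>d. poly_span B x d)" "h2 \<in> (\<Union>d. poly_span B x d)" for h1 h2
    using that poly_span_mult by blast
  show "h1 \<oplus> h2 \<in> (\<Union>d. poly_span B x d)"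
    if "h1 \<in> (\<Union>d. poly_span B x d)" "h2 \<in> (\<Union>d. poly_span B x d)" for h1 h2
  proof -
    from that obtain d e where "h1 \<in> poly_span B x d" "h2 \<in> poly_span B x e" by auto
    then have "h1 \<oplus> h2 \<in> poly_span B x (max d e)" using max poly_span_add by blast
    then show ?thesis by blast
  qed
qed

lemma poly_span_base: "b \<in> B \<Longrightarrow> b \<in> poly_span B x (Suc 0)"
proof -
  assume b: "b \<in> B"
  then have "b = \<zero> \<oplus> b \<otimes> x [^] (0::nat)" using subringE(1)[OF B] by auto
  then show ?thesis using b by auto
qed

lemma poly_span_var: "x \<in> poly_span B x (Suc (Suc 0))"
proof -
  have "x = \<zero> \<oplus> \<one> \<otimes> x [^] Suc 0" using x by simp
  moreover have "\<zero> \<in> poly_span B x (Suc 0)" by (rule poly_span_zero)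
  ultimately show ?thesis using subringE(3)[OF B] unfolding poly_span.simps(2)[of B x "Suc 0"] by blast
qed

text \<open>Hilbert's basis theorem: \<open>L d\<close> below is the ideal of leading coefficients of the elements of
  degree at most \<open>d\<close> in an ideal of \<open>B[x]\<close>.\<close>

lemma noetherian_ring_adjoin:
  assumes nB: "noetherian_ring (R\<lparr>carrier := B\<rparr>)" and C: "subring C R" and BC: "B \<subseteq> C" and xC: "x \<in> C"
    and CV: "C \<subseteq> (\<Union>d. poly_span B x d)"
  shows "noetherian_ring (R\<lparr>carrier := C\<rparr>)"
proof -
  interpret BN: noetherian_ring "R\<lparr>carrier := B\<rparr>" by fact
  interpret CR: ring "R\<lparr>carrier := C\<rparr>" using subring_iff[OF subringE(1)[OF C]] C by simp
  have powC: "x [^] k \<in> C" for k :: nat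
    by (induction k) (use subringE(3,6)[OF C] xC in auto)
  show ?thesis
  proof (rule CR.noetherian_ringI)
    fix I assume I: "ideal I (R\<lparr>carrier := C\<rparr>)"
    interpret I: ideal I "R\<lparr>carrier := C\<rparr>" by fact
    have IC: "I \<subseteq> C" using I.a_subset by simp
    have Ic: "y \<in> I \<Longrightarrow> y \<in> carrier R" for y using IC subringE(1)[OF C] by auto
    have Iadd: "y \<oplus> z \<in> I" if "y \<in> I" "z \<in> I" for y z using I.a_closed[OF that] by simp
    have Imult: "c \<otimes> y \<in> I" if "c \<in> C" "y \<in> I" for c y using I.I_l_closed[OF that(2), of c] that by simp
    have I0: "\<zero> \<in> I" using I.zero_closed by simp
    \<comment> \<open>Seen as a B-module, an ideal of C can be cut down to bounded degree and
      compared with the noetherian modules \<open>poly_span B x d\<close>.\<close>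
    have submod: "submodule J (R\<lparr>carrier := B\<rparr>) (self_module R)" if "ideal J (R\<lparr>carrier := C\<rparr>)" for J
    proof -
      interpret J: ideal J "R\<lparr>carrier := C\<rparr>" by fact
      have Jc: "J \<subseteq> carrier R" using J.a_subset subringE(1)[OF C] by auto
      have m: "c \<otimes> y \<in> J" if "c \<in> C" "y \<in> J" for c y using J.I_l_closed[OF that(2), of c] that by simp
      show ?thesis
      proof (rule BM.submoduleI)
        show "\<ominus>\<^bsub>self_module R\<^esub> a \<in> J" if a: "a \<in> J" for a
        proof -
          have "\<ominus>\<^bsub>self_module R\<^esub> a = (\<ominus>\<^bsub>R\<lparr>carrier := B\<rparr>\<^esub> \<one>\<^bsub>R\<lparr>carrier := B\<rparr>\<^esub>) \<otimes> a"
            using BM.smult_l_minus[of "\<one>\<^bsub>R\<lparr>carrier := B\<rparr>\<^esub>" a] BM.smult_one[of a] a Jc subringE(3)[OF B]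
            by auto
          then show ?thesis using m[OF _ a] BM.R.add.inv_closed[of "\<one>\<^bsub>R\<lparr>carrier := B\<rparr>\<^esub>"] BM.R.one_closed BC
            by (simp add: subset_iff)
        qed
      qed (use Jc J.zero_closed J.a_closed m BC in auto)
    qed
    define L where "L d = {b \<in> B. \<exists>v\<in>poly_span B x d. v \<oplus> b \<otimes> x [^] d \<in> I}" for d
    have L_Suc: "L d \<subseteq> L (Suc d)" for d
    proof
      fix b assume "b \<in> L d"
      then obtain v where v: "b \<in> B" "v \<in> poly_span B x d" "v \<oplus> b \<otimes> x [^] d \<in> I" unfolding L_def by auto
      have bR: "b \<in> carrier R" using v subringE(1)[OF B] by auto
      have "x \<otimes> v \<oplus> b \<otimes> x [^] Suc d = x \<otimes> (v \<oplus> b \<otimes> x [^] d)"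
        using bR x poly_span_carrier[OF v(2)] by (simp add: r_distr m_ac)
      then have "x \<otimes> v \<oplus> b \<otimes> x [^] Suc d \<in> I" using Imult[OF xC v(3)] by simp
      then show "b \<in> L (Suc d)" using v poly_span_shift[OF v(2)] unfolding L_def by blast
    qed
    have L_mono: "d \<le> e \<Longrightarrow> L d \<subseteq> L e" for d e
      by (induction rule: dec_induct) (use L_Suc in blast)+
    have L_ideal: "ideal (L d) (R\<lparr>carrier := B\<rparr>)" for d
    proof (rule idealI)
      show "ring (R\<lparr>carrier := B\<rparr>)" by (rule BM.R.ring_axioms)
      have sm: "c \<otimes> b \<in> L d" if h: "b \<in> L d" "c \<in> B" for b c
      proof -
        from h obtain v where v: "b \<in> B" "v \<in> poly_span B x d" "v \<oplus> b \<otimes> x [^] d \<in> I" unfolding L_def by auto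
        have bR: "b \<in> carrier R" "c \<in> carrier R" using v h subringE(1)[OF B] by auto
        have "c \<otimes> v \<oplus> (c \<otimes> b) \<otimes> x [^] d = c \<otimes> (v \<oplus> b \<otimes> x [^] d)"
          using bR x poly_span_carrier[OF v(2)] by (simp add: r_distr m_ac)
        then have "c \<otimes> v \<oplus> (c \<otimes> b) \<otimes> x [^] d \<in> I" using Imult[OF _ v(3)] h BC by auto
        then show ?thesis using v poly_span_smult[OF h(2) v(2)] subringE(6)[OF B h(2) v(1)]
          unfolding L_def by blast
      qed
      have comm: "b \<otimes> c = c \<otimes> b" if "b \<in> L d" "c \<in> B" for b c
        using that subringE(1)[OF B] by (intro m_comm) (auto simp: L_def)
      show "c \<otimes>\<^bsub>R\<lparr>carrier := B\<rparr>\<^esub> b \<in> L d" "b \<otimes>\<^bsub>R\<lparr>carrier := B\<rparr>\<^esub> c \<in> L d"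
        if "b \<in> L d" "c \<in> carrier (R\<lparr>carrier := B\<rparr>)" for b c
        using sm[of b c] comm[of b c] that by auto
      show "subgroup (L d) (add_monoid (R\<lparr>carrier := B\<rparr>))"
      proof (rule BM.R.add.subgroupI)
        show "L d \<subseteq> carrier (R\<lparr>carrier := B\<rparr>)" unfolding L_def by auto
        have "\<zero> \<oplus> \<zero> \<otimes> x [^] d \<in> I" using I0 x by simp
        then have "\<zero> \<in> L d" using poly_span_zero subringE(2)[OF B] unfolding L_def by blast
        then show "L d \<noteq> {}" by blast
        show "\<ominus>\<^bsub>R\<lparr>carrier := B\<rparr>\<^esub> b \<in> L d" if "b \<in> L d" for b
        proof -
          have bB: "b \<in> B" using that unfolding L_def by auto
          have "\<ominus>\<^bsub>R\<lparr>carrier := B\<rparr>\<^esub> b = (\<ominus>\<^bsub>R\<lparr>carrier := B\<rparr>\<^esub> \<one>\<^bsub>R\<lparr>carrier := B\<rparr>\<^esub>) \<otimes>\<^bsub>R\<lparr>carrier := B\<rparr>\<^esub> b"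
            using bB BM.R.l_minus[of "\<one>\<^bsub>R\<lparr>carrier := B\<rparr>\<^esub>" b] BM.R.one_closed BM.R.l_one[of b] by simp
          then show ?thesis using sm[OF that] BM.R.add.inv_closed[OF BM.R.one_closed] by simp
        qed
        show "b \<oplus>\<^bsub>R\<lparr>carrier := B\<rparr>\<^esub> c \<in> L d" if h: "b \<in> L d" "c \<in> L d" for b c
        proof -
          from h obtain v w where v: "b \<in> B" "v \<in> poly_span B x d" "v \<oplus> b \<otimes> x [^] d \<in> I"
            and w: "c \<in> B" "w \<in> poly_span B x d" "w \<oplus> c \<otimes> x [^] d \<in> I" unfolding L_def by auto
          have bR: "b \<in> carrier R" "c \<in> carrier R" using v w subringE(1)[OF B] by auto
          have "(v \<oplus> w) \<oplus> (b \<oplus> c) \<otimes> x [^] d = (v \<oplus> b \<otimes> x [^] d) \<oplus> (w \<oplus> c \<otimes> x [^] d)"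
            using bR x poly_span_carrier[OF v(2)] poly_span_carrier[OF w(2)] by (simp add: l_distr a_ac)
          then have "(v \<oplus> w) \<oplus> (b \<oplus> c) \<otimes> x [^] d \<in> I" using Iadd[OF v(3) w(3)] by simp
          then show ?thesis using poly_span_add[OF v(2) w(2)] subringE(7)[OF B v(1) w(1)]
            unfolding L_def by auto
        qed
      qed
    qed
    \<comment> \<open>The L d form an increasing chain of ideals of B, so some L D contains all of
      them: the leading coefficients of every degree already occur in degree D.\<close>
    have "\<Union>(range L) \<in> range L"
    proof (rule BN.ideal_chain_is_trivial)
      have "L d \<subseteq> L e \<or> L e \<subseteq> L d" for d e using L_mono[of d e] L_mono[of e d] by linarith
      then show "subset.chain {I. ideal I (R\<lparr>carrier := B\<rparr>)} (range L)"
        using L_ideal by (auto simp: subset_chain_def)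
    qed auto
    then obtain D where "\<Union>(range L) = L D" by auto
    then have D: "L d \<subseteq> L D" for d by auto
    \<comment> \<open>Index D + 1 means degree at most D. Generators of this part of I over B turn
      out to generate all of I over C.\<close>
    have "submodule (I \<inter> poly_span B x (Suc D)) (R\<lparr>carrier := B\<rparr>) (self_module R)"
      by (rule BM.submodule_Int[OF submod[OF I] poly_span_submodule])
    then obtain F where F: "finite F" "F \<subseteq> I \<inter> poly_span B x (Suc D)"
      "\<And>H. submodule H (R\<lparr>carrier := B\<rparr>) (self_module R) \<Longrightarrow> F \<subseteq> H \<Longrightarrow> I \<inter> poly_span B x (Suc D) \<subseteq> H"
      using noetherian_submoduleD[OF poly_span_noetherian[OF nB, of "Suc D"]] by blast
    let ?J = "Idl\<^bsub>R\<lparr>carrier := C\<rparr>\<^esub> F"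
    have FC: "F \<subseteq> carrier (R\<lparr>carrier := C\<rparr>)" using F(2) IC by auto
    have J: "ideal ?J (R\<lparr>carrier := C\<rparr>)" by (rule CR.genideal_ideal[OF FC])
    interpret J: ideal ?J "R\<lparr>carrier := C\<rparr>" by fact
    have JI: "?J \<subseteq> I" by (rule CR.genideal_minimal[OF I]) (use F(2) in auto)
    have low: "I \<inter> poly_span B x (Suc D) \<subseteq> ?J"
      by (rule F(3)[OF submod[OF J] CR.genideal_self[OF FC]])
    have "y \<in> ?J" if "y \<in> I" "y \<in> poly_span B x d" for y d
      using that
    proof (induction d arbitrary: y)
      case 0
      then show ?case using J.zero_closed by simp
    next
      case (Suc d)
      show ?case
      proof (cases "d \<le> D")
        case True
        then have "y \<in> poly_span B x (Suc D)" using poly_span_mono[of "Suc d" "Suc D" y] Suc.prems by auto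
        then show ?thesis using low Suc.prems by auto
      next
        case False
        \<comment> \<open>Here d > D. The leading coefficient b also occurs in degree D, on an
          element z of the candidate ideal, and subtracting x^(d - D) z from y removes the leading
          term.\<close>
        obtain v b where v: "y = v \<oplus> b \<otimes> x [^] d" "v \<in> poly_span B x d" "b \<in> B" using Suc.prems by auto
        then have "b \<in> L D" using Suc.prems D[of d] unfolding L_def by auto
        then obtain w where w: "w \<in> poly_span B x D" "w \<oplus> b \<otimes> x [^] D \<in> I" unfolding L_def by auto
        let ?z = "w \<oplus> b \<otimes> x [^] D" and ?k = "d - D"
        have c: "b \<in> carrier R" "v \<in> carrier R" "w \<in> carrier R"
          using v subringE(1)[OF B] poly_span_carrier w by auto
        have zJ: "?z \<in> ?J" using low w v by auto
        have xzJ: "x [^] ?k \<otimes> ?z \<in> ?J" using J.I_l_closed[OF zJ, of "x [^] ?k"] powC by simp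
        have "x [^] ?k \<otimes> x [^] D = x [^] d" using False x by (simp add: nat_pow_mult)
        then have xz: "x [^] ?k \<otimes> ?z = x [^] ?k \<otimes> w \<oplus> b \<otimes> x [^] d"
          using c x by (simp add: r_distr m_lcomm)
        have "y \<oplus> (\<ominus> \<one>) \<otimes> (x [^] ?k \<otimes> ?z) \<in> I"
        proof (rule Iadd[OF Suc.prems(1) Imult])
          show "\<ominus> \<one> \<in> C" by (rule subringE(5)[OF C subringE(3)[OF C]])
          show "x [^] ?k \<otimes> ?z \<in> I" using JI xzJ by (rule subsetD)
        qed
        moreover have eq: "y \<oplus> (\<ominus> \<one>) \<otimes> (x [^] ?k \<otimes> ?z) = v \<oplus> \<ominus> (x [^] ?k \<otimes> w)"
        proof -
          define p q where "p = x [^] ?k \<otimes> w" and "q = b \<otimes> x [^] d"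
          have pq: "p \<in> carrier R" "q \<in> carrier R" using c x by (auto simp: p_def q_def)
          have "(v \<oplus> q) \<oplus> (\<ominus> \<one>) \<otimes> (p \<oplus> q) = v \<oplus> \<ominus> p \<oplus> (q \<oplus> \<ominus> q)"
            using pq c(2) by (simp add: l_minus minus_add a_ac del: r_neg)
          then have "(v \<oplus> q) \<oplus> (\<ominus> \<one>) \<otimes> (p \<oplus> q) = v \<oplus> \<ominus> p"
            using pq c(2) by (simp add: r_neg)
          then show ?thesis unfolding xz v(1) p_def q_def .
        qed
        moreover have "v \<oplus> \<ominus> (x [^] ?k \<otimes> w) \<in> poly_span B x d"
          using poly_span_add[OF v(2) poly_span_uminus] poly_span_pow_shift[OF w(1), of ?k] False by simp
        ultimately have "y \<oplus> (\<ominus> \<one>) \<otimes> (x [^] ?k \<otimes> ?z) \<in> ?J" using Suc.IH by simp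
        then have "(y \<oplus> (\<ominus> \<one>) \<otimes> (x [^] ?k \<otimes> ?z)) \<oplus> x [^] ?k \<otimes> ?z \<in> ?J"
          using J.a_closed[OF _ xzJ] by simp
        moreover have "(y \<oplus> (\<ominus> \<one>) \<otimes> (x [^] ?k \<otimes> ?z)) \<oplus> x [^] ?k \<otimes> ?z = y"
          using c x Ic[OF Suc.prems(1)] by (simp add: l_minus a_assoc l_neg)
        ultimately show ?thesis by simp
      qed
    qed
    then have "I \<subseteq> ?J" using IC CV by blast
    then have "I = ?J" using JI by auto
    then show "\<exists>A\<subseteq>carrier (R\<lparr>carrier := C\<rparr>). finite A \<and> I = Idl\<^bsub>R\<lparr>carrier := C\<rparr>\<^esub> A" using F(1) FC by blast
  qed
qed

end

text \<open>The elements of G are adjoined one at a time; each step stays inside B[x] for the ring B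
  reached before, which is what \<open>noetherian_ring_adjoin\<close> requires.\<close>

lemma noetherian_ring_generate:
  assumes K: "subring K R" and nK: "noetherian_ring (R\<lparr>carrier := K\<rparr>)"
    and G: "finite G" "G \<subseteq> carrier R"
  shows "noetherian_ring (R\<lparr>carrier := generate_ring R (K \<union> G)\<rparr>)"
  using G
proof (induction G)
  case empty
  have "generate_ring R K = K"
    using generate_ringI[OF subringE(1)[OF K] K] by blast
  then show ?case using nK by simp
next
  case (insert x G)
  have c: "K \<union> G \<subseteq> carrier R" "K \<union> insert x G \<subseteq> carrier R" "x \<in> carrier R"
    using insert.prems subringE(1)[OF K] by auto
  note B = generate_ring_is_subring[OF c(1)] and C = generate_ring_is_subring[OF c(2)]
  have BC: "generate_ring R (K \<union> G) \<subseteq> generate_ring R (K \<union> insert x G)"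
    by (rule generate_ring_min_subring1[OF c(1) C]) (auto intro: generate_ring.incl)
  show ?case
  proof (rule noetherian_ring_adjoin[OF B c(3) insert.IH C BC])
    show "G \<subseteq> carrier R" using c by auto
    show "x \<in> generate_ring R (K \<union> insert x G)" by (auto intro: generate_ring.incl)
    show "generate_ring R (K \<union> insert x G) \<subseteq> (\<Union>d. poly_span (generate_ring R (K \<union> G)) x d)"
    proof (rule generate_ring_min_subring1[OF c(2) subring_poly_span[OF B c(3)]])
      show "K \<union> insert x G \<subseteq> (\<Union>d. poly_span (generate_ring R (K \<union> G)) x d)"
        using poly_span_base[OF B c(3)] poly_span_var[OF B c(3)]
        by (auto intro: generate_ring.incl simp del: poly_span.simps)
    qed
  qed
qed

text \<open>Meant for the image of a field in a ring of functions: a nonzero element of an ideal is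
  a unit, so only the zero ideal and K remain. The form of the hypothesis also admits the zero ring
  as image.\<close>

lemma noetherian_ring_of_inverses:
  assumes K: "subring K R" and inv: "\<And>y. y \<in> K \<Longrightarrow> y = \<zero> \<or> (\<exists>z\<in>K. y \<otimes> z = \<one>)"
  shows "noetherian_ring (R\<lparr>carrier := K\<rparr>)"
proof -
  interpret KR: ring "R\<lparr>carrier := K\<rparr>" using subring_iff[OF subringE(1)[OF K]] K by simp
  show ?thesis
  proof (rule KR.noetherian_ringI)
    fix I assume I: "ideal I (R\<lparr>carrier := K\<rparr>)"
    interpret I: ideal I "R\<lparr>carrier := K\<rparr>" by fact
    show "\<exists>A\<subseteq>carrier (R\<lparr>carrier := K\<rparr>). finite A \<and> I = Idl\<^bsub>R\<lparr>carrier := K\<rparr>\<^esub> A"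
    proof (cases "I \<subseteq> {\<zero>}")
      case True
      then have "I = {\<zero>}" using I.zero_closed by auto
      then show ?thesis using KR.genideal_zero subringE(2)[OF K] by (intro exI[of _ "{\<zero>}"]) auto
    next
      case False
      then obtain y where y: "y \<in> I" "y \<noteq> \<zero>" by auto
      moreover have "y \<in> K" using y I.a_subset by auto
      ultimately obtain z where "z \<in> K" "y \<otimes> z = \<one>" using inv by blast
      then have "\<one> \<in> I" using I.I_r_closed[OF y(1), of z] by simp
      then have "I = K" using I.one_imp_carrier by simp
      then show ?thesis using KR.genideal_one subringE(3)[OF K] by (intro exI[of _ "{\<one>}"]) auto
    qed
  qed
qed

lemma ideal_generators:
  assumes R: "noetherian_ring R" and I: "ideal I R"
  obtains m :: nat and g where "g \<in> {..<m} \<rightarrow> I"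
    "\<And>t. t \<in> I \<Longrightarrow> \<exists>a \<in> {..<m} \<rightarrow> carrier R. t = (\<Oplus>j\<in>{..<m}. a j \<otimes> g j)"
proof -
  interpret M: module R "self_module R"
    using module_self_module[OF carrier_is_subring] by simp
  interpret I: ideal I R by fact
  have S: "submodule I R (self_module R)"
  proof (rule M.submoduleI)
    show "\<ominus>\<^bsub>self_module R\<^esub> a \<in> I" if "a \<in> I" for a
    proof -
      have "\<ominus>\<^bsub>self_module R\<^esub> a = (\<ominus> \<one>) \<otimes> a"
        using M.smult_l_minus[of \<one> a] M.smult_one[of a] that I.Icarr by simp
      then show ?thesis using I.I_l_closed[OF that, of "\<ominus> \<one>"] by simp
    qed
  qed (use I.a_subset I.zero_closed I.a_closed I.I_l_closed in auto)
  \<comment> \<open>With coefficients in all of R and x = 1, the span of index 1 is R itself, so R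
    is noetherian as a module over itself.\<close>
  have N: "noetherian_submodule R (self_module R) (poly_span (carrier R) \<one> (Suc 0))"
    using poly_span_noetherian[OF carrier_is_subring one_closed, of "Suc 0"] R by simp
  have IV: "I \<subseteq> poly_span (carrier R) \<one> (Suc 0)"
    using I.a_subset poly_span_base[OF carrier_is_subring one_closed] by blast
  obtain m :: nat and g where g: "g \<in> {..<m} \<rightarrow> I"
    "\<And>t. t \<in> I \<Longrightarrow> \<exists>a \<in> {..<m} \<rightarrow> carrier R.
        t = (\<Oplus>\<^bsub>self_module R\<^esub>j\<in>{..<m}. a j \<odot>\<^bsub>self_module R\<^esub> g j)"
    by (rule M.noetherian_submodule_generators[OF N S IV]) (rule that)
  \<comment> \<open>The two sums are taken in different records, so their agreement needs an
    induction on the number of terms.\<close>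
  have "finsum (self_module R) h {..<k} = finsum R h {..<k}"
    if "h \<in> {..<k} \<rightarrow> carrier R" for h and k :: nat
    using that
    by (induction k) (simp_all add: lessThan_Suc Pi_iff)
  then have "(\<Oplus>\<^bsub>self_module R\<^esub>j\<in>{..<m}. a j \<odot>\<^bsub>self_module R\<^esub> g j) = (\<Oplus>j\<in>{..<m}. a j \<otimes> g j)"
    if "a \<in> {..<m} \<rightarrow> carrier R" for a
    using that g(1) I.a_subset by (simp add: Pi_iff subset_iff)
  note conv = this
  show thesis
  proof (rule that[OF g(1)])
    fix t assume "t \<in> I"
    then obtain a where a: "a \<in> {..<m} \<rightarrow> carrier R"
      "t = (\<Oplus>\<^bsub>self_module R\<^esub>j\<in>{..<m}. a j \<odot>\<^bsub>self_module R\<^esub> g j)"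
      using g(2) by meson
    then show "\<exists>a \<in> {..<m} \<rightarrow> carrier R. t = (\<Oplus>j\<in>{..<m}. a j \<otimes> g j)"
      using conv[OF a(1)] by (intro bexI[OF _ a(1)]) simp
  qed
qed

end

text \<open>The free module of rank n. Tuples are extensional functions and the operations are
  literally those of \<open>relation_sheaf\<close>, so that sections of a relation sheaf arise from
  it by shrinking the carrier.\<close>

definition power_module :: "('a, 'e) ring_scheme \<Rightarrow> nat \<Rightarrow> ('a, nat \<Rightarrow> 'a) module" where
  "power_module A n = \<lparr>carrier = {..<n} \<rightarrow>\<^sub>E carrier A, monoid.mult = undefined, one = undefined,
     zero = (\<lambda>i\<in>{..<n}. \<zero>\<^bsub>A\<^esub>), add = (\<lambda>a b. \<lambda>i\<in>{..<n}. a i \<oplus>\<^bsub>A\<^esub> b i),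
     smult = (\<lambda>c a. \<lambda>i\<in>{..<n}. c \<otimes>\<^bsub>A\<^esub> a i)\<rparr>"

lemma power_module_simps [simp]:
  "carrier (power_module A n) = {..<n} \<rightarrow>\<^sub>E carrier A"
  "\<zero>\<^bsub>power_module A n\<^esub> = (\<lambda>i\<in>{..<n}. \<zero>\<^bsub>A\<^esub>)"
  "a \<oplus>\<^bsub>power_module A n\<^esub> b = (\<lambda>i\<in>{..<n}. a i \<oplus>\<^bsub>A\<^esub> b i)"
  "c \<odot>\<^bsub>power_module A n\<^esub> a = (\<lambda>i\<in>{..<n}. c \<otimes>\<^bsub>A\<^esub> a i)"
  by (simp_all add: power_module_def)

context cring
begin

lemma power_module_eqI:
  assumes "a \<in> {..<n} \<rightarrow>\<^sub>E carrier R" "b \<in> {..<n} \<rightarrow>\<^sub>E carrier R" "\<And>i. i < n \<Longrightarrow> a i = b i"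
  shows "a = b"
  by (rule PiE_ext[OF assms(1,2)]) (use assms(3) in auto)

lemma module_power_module: "module R (power_module R n)"
proof (rule moduleI)
  show "cring R" by (rule is_cring)
  show "abelian_group (power_module R n)"
  proof (rule abelian_groupI)
    show "\<exists>b\<in>carrier (power_module R n). b \<oplus>\<^bsub>power_module R n\<^esub> a = \<zero>\<^bsub>power_module R n\<^esub>"
      if "a \<in> carrier (power_module R n)" for a
      by (rule bexI[of _ "\<lambda>i\<in>{..<n}. \<ominus> a i"])
         (use that in \<open>auto simp: PiE_iff l_neg intro!: restrict_ext\<close>)
  qed (auto simp: PiE_iff extensional_def restrict_def fun_eq_iff a_ac)
qed (auto simp: PiE_iff extensional_def restrict_def fun_eq_iff l_distr r_distr m_assoc)

text \<open>The free module is exhausted by V k, the tuples whose entries from index k on vanish; V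
  (k + 1) is V k with the basis vector e k adjoined, so \<open>noetherian_submodule_extend\<close>
  climbs from V 0 = 0 to V n.\<close>

lemma tuple_generators:
  assumes R: "noetherian_ring R" and N: "submodule N R (power_module R n)"
  obtains m :: nat and g where "g \<in> {..<m} \<rightarrow> N"
    "\<And>t. t \<in> N \<Longrightarrow> \<exists>a \<in> {..<m} \<rightarrow> carrier R. \<forall>i<n. t i = (\<Oplus>j\<in>{..<m}. a j \<otimes> g j i)"
proof -
  interpret M: module R "power_module R n" by (rule module_power_module)
  define V where "V k = {t \<in> {..<n} \<rightarrow>\<^sub>E carrier R. \<forall>i. k \<le> i \<longrightarrow> i < n \<longrightarrow> t i = \<zero>}" for k
  define e where "e k = (\<lambda>i\<in>{..<n}. if i = k then \<one> else \<zero>)" for k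
  have V: "submodule (V k) R (power_module R n) \<and> noetherian_submodule R (power_module R n) (V k)"
    if "k \<le> n" for k
    using that
  proof (induction k)
    case 0
    have "V 0 = {\<zero>\<^bsub>power_module R n\<^esub>}"
      by (auto simp: V_def PiE_iff extensional_def fun_eq_iff)
    then show ?case using M.submodule_singleton_zero M.noetherian_submodule_zero by simp
  next
    case (Suc k)
    then have k: "k < n" "k \<le> n" by auto
    have ek: "e k \<in> carrier (power_module R n)" by (auto simp: e_def)
    let ?W = "{v \<oplus>\<^bsub>power_module R n\<^esub> b \<odot>\<^bsub>power_module R n\<^esub> e k | v b. v \<in> V k \<and> b \<in> carrier R}"
    have "V (Suc k) = ?W"
    proof (intro equalityI subsetI)
      fix t assume t: "t \<in> V (Suc k)"
      let ?v = "\<lambda>i\<in>{..<n}. if i = k then \<zero> else t i"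
      have tc: "t i \<in> carrier R" if "i < n" for i using t that by (auto simp: V_def PiE_iff)
      have "?v \<in> V k" using t k tc by (auto simp: V_def)
      moreover have "t = ?v \<oplus>\<^bsub>power_module R n\<^esub> t k \<odot>\<^bsub>power_module R n\<^esub> e k"
        by (rule power_module_eqI[of _ n]) (use t k tc in \<open>auto simp: V_def e_def\<close>)
      ultimately show "t \<in> ?W" using tc[OF k(1)] by blast
    next
      fix t assume "t \<in> ?W"
      then obtain v b where "v \<in> V k" "b \<in> carrier R" "t = v \<oplus>\<^bsub>power_module R n\<^esub> b \<odot>\<^bsub>power_module R n\<^esub> e k"
        by blast
      then show "t \<in> V (Suc k)" by (auto simp: V_def e_def PiE_iff)
    qed
    then show ?case
      using M.submodule_extend[OF _ ek] M.noetherian_submodule_extend[OF R _ _ ek] Suc.IH[OF k(2)] by simp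
  qed
  have NV: "N \<subseteq> V n" using M.submoduleE(1)[OF N] by (auto simp: V_def)
  obtain m :: nat and g where g: "g \<in> {..<m} \<rightarrow> N"
    "\<And>t. t \<in> N \<Longrightarrow> \<exists>a \<in> {..<m} \<rightarrow> carrier R.
        t = (\<Oplus>\<^bsub>power_module R n\<^esub>j\<in>{..<m}. a j \<odot>\<^bsub>power_module R n\<^esub> g j)"
    by (rule M.noetherian_submodule_generators[OF conjunct2[OF V[OF order_refl]] N NV]) (rule that)
  have fs: "finsum (power_module R n) h {..<k} i = (\<Oplus>j\<in>{..<k}. h j i)"
    if "h \<in> {..<k} \<rightarrow> carrier (power_module R n)" "i < n" for h i and k :: nat
    using that(1)
  proof (induction k)
    case (Suc k)
    have h: "h j \<in> {..<n} \<rightarrow>\<^sub>E carrier R" if "j < Suc k" for j using Suc.prems that by auto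
    then have hi: "h j i \<in> carrier R" if "j < Suc k" for j using that \<open>i < n\<close> by auto
    have "finsum (power_module R n) h {..<Suc k} = h k \<oplus>\<^bsub>power_module R n\<^esub> finsum (power_module R n) h {..<k}"
      unfolding lessThan_Suc by (rule M.finsum_insert) (use Suc.prems in \<open>auto simp: Pi_iff\<close>)
    moreover have "(\<Oplus>j\<in>{..<Suc k}. h j i) = h k i \<oplus> (\<Oplus>j\<in>{..<k}. h j i)"
      unfolding lessThan_Suc by (rule finsum_insert) (use hi in auto)
    ultimately show ?case using Suc \<open>i < n\<close> by (simp add: Pi_iff)
  qed (use \<open>i < n\<close> in simp)
  have "\<forall>i<n. t i = (\<Oplus>j\<in>{..<m}. a j \<otimes> g j i)"
    if a: "a \<in> {..<m} \<rightarrow> carrier R" "t = (\<Oplus>\<^bsub>power_module R n\<^esub>j\<in>{..<m}. a j \<odot>\<^bsub>power_module R n\<^esub> g j)" for a t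
  proof (intro allI impI)
    fix i assume i: "i < n"
    have gM: "g j \<in> {..<n} \<rightarrow>\<^sub>E carrier R" if "j < m" for j
      using g(1) M.submoduleE(1)[OF N] that by auto
    have "t i = (\<Oplus>j\<in>{..<m}. (a j \<odot>\<^bsub>power_module R n\<^esub> g j) i)"
      unfolding a(2) by (rule fs[OF _ i]) (use gM a(1) in \<open>auto simp: PiE_iff Pi_iff\<close>)
    then show "t i = (\<Oplus>j\<in>{..<m}. a j \<otimes> g j i)" using i by simp
  qed
  note conv = this
  show thesis
  proof (rule that[OF g(1)])
    fix t assume "t \<in> N"
    then obtain a where a: "a \<in> {..<m} \<rightarrow> carrier R"
      "t = (\<Oplus>\<^bsub>power_module R n\<^esub>j\<in>{..<m}. a j \<odot>\<^bsub>power_module R n\<^esub> g j)"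
      using g(2) by meson
    show "\<exists>a \<in> {..<m} \<rightarrow> carrier R. \<forall>i<n. t i = (\<Oplus>j\<in>{..<m}. a j \<otimes> g j i)"
      using conv[OF a] a(1) by (rule bexI)
  qed
qed

end

section \<open>Sections over a spectrum\<close>

locale cring_multiplicative_set = cring R for R (structure) +
  fixes S
  assumes S_sub: "S \<subseteq> carrier R" and S_one: "\<one> \<in> S" and S_mult: "s \<in> S \<Longrightarrow> t \<in> S \<Longrightarrow> s \<otimes> t \<in> S"
begin

lemma S_carrier [simp]: "s \<in> S \<Longrightarrow> s \<in> carrier R"
  using S_sub by auto

text \<open>Equality of fractions without subtraction, a form in which associativity and
  commutativity settle the computations that follow.\<close>

lemma mem_fraction_iff:
  assumes "a \<in> carrier R" "s \<in> S"
  shows "(b, t) \<in> fraction R S a s \<longleftrightarrow>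
    b \<in> carrier R \<and> t \<in> S \<and> (\<exists>u\<in>S. u \<otimes> (t \<otimes> a) = u \<otimes> (s \<otimes> b))"
proof -
  have "u \<otimes> ((t \<otimes> a) \<ominus> (s \<otimes> b)) = \<zero> \<longleftrightarrow> u \<otimes> (t \<otimes> a) = u \<otimes> (s \<otimes> b)"
    if "u \<in> S" "t \<in> S" "b \<in> carrier R" for u
  proof -
    have "u \<otimes> ((t \<otimes> a) \<ominus> (s \<otimes> b)) = u \<otimes> (t \<otimes> a) \<ominus> u \<otimes> (s \<otimes> b)"
      using that assms by (simp add: minus_eq r_distr r_minus)
    then show ?thesis using that assms by (simp add: r_right_minus_eq)
  qed
  then show ?thesis unfolding fraction_def by auto
qed

lemma fraction_self: "a \<in> carrier R \<Longrightarrow> s \<in> S \<Longrightarrow> (a, s) \<in> fraction R S a s"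
  using S_one by (auto simp: mem_fraction_iff)

lemma fraction_trans:
  assumes "a \<in> carrier R" "s \<in> S" "(b, t) \<in> fraction R S a s" "(c, r) \<in> fraction R S b t"
  shows "(c, r) \<in> fraction R S a s"
proof -
  from assms(1-3) obtain u where u: "b \<in> carrier R" "t \<in> S" "u \<in> S" "u \<otimes> (t \<otimes> a) = u \<otimes> (s \<otimes> b)"
    by (auto simp: mem_fraction_iff)
  with assms(4) obtain v where v: "c \<in> carrier R" "r \<in> S" "v \<in> S" "v \<otimes> (r \<otimes> b) = v \<otimes> (t \<otimes> c)"
    by (auto simp: mem_fraction_iff)
  \<comment> \<open>The middle denominator t cannot be cancelled, so it becomes part of the
    multiplier.\<close>
  have "(u \<otimes> v \<otimes> t) \<otimes> (r \<otimes> a) = (v \<otimes> r) \<otimes> (u \<otimes> (t \<otimes> a))"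
    using u(1-3) v(1-3) assms(1,2) by (simp add: m_ac)
  also have "\<dots> = (u \<otimes> s) \<otimes> (v \<otimes> (r \<otimes> b))" unfolding u(4) using u(1-3) v(1-3) assms(1,2) by (simp add: m_ac)
  also have "\<dots> = (u \<otimes> v \<otimes> t) \<otimes> (s \<otimes> c)" unfolding v(4) using u(1-3) v(1-3) assms(1,2) by (simp add: m_ac)
  finally show ?thesis
    using u v assms(1,2) S_mult by (auto simp: mem_fraction_iff intro!: bexI[of _ "u \<otimes> v \<otimes> t"])
qed

lemma fraction_sym:
  assumes "a \<in> carrier R" "s \<in> S" "(b, t) \<in> fraction R S a s"
  shows "(a, s) \<in> fraction R S b t"
proof -
  from assms obtain u where u: "b \<in> carrier R" "t \<in> S" "u \<in> S" "u \<otimes> (t \<otimes> a) = u \<otimes> (s \<otimes> b)"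
    by (auto simp: mem_fraction_iff)
  then show ?thesis using assms(1,2) by (auto simp: mem_fraction_iff intro!: bexI[of _ u])
qed

lemma fraction_eq:
  assumes "a \<in> carrier R" "s \<in> S" "(b, t) \<in> fraction R S a s"
  shows "fraction R S b t = fraction R S a s"
proof -
  have b: "b \<in> carrier R" "t \<in> S" using assms by (auto simp: mem_fraction_iff)
  show ?thesis
    using fraction_trans[OF assms] fraction_trans[OF b fraction_sym[OF assms]] by auto
qed

lemma fraction_eqI:
  assumes "a \<in> carrier R" "s \<in> S" "b \<in> carrier R" "t \<in> S" "t \<otimes> a = s \<otimes> b"
  shows "fraction R S a s = fraction R S b t"
  by (rule fraction_eq[symmetric, OF assms(1,2)]) (use assms S_one in \<open>auto simp: mem_fraction_iff\<close>)

text \<open>Independence of representatives makes every set in the double union equal to the one on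
  the right, and a nonempty union of equal sets collapses.\<close>

lemma fraction_mult:
  assumes "a \<in> carrier R" "s \<in> S" "b \<in> carrier R" "t \<in> S"
  shows "fraction R S a s \<otimes>\<^bsub>localization R S\<^esub> fraction R S b t = fraction R S (a \<otimes> b) (s \<otimes> t)"
proof -
  have eq: "fraction R S (a' \<otimes> b') (s' \<otimes> t') = fraction R S (a \<otimes> b) (s \<otimes> t)"
    if "(a', s') \<in> fraction R S a s" "(b', t') \<in> fraction R S b t" for a' s' b' t'
  proof (rule fraction_eq)
    from that(1) assms obtain u where u: "a' \<in> carrier R" "s' \<in> S" "u \<in> S" "u \<otimes> (s' \<otimes> a) = u \<otimes> (s \<otimes> a')"
      by (auto simp: mem_fraction_iff)
    from that(2) assms obtain v where v: "b' \<in> carrier R" "t' \<in> S" "v \<in> S" "v \<otimes> (t' \<otimes> b) = v \<otimes> (t \<otimes> b')"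
      by (auto simp: mem_fraction_iff)
    have "(u \<otimes> v) \<otimes> ((s' \<otimes> t') \<otimes> (a \<otimes> b)) = (u \<otimes> (s' \<otimes> a)) \<otimes> (v \<otimes> (t' \<otimes> b))"
      using u(1-3) v(1-3) assms by (simp add: m_ac)
    also have "\<dots> = (u \<otimes> v) \<otimes> ((s \<otimes> t) \<otimes> (a' \<otimes> b'))"
      unfolding u(4) v(4) using u(1-3) v(1-3) assms by (simp add: m_ac)
    finally show "(a' \<otimes> b', s' \<otimes> t') \<in> fraction R S (a \<otimes> b) (s \<otimes> t)"
      using u v assms S_mult by (auto simp: mem_fraction_iff intro!: bexI[of _ "u \<otimes> v"])
  qed (use assms S_mult in auto)
  have "(\<Union>(b', t')\<in>fraction R S b t. fraction R S (a' \<otimes> b') (s' \<otimes> t')) = fraction R S (a \<otimes> b) (s \<otimes> t)"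
    if "(a', s') \<in> fraction R S a s" for a' s'
    by (rule SUP_eq_const) (use eq[OF that] fraction_self[OF assms(3,4)] in auto)
  then have "(\<Union>(a', s')\<in>fraction R S a s. \<Union>(b', t')\<in>fraction R S b t.
      fraction R S (a' \<otimes> b') (s' \<otimes> t')) = fraction R S (a \<otimes> b) (s \<otimes> t)"
    by (intro SUP_eq_const) (use fraction_self[OF assms(1,2)] in auto)
  then show ?thesis by (simp add: localization_def)
qed

lemma fraction_in_localization: "a \<in> carrier R \<Longrightarrow> s \<in> S \<Longrightarrow> fraction R S a s \<in> carrier (localization R S)"
  unfolding localization_def by auto

end

lemma cring_multiplicative_set_prime_complement:
  assumes "primeideal p R"
  shows "cring_multiplicative_set R (carrier R - p)"
proof -
  interpret primeideal p R by fact
  show ?thesis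
  proof
    show "\<one>\<^bsub>R\<^esub> \<in> carrier R - p" using one_imp_carrier I_notcarr by auto
  qed (use I_prime in auto)
qed

lemma openin_zariski [simp]: "openin (topology (zariski_open R)) U \<longleftrightarrow> zariski_open R U"
  by (simp add: istopology_zariski_open)

lemma openin_Spec [simp]: "openin (top_of (Spec R)) U \<longleftrightarrow> zariski_open R U"
  by (simp add: Spec_def)

lemma zariski_open_subset: "zariski_open R U \<Longrightarrow> U \<subseteq> spec_points R"
  by (auto simp: zariski_open_def)

lemma zariski_open_basic: "u \<in> carrier R \<Longrightarrow> zariski_open R {p \<in> spec_points R. u \<notin> p}"
  unfolding zariski_open_def by (rule exI[of _ "{u}"]) auto

lemma zariski_open_UNIV: "zariski_open R (spec_points R)"
proof -
  have "\<not> carrier R \<subseteq> p" if "p \<in> spec_points R" for p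
  proof -
    interpret primeideal p R using that by (simp add: spec_points_def)
    show ?thesis using I_notcarr a_subset by auto
  qed
  then show ?thesis unfolding zariski_open_def by auto
qed

lemma topspace_Spec [simp]: "topspace (top_of (Spec R)) = spec_points R"
  using zariski_open_subset zariski_open_UNIV by (fastforce simp: topspace_def)

definition frac_section :: "'a ring \<Rightarrow> 'a set set \<Rightarrow> 'a \<Rightarrow> 'a \<Rightarrow> 'a set \<Rightarrow> ('a \<times> 'a) set" where
  "frac_section R Z a g = (\<lambda>q\<in>Z. fraction R (carrier R - q) a g)"

context
  fixes R :: "'a ring" (structure) and Z
  assumes Z: "zariski_open R Z"
begin

lemma mset_at: "q \<in> Z \<Longrightarrow> cring_multiplicative_set R (carrier R - q)"
  using zariski_open_subset[OF Z] cring_multiplicative_set_prime_complement by (auto simp: spec_points_def)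

lemma frac_section_closed:
  assumes "a \<in> carrier R" "g \<in> carrier R" "\<And>q. q \<in> Z \<Longrightarrow> g \<notin> q"
  shows "frac_section R Z a g \<in> carrier (\<O> (Spec R) Z)"
proof -
  have "frac_section R Z a g \<in> (\<Pi>\<^sub>E p\<in>Z. carrier (local_at R p))"
    unfolding frac_section_def
  proof (rule restrict_PiE_iff[THEN iffD2], rule ballI)
    fix q assume q: "q \<in> Z"
    interpret cring_multiplicative_set R "carrier R - q" by (rule mset_at[OF q])
    show "fraction R (carrier R - q) a g \<in> carrier (local_at R q)"
      by (rule fraction_in_localization) (use assms q in auto)
  qed
  moreover have "\<forall>p\<in>Z. \<exists>W b f. zariski_open R W \<and> p \<in> W \<and> W \<subseteq> Z \<and> b \<in> carrier R \<and> f \<in> carrier R \<and>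
       (\<forall>q\<in>W. f \<notin> q \<and> frac_section R Z a g q = fraction R (carrier R - q) b f)"
  proof
    fix p assume "p \<in> Z"
    then show "\<exists>W b f. zariski_open R W \<and> p \<in> W \<and> W \<subseteq> Z \<and> b \<in> carrier R \<and> f \<in> carrier R \<and>
       (\<forall>q\<in>W. f \<notin> q \<and> frac_section R Z a g q = fraction R (carrier R - q) b f)"
      by (intro exI[of _ Z] exI[of _ a] exI[of _ g]) (use assms Z in \<open>simp add: frac_section_def\<close>)
  qed
  ultimately show ?thesis by (simp add: Spec_def spec_sections_def)
qed

lemma frac_section_eqI:
  assumes "a \<in> carrier R" "g \<in> carrier R" "\<And>q. q \<in> Z \<Longrightarrow> g \<notin> q"
    "b \<in> carrier R" "h \<in> carrier R" "\<And>q. q \<in> Z \<Longrightarrow> h \<notin> q" "h \<otimes> a = g \<otimes> b"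
  shows "frac_section R Z a g = frac_section R Z b h"
  unfolding frac_section_def
proof (rule restrict_ext)
  fix q assume q: "q \<in> Z"
  interpret cring_multiplicative_set R "carrier R - q" by (rule mset_at[OF q])
  show "fraction R (carrier R - q) a g = fraction R (carrier R - q) b h"
    by (rule fraction_eqI) (use assms q in auto)
qed

lemma frac_section_mult:
  assumes "a \<in> carrier R" "g \<in> carrier R" "\<And>q. q \<in> Z \<Longrightarrow> g \<notin> q"
    "b \<in> carrier R" "h \<in> carrier R" "\<And>q. q \<in> Z \<Longrightarrow> h \<notin> q"
  shows "frac_section R Z a g \<otimes>\<^bsub>\<O> (Spec R) Z\<^esub> frac_section R Z b h = frac_section R Z (a \<otimes> b) (g \<otimes> h)"
proof -
  have "fraction R (carrier R - q) a g \<otimes>\<^bsub>local_at R q\<^esub> fraction R (carrier R - q) b h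
    = fraction R (carrier R - q) (a \<otimes> b) (g \<otimes> h)" if q: "q \<in> Z" for q
  proof -
    interpret cring_multiplicative_set R "carrier R - q" by (rule mset_at[OF q])
    show ?thesis by (rule fraction_mult) (use assms q in auto)
  qed
  then show ?thesis by (simp add: Spec_def frac_section_def cong: restrict_cong)
qed

lemma frac_section_one: "\<one>\<^bsub>\<O> (Spec R) Z\<^esub> = frac_section R Z \<one> \<one>"
  by (simp add: Spec_def frac_section_def localization_def)

lemma frac_section_zero: "\<zero>\<^bsub>\<O> (Spec R) Z\<^esub> = frac_section R Z \<zero> \<one>"
  by (simp add: Spec_def frac_section_def localization_def)

end

lemma res_frac_section: "Z' \<subseteq> Z \<Longrightarrow> res (Spec R) Z Z' (frac_section R Z a g) = frac_section R Z' a g"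
  by (auto simp: Spec_def frac_section_def restrict_def fun_eq_iff)

section \<open>Ringed spaces and affine open sets\<close>

lemma ex1_eqI: "\<exists>!x. P x \<Longrightarrow> P a \<Longrightarrow> P b \<Longrightarrow> a = b"
  by blast

lemma (in cring) UnitsI_comm: "x \<in> carrier R \<Longrightarrow> y \<in> carrier R \<Longrightarrow> x \<otimes> y = \<one> \<Longrightarrow> x \<in> Units R"
  unfolding Units_def using m_comm[of x y] by auto

lemma spec_sections_local:
  "s \<in> carrier (\<O> (Spec R) U) \<Longrightarrow> p \<in> U \<Longrightarrow>
    \<exists>W a f. zariski_open R W \<and> p \<in> W \<and> W \<subseteq> U \<and> a \<in> carrier R \<and> f \<in> carrier R \<and>
       (\<forall>q\<in>W. f \<notin> q \<and> s q = fraction R (carrier R - q) a f)"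
  by (simp add: Spec_def spec_sections_def)

text \<open>For the proof that the isomorphism of an affine open set with a spectrum sends the zero
  section to zero. \<open>ring_hom_zero\<close> would ask for rings of sections on the spectrum;
  that the zero section absorbs every factor can be read off from fractions.\<close>

lemma zero_section_mult:
  assumes R: "cring R" and Z: "zariski_open R Z" and s: "s \<in> carrier (\<O> (Spec R) Z)"
  shows "frac_section R Z \<zero>\<^bsub>R\<^esub> \<one>\<^bsub>R\<^esub> \<otimes>\<^bsub>\<O> (Spec R) Z\<^esub> s = frac_section R Z \<zero>\<^bsub>R\<^esub> \<one>\<^bsub>R\<^esub>"
proof -
  have "fraction R (carrier R - q) \<zero>\<^bsub>R\<^esub> \<one>\<^bsub>R\<^esub> \<otimes>\<^bsub>local_at R q\<^esub> s q = fraction R (carrier R - q) \<zero>\<^bsub>R\<^esub> \<one>\<^bsub>R\<^esub>"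
    if q: "q \<in> Z" for q
  proof -
    interpret cring_multiplicative_set R "carrier R - q" by (rule mset_at[OF Z q])
    have "s q \<in> carrier (local_at R q)" using s q by (auto simp: Spec_def spec_sections_def)
    then obtain a g where ag: "a \<in> carrier R" "g \<in> carrier R - q" "s q = fraction R (carrier R - q) a g"
      by (auto simp: localization_def)
    have "fraction R (carrier R - q) \<zero>\<^bsub>R\<^esub> \<one>\<^bsub>R\<^esub> \<otimes>\<^bsub>local_at R q\<^esub> s q
       = fraction R (carrier R - q) (\<zero>\<^bsub>R\<^esub> \<otimes>\<^bsub>R\<^esub> a) (\<one>\<^bsub>R\<^esub> \<otimes>\<^bsub>R\<^esub> g)"
      unfolding ag(3) by (rule fraction_mult[OF zero_closed S_one ag(1,2)])
    also have "\<dots> = fraction R (carrier R - q) \<zero>\<^bsub>R\<^esub> \<one>\<^bsub>R\<^esub>"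
      by (rule fraction_eqI) (use ag S_one in auto)
    finally show ?thesis .
  qed
  then have "(\<lambda>q\<in>Z. frac_section R Z \<zero>\<^bsub>R\<^esub> \<one>\<^bsub>R\<^esub> q \<otimes>\<^bsub>local_at R q\<^esub> s q) = frac_section R Z \<zero>\<^bsub>R\<^esub> \<one>\<^bsub>R\<^esub>"
    by (intro ext) (simp add: frac_section_def)
  moreover have "frac_section R Z \<zero>\<^bsub>R\<^esub> \<one>\<^bsub>R\<^esub> \<otimes>\<^bsub>\<O> (Spec R) Z\<^esub> s
     = (\<lambda>q\<in>Z. frac_section R Z \<zero>\<^bsub>R\<^esub> \<one>\<^bsub>R\<^esub> q \<otimes>\<^bsub>local_at R q\<^esub> s q)"
    by (simp add: Spec_def)
  ultimately show ?thesis by simp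
qed

section \<open>Consequences of the sheaf axiom\<close>

lemma sheaf_restrict_closed:
  assumes "is_sheaf T F r" "openin T U" "openin T V" "V \<subseteq> U" "s \<in> F U"
  shows "r U V s \<in> F V"
proof -
  have "\<forall>U V. openin T U \<longrightarrow> openin T V \<longrightarrow> V \<subseteq> U \<longrightarrow> r U V \<in> F U \<rightarrow> F V"
    using assms(1) unfolding is_sheaf_def by (elim conjE)
  then have "r U V \<in> F U \<rightarrow> F V" using assms(2-4) by simp
  then show ?thesis using assms(5) by (rule funcset_mem)
qed

lemma sheaf_restrict_id:
  assumes "is_sheaf T F r" "openin T U" "s \<in> F U"
  shows "r U U s = s"
proof -
  have "\<forall>U s. openin T U \<longrightarrow> s \<in> F U \<longrightarrow> r U U s = s"
    using assms(1) unfolding is_sheaf_def by (elim conjE)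
  then show ?thesis using assms(2,3) by simp
qed

lemma sheaf_restrict_restrict:
  assumes "is_sheaf T F r" "openin T U" "openin T V" "openin T W" "W \<subseteq> V" "V \<subseteq> U" "s \<in> F U"
  shows "r V W (r U V s) = r U W s"
proof -
  have "\<forall>U V W s. openin T U \<longrightarrow> openin T V \<longrightarrow> openin T W \<longrightarrow> W \<subseteq> V \<longrightarrow> V \<subseteq> U \<longrightarrow>
       s \<in> F U \<longrightarrow> r V W (r U V s) = r U W s"
    using assms(1) unfolding is_sheaf_def by (elim conjE)
  then show ?thesis using assms(2-7) by simp
qed

lemma sheaf_glue:
  assumes "is_sheaf T F r" "\<And>U. U \<in> \<U> \<Longrightarrow> openin T U" "\<And>U. U \<in> \<U> \<Longrightarrow> s U \<in> F U"
    "\<And>U V. U \<in> \<U> \<Longrightarrow> V \<in> \<U> \<Longrightarrow> r U (U \<inter> V) (s U) = r V (U \<inter> V) (s V)"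
  shows "\<exists>!t. t \<in> F (\<Union>\<U>) \<and> (\<forall>U\<in>\<U>. r (\<Union>\<U>) U t = s U)"
proof -
  have "\<forall>\<U> s. (\<forall>U\<in>\<U>. openin T U \<and> s U \<in> F U) \<longrightarrow>
       (\<forall>U\<in>\<U>. \<forall>V\<in>\<U>. r U (U \<inter> V) (s U) = r V (U \<inter> V) (s V)) \<longrightarrow>
       (\<exists>!t. t \<in> F (\<Union>\<U>) \<and> (\<forall>U\<in>\<U>. r (\<Union>\<U>) U t = s U))"
    using assms(1) unfolding is_sheaf_def by (elim conjE)
  from this[rule_format, of \<U> s] assms(2-4) show ?thesis by blast
qed

text \<open>Uniqueness in the gluing axiom, for the cover of U by all open sets on which s and t
  agree.\<close>

lemma sheaf_locality:
  assumes sh: "is_sheaf T F r" and U: "openin T U" and s: "s \<in> F U" "t \<in> F U"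
    and loc: "\<And>x. x \<in> U \<Longrightarrow> \<exists>W. openin T W \<and> x \<in> W \<and> W \<subseteq> U \<and> r U W s = r U W t"
  shows "s = t"
proof -
  let ?\<U> = "{W. openin T W \<and> W \<subseteq> U \<and> r U W s = r U W t}"
  have un: "\<Union>?\<U> = U" using loc by blast
  have "\<exists>!v. v \<in> F (\<Union>?\<U>) \<and> (\<forall>W\<in>?\<U>. r (\<Union>?\<U>) W v = r U W s)"
  proof (rule sheaf_glue[OF sh])
    fix V W assume VW: "V \<in> ?\<U>" "W \<in> ?\<U>"
    then have o: "openin T (V \<inter> W)" by auto
    have "r V (V \<inter> W) (r U V s) = r U (V \<inter> W) s"
      by (rule sheaf_restrict_restrict[OF sh U _ o _ _ s(1)]) (use VW in auto)
    moreover have "r W (V \<inter> W) (r U W s) = r U (V \<inter> W) s"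
      by (rule sheaf_restrict_restrict[OF sh U _ o _ _ s(1)]) (use VW in auto)
    ultimately show "r V (V \<inter> W) (r U V s) = r W (V \<inter> W) (r U W s)" by simp
  next
    show "r U W s \<in> F W" if "W \<in> ?\<U>" for W
      using sheaf_restrict_closed[OF sh U _ _ s(1)] that by blast
  qed auto
  then have "\<exists>!v. v \<in> F U \<and> (\<forall>W\<in>?\<U>. r U W v = r U W s)" unfolding un .
  moreover have "s \<in> F U \<and> (\<forall>W\<in>?\<U>. r U W s = r U W s)" "t \<in> F U \<and> (\<forall>W\<in>?\<U>. r U W t = r U W s)"
    using s by simp_all
  ultimately show ?thesis by (rule ex1_eqI)
qed

text \<open>Settles the empty open set in later comparisons, where injectivity of restriction to a
  nonempty open set has nothing to offer.\<close>

lemma sheaf_empty_unique: "is_sheaf T F r \<Longrightarrow> s \<in> F {} \<Longrightarrow> t \<in> F {} \<Longrightarrow> s = t"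
  by (rule sheaf_locality[of T F r "{}"]) auto

lemma openin_open_subspace [simp]:
  "opn X U \<Longrightarrow> opn (open_subspace X U) V \<longleftrightarrow> opn X V \<and> V \<subseteq> U"
  by (simp add: open_subspace_def openin_open_subtopology)

lemma open_subspace_simps [simp]:
  "\<O> (open_subspace X U) = \<O> X" "res (open_subspace X U) = res X"
  by (simp_all add: open_subspace_def)

lemma pts_open_subspace [simp]: "opn X U \<Longrightarrow> pts (open_subspace X U) = U"
  using openin_subset by (fastforce simp: open_subspace_def)

locale ringed =
  fixes X :: "('x, 'r) ringed_space"
  assumes ringed: "is_ringed_space X"
begin

lemma O_cring: "opn X U \<Longrightarrow> cring (\<O> X U)"
  using ringed by (simp add: is_ringed_space_def)

lemma res_hom: "opn X U \<Longrightarrow> opn X V \<Longrightarrow> V \<subseteq> U \<Longrightarrow> res X U V \<in> ring_hom (\<O> X U) (\<O> X V)"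
  using ringed by (simp add: is_ringed_space_def)

lemma O_sheaf: "is_sheaf (top_of X) (\<lambda>U. carrier (\<O> X U)) (res X)"
  using ringed by (simp add: is_ringed_space_def)

lemmas res_id = sheaf_restrict_id[OF O_sheaf]
lemmas res_res = sheaf_restrict_restrict[OF O_sheaf]
lemmas res_closed = sheaf_restrict_closed[OF O_sheaf]
lemmas O_locality = sheaf_locality[OF O_sheaf]
lemmas O_empty = sheaf_empty_unique[OF O_sheaf]

lemma res_mult:
  "opn X U \<Longrightarrow> opn X V \<Longrightarrow> V \<subseteq> U \<Longrightarrow> a \<in> carrier (\<O> X U) \<Longrightarrow> b \<in> carrier (\<O> X U) \<Longrightarrow>
    res X U V (a \<otimes>\<^bsub>\<O> X U\<^esub> b) = res X U V a \<otimes>\<^bsub>\<O> X V\<^esub> res X U V b"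
  by (rule ring_hom_mult[OF res_hom])

lemma res_add:
  "opn X U \<Longrightarrow> opn X V \<Longrightarrow> V \<subseteq> U \<Longrightarrow> a \<in> carrier (\<O> X U) \<Longrightarrow> b \<in> carrier (\<O> X U) \<Longrightarrow>
    res X U V (a \<oplus>\<^bsub>\<O> X U\<^esub> b) = res X U V a \<oplus>\<^bsub>\<O> X V\<^esub> res X U V b"
  by (rule ring_hom_add[OF res_hom])

lemma res_one: "opn X U \<Longrightarrow> opn X V \<Longrightarrow> V \<subseteq> U \<Longrightarrow> res X U V \<one>\<^bsub>\<O> X U\<^esub> = \<one>\<^bsub>\<O> X V\<^esub>"
  by (rule ring_hom_one[OF res_hom])

lemma res_zero: "opn X U \<Longrightarrow> opn X V \<Longrightarrow> V \<subseteq> U \<Longrightarrow> res X U V \<zero>\<^bsub>\<O> X U\<^esub> = \<zero>\<^bsub>\<O> X V\<^esub>"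
  by (rule ring_hom_zero[OF res_hom]) (simp_all add: O_cring cring.axioms(1))

text \<open>The description of sections of a spectrum by fractions, carried over to W. The set
  \<Psi> is the image of R in \<open>\<O> X W\<close>; stating everything through it keeps the
  spectrum out of the later arguments. The last property is how vanishing in a local ring reads on
  W: b/1 = 0 at a prime q means u b = 0 for some u outside q, and u is invertible on its basic open
  set, which contains q.\<close>

lemma affine_fractions:
  assumes W: "affine_open X W"
  obtains \<Psi> where "\<Psi> \<subseteq> carrier (\<O> X W)"
    "\<And>V y t. opn X V \<Longrightarrow> V \<subseteq> W \<Longrightarrow> y \<in> V \<Longrightarrow> t \<in> carrier (\<O> X V) \<Longrightarrow>
      \<exists>D u a. opn X D \<and> y \<in> D \<and> D \<subseteq> V \<and> u \<in> \<Psi> \<and> a \<in> \<Psi> \<and> res X W D u \<in> Units (\<O> X D) \<and>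
        res X W D u \<otimes>\<^bsub>\<O> X D\<^esub> res X V D t = res X W D a"
    "\<And>a V. a \<in> \<Psi> \<Longrightarrow> opn X V \<Longrightarrow> V \<subseteq> W \<Longrightarrow> V \<noteq> {} \<Longrightarrow> res X W V a = \<zero>\<^bsub>\<O> X V\<^esub> \<Longrightarrow>
      \<exists>h\<in>\<Psi>. h \<otimes>\<^bsub>\<O> X W\<^esub> a = \<zero>\<^bsub>\<O> X W\<^esub> \<and>
        (\<exists>D. opn X D \<and> D \<subseteq> W \<and> D \<noteq> {} \<and> res X W D h \<in> Units (\<O> X D))"
proof -
  have oW: "opn X W" using W by (simp add: affine_open_def)
  let ?Y = "open_subspace X W"
  from W obtain R :: "'r ring" and f where R: "cring R" and iso: "rs_iso ?Y (Spec R) f"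
    by (auto simp: affine_open_def is_affine_def)
  interpret R: cring R by fact
  let ?P = "spec_points R"
  define pre where "pre Z = preim ?Y f Z" for Z
  define c where "c = comor f"
  have pre_iff: "x \<in> pre Z \<longleftrightarrow> x \<in> W \<and> base f x \<in> Z" for x Z
    using oW by (simp add: pre_def preim_def)
  have homeo: "homeomorphic_map (top_of ?Y) (top_of (Spec R)) (base f)"
    and mor: "rs_morphism ?Y (Spec R) f" using iso by (auto simp: rs_iso_def)
  have cbij: "bij_betw (c Z) (carrier (\<O> (Spec R) Z)) (carrier (\<O> X (pre Z)))" if "zariski_open R Z" for Z
    using iso that by (simp add: rs_iso_def c_def pre_def)
  have chom: "c Z \<in> ring_hom (\<O> (Spec R) Z) (\<O> X (pre Z))" if "zariski_open R Z" for Z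
    using mor that by (simp add: rs_morphism_def c_def pre_def)
  have cres: "c Z' (res (Spec R) Z Z' s) = res X (pre Z) (pre Z') (c Z s)"
    if "zariski_open R Z" "zariski_open R Z'" "Z' \<subseteq> Z" "s \<in> carrier (\<O> (Spec R) Z)" for Z Z' s
    using mor that by (simp add: rs_morphism_def c_def pre_def)
  have base_in: "base f x \<in> ?P" if "x \<in> W" for x
    using homeomorphic_imp_surjective_map[OF homeo] that oW by auto
  have "base f ` W = ?P"
    using homeomorphic_imp_surjective_map[OF homeo] oW by simp
  then have surj: "\<exists>x\<in>W. base f x = p" if "p \<in> ?P" for p
    using that by (metis imageE)
  have inj: "inj_on (base f) W" using homeomorphic_imp_injective_map[OF homeo] oW by simp
  have pre_open: "opn X (pre Z)" if "zariski_open R Z" for Z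
  proof -
    have "openin (top_of ?Y) {x \<in> topspace (top_of ?Y). base f x \<in> Z}"
      by (rule openin_continuous_map_preimage[OF homeomorphic_imp_continuous_map[OF homeo]]) (use that in simp)
    then show ?thesis using oW by (simp add: pre_def preim_def)
  qed
  have pre_sub: "pre Z \<subseteq> W" for Z using pre_iff by auto
  have pre_mono: "Z' \<subseteq> Z \<Longrightarrow> pre Z' \<subseteq> pre Z" for Z Z' using pre_iff by auto
  have preP: "pre ?P = W" using pre_iff base_in by auto
  have img: "zariski_open R (base f ` V) \<and> pre (base f ` V) = V" if V: "opn X V" "V \<subseteq> W" for V
  proof
    have "openin (top_of (Spec R)) (base f ` V)"
      using homeomorphic_imp_open_map[OF homeo] V oW unfolding open_map_def by simp
    then show "zariski_open R (base f ` V)" by simp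
    show "pre (base f ` V) = V" 
    proof (rule Set.set_eqI)
      fix x show "x \<in> pre (base f ` V) \<longleftrightarrow> x \<in> V"
        using V(2) inj_on_image_mem_iff[OF inj _ V(2), of x] pre_iff[of x "base f ` V"] by blast
    qed
  qed
  have no1: "\<one>\<^bsub>R\<^esub> \<notin> q" if "q \<in> ?P" for q
  proof -
    interpret primeideal q R using that by (simp add: spec_points_def)
    show ?thesis
    proof
      assume "\<one>\<^bsub>R\<^esub> \<in> q"
      then have "q = carrier R" by (rule one_imp_carrier)
      then show False using I_notcarr by simp
    qed
  qed
  have no1': "\<one>\<^bsub>R\<^esub> \<notin> q" if "q \<in> Z" "zariski_open R Z" for q Z
    using no1 zariski_open_subset[OF that(2)] that(1) by auto
  define \<psi> where "\<psi> a = c ?P (frac_section R ?P a \<one>\<^bsub>R\<^esub>)" for a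
  have fc: "frac_section R Z a \<one>\<^bsub>R\<^esub> \<in> carrier (\<O> (Spec R) Z)" if "a \<in> carrier R" "zariski_open R Z" for a Z
    using frac_section_closed[OF that(2,1) R.one_closed no1'[OF _ that(2)]] .
  have \<psi>_closed: "\<psi> a \<in> carrier (\<O> X W)" if "a \<in> carrier R" for a
    using ring_hom_closed[OF chom[OF zariski_open_UNIV] fc[OF that zariski_open_UNIV]] preP
    by (simp add: \<psi>_def)
  have \<psi>_mult: "\<psi> a \<otimes>\<^bsub>\<O> X W\<^esub> \<psi> b = \<psi> (a \<otimes>\<^bsub>R\<^esub> b)" if "a \<in> carrier R" "b \<in> carrier R" for a b
    using ring_hom_mult[OF chom[OF zariski_open_UNIV] fc[OF that(1) zariski_open_UNIV] fc[OF that(2) zariski_open_UNIV]]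
      frac_section_mult[OF zariski_open_UNIV that(1) R.one_closed no1 that(2) R.one_closed no1] preP
    by (simp add: \<psi>_def)
  \<comment> \<open>Zero of \<open>\<O> X W\<close> is the image of some section s because the
    comparison is surjective. The image of the zero section absorbs the image of s, hence is a
    multiple of zero.\<close>
  have \<psi>_zero: "\<psi> \<zero>\<^bsub>R\<^esub> = \<zero>\<^bsub>\<O> X W\<^esub>"
  proof -
    have "\<zero>\<^bsub>\<O> X W\<^esub> \<in> c ?P ` carrier (\<O> (Spec R) ?P)"
      unfolding bij_betw_imp_surj_on[OF cbij[OF zariski_open_UNIV]] preP
      by (rule cring.cring_simprules(2)[OF O_cring[OF oW]])
    then obtain s where s: "s \<in> carrier (\<O> (Spec R) ?P)" "c ?P s = \<zero>\<^bsub>\<O> X W\<^esub>"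
      by (elim imageE) (rule that, auto)
    have "\<psi> \<zero>\<^bsub>R\<^esub> = \<psi> \<zero>\<^bsub>R\<^esub> \<otimes>\<^bsub>\<O> X W\<^esub> c ?P s"
      using ring_hom_mult[OF chom[OF zariski_open_UNIV] fc[OF R.zero_closed zariski_open_UNIV] s(1)]
        zero_section_mult[OF R zariski_open_UNIV s(1)] preP by (simp add: \<psi>_def)
    also have "\<dots> = \<zero>\<^bsub>\<O> X W\<^esub>"
      unfolding s(2) by (rule cring.cring_simprules(27)[OF O_cring[OF oW] \<psi>_closed[OF R.zero_closed]])
    finally show ?thesis .
  qed
  have \<psi>_res: "res X W (pre Z) (\<psi> a) = c Z (frac_section R Z a \<one>\<^bsub>R\<^esub>)"
    if "a \<in> carrier R" "zariski_open R Z" for a Z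
    using cres[OF zariski_open_UNIV that(2) zariski_open_subset[OF that(2)] fc[OF that(1) zariski_open_UNIV]]
      res_frac_section[OF zariski_open_subset[OF that(2)]] preP by (simp add: \<psi>_def)
  have \<psi>_unit: "res X W (pre Z) (\<psi> g) \<in> Units (\<O> X (pre Z))"
    if g: "g \<in> carrier R" and Z: "zariski_open R Z" and gZ: "\<And>q. q \<in> Z \<Longrightarrow> g \<notin> q" for g Z
  proof -
    interpret OZ: cring "\<O> X (pre Z)" by (rule O_cring[OF pre_open[OF Z]])
    have inv: "frac_section R Z \<one>\<^bsub>R\<^esub> g \<in> carrier (\<O> (Spec R) Z)"
      by (rule frac_section_closed[OF Z R.one_closed g gZ])
    have "frac_section R Z g \<one>\<^bsub>R\<^esub> \<otimes>\<^bsub>\<O> (Spec R) Z\<^esub> frac_section R Z \<one>\<^bsub>R\<^esub> g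
      = frac_section R Z g g"
      using frac_section_mult[OF Z g R.one_closed no1'[OF _ Z] R.one_closed g gZ] g by simp
    also have "\<dots> = \<one>\<^bsub>\<O> (Spec R) Z\<^esub>"
      unfolding frac_section_one[OF Z]
      by (rule frac_section_eqI[OF Z]) (use g gZ no1'[OF _ Z] in auto)
    finally have "c Z (frac_section R Z g \<one>\<^bsub>R\<^esub>) \<otimes>\<^bsub>\<O> X (pre Z)\<^esub> c Z (frac_section R Z \<one>\<^bsub>R\<^esub> g)
        = \<one>\<^bsub>\<O> X (pre Z)\<^esub>"
      using ring_hom_mult[OF chom[OF Z] fc[OF g Z] inv] ring_hom_one[OF chom[OF Z]] by simp
    then show ?thesis
      unfolding \<psi>_res[OF g Z]
      by (rule OZ.UnitsI_comm[OF ring_hom_closed[OF chom[OF Z] fc[OF g Z]] ring_hom_closed[OF chom[OF Z] inv]])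
  qed
  show thesis
  proof (rule that[of "\<psi> ` carrier R"])
    show "\<psi> ` carrier R \<subseteq> carrier (\<O> X W)" using \<psi>_closed by auto
    show "\<exists>D u a. opn X D \<and> y \<in> D \<and> D \<subseteq> V \<and> u \<in> \<psi> ` carrier R \<and> a \<in> \<psi> ` carrier R \<and>
        res X W D u \<in> Units (\<O> X D) \<and> res X W D u \<otimes>\<^bsub>\<O> X D\<^esub> res X V D t = res X W D a"
      if V: "opn X V" "V \<subseteq> W" "y \<in> V" and t: "t \<in> carrier (\<O> X V)" for V y t
    proof -
      have Z: "zariski_open R (base f ` V)" and pV: "pre (base f ` V) = V" using img[OF V(1,2)] by auto
      have "t \<in> c (base f ` V) ` carrier (\<O> (Spec R) (base f ` V))"
        unfolding bij_betw_imp_surj_on[OF cbij[OF Z]] pV by (rule t)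
      then obtain t' where t': "t' \<in> carrier (\<O> (Spec R) (base f ` V))" "c (base f ` V) t' = t"
        by (elim imageE) (rule that, auto)
      have "base f y \<in> base f ` V" using V(3) by (rule imageI)
      \<comment> \<open>Near the point of y the section is the single fraction a/g; the preimage of
        Z1 serves as D, and g is invertible there.\<close>
      obtain Z1 a g where Z1: "zariski_open R Z1" "base f y \<in> Z1" "Z1 \<subseteq> base f ` V"
        and ag: "a \<in> carrier R" "g \<in> carrier R"
        and loc: "\<forall>q\<in>Z1. g \<notin> q \<and> t' q = fraction R (carrier R - q) a g"
        using spec_sections_local[OF t'(1) \<open>base f y \<in> base f ` V\<close>] by (elim exE conjE) (rule that)
      have r: "res (Spec R) (base f ` V) Z1 t' = frac_section R Z1 a g"
        using loc by (auto simp: Spec_def frac_section_def intro!: restrict_ext)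
      have gZ: "\<And>q. q \<in> Z1 \<Longrightarrow> g \<notin> q" using loc by auto
      have tD: "res X V (pre Z1) t = c Z1 (frac_section R Z1 a g)"
        using cres[OF Z Z1(1,3) t'(1)] r t'(2) pV by simp
      have "frac_section R Z1 g \<one>\<^bsub>R\<^esub> \<otimes>\<^bsub>\<O> (Spec R) Z1\<^esub> frac_section R Z1 a g
         = frac_section R Z1 (g \<otimes>\<^bsub>R\<^esub> a) (\<one>\<^bsub>R\<^esub> \<otimes>\<^bsub>R\<^esub> g)"
        by (rule frac_section_mult[OF Z1(1) ag(2) R.one_closed no1'[OF _ Z1(1)] ag gZ])
      also have "\<dots> = frac_section R Z1 a \<one>\<^bsub>R\<^esub>"
        by (rule frac_section_eqI[OF Z1(1)]) (use ag gZ no1'[OF _ Z1(1)] in \<open>auto simp: R.m_comm\<close>)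
      finally have "res X W (pre Z1) (\<psi> g) \<otimes>\<^bsub>\<O> X (pre Z1)\<^esub> res X V (pre Z1) t = res X W (pre Z1) (\<psi> a)"
        unfolding tD \<psi>_res[OF ag(2) Z1(1)] \<psi>_res[OF ag(1) Z1(1)]
        using ring_hom_mult[OF chom[OF Z1(1)] fc[OF ag(2) Z1(1)] frac_section_closed[OF Z1(1) ag gZ]]
        by simp
      moreover have "y \<in> pre Z1" "pre Z1 \<subseteq> V" using V Z1 pV pre_mono[OF Z1(3)] by (auto simp: pre_iff)
      ultimately show ?thesis
        using pre_open[OF Z1(1)] \<psi>_unit[OF ag(2) Z1(1) gZ] ag
        by (intro exI[of _ "pre Z1"] exI[of _ "\<psi> g"] exI[of _ "\<psi> a"]) simp
    qed
    show "\<exists>h\<in>\<psi> ` carrier R. h \<otimes>\<^bsub>\<O> X W\<^esub> a = \<zero>\<^bsub>\<O> X W\<^esub> \<and>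
        (\<exists>D. opn X D \<and> D \<subseteq> W \<and> D \<noteq> {} \<and> res X W D h \<in> Units (\<O> X D))"
      if a: "a \<in> \<psi> ` carrier R" and V: "opn X V" "V \<subseteq> W" "V \<noteq> {}" and a0: "res X W V a = \<zero>\<^bsub>\<O> X V\<^esub>" for a V
    proof -
      obtain b where b: "b \<in> carrier R" "a = \<psi> b" using a by auto
      have Z: "zariski_open R (base f ` V)" and pV: "pre (base f ` V) = V" using img[OF V(1,2)] by auto
      let ?Z = "base f ` V"
      have "c ?Z (frac_section R ?Z b \<one>\<^bsub>R\<^esub>) = c ?Z (frac_section R ?Z \<zero>\<^bsub>R\<^esub> \<one>\<^bsub>R\<^esub>)"
        using \<psi>_res[OF b(1) Z] \<psi>_res[OF R.zero_closed Z] \<psi>_zero a0 b(2) pV res_zero[OF oW V(1,2)] by simp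
      then have eq: "frac_section R ?Z b \<one>\<^bsub>R\<^esub> = frac_section R ?Z \<zero>\<^bsub>R\<^esub> \<one>\<^bsub>R\<^esub>"
        using cbij[OF Z] fc[OF b(1) Z] fc[OF R.zero_closed Z] by (intro inj_onD[OF bij_betw_imp_inj_on[OF cbij[OF Z]]]) auto
      \<comment> \<open>One prime suffices: equality with zero in the local ring at q already yields
        u outside q with u b = 0.\<close>
      obtain q where q: "q \<in> ?Z" using V(3) by auto
      interpret S: cring_multiplicative_set R "carrier R - q" by (rule mset_at[OF Z q])
      have "fraction R (carrier R - q) b \<one>\<^bsub>R\<^esub> = fraction R (carrier R - q) \<zero>\<^bsub>R\<^esub> \<one>\<^bsub>R\<^esub>"
        using fun_cong[OF eq, of q] q by (simp add: frac_section_def)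
      then have "(b, \<one>\<^bsub>R\<^esub>) \<in> fraction R (carrier R - q) \<zero>\<^bsub>R\<^esub> \<one>\<^bsub>R\<^esub>"
        using S.fraction_self[OF b(1) S.S_one] by simp
      then obtain u where u: "u \<in> carrier R" "u \<notin> q" "u \<otimes>\<^bsub>R\<^esub> b = \<zero>\<^bsub>R\<^esub>"
        using S.mem_fraction_iff[OF R.zero_closed S.S_one] b(1) by auto
      let ?D = "{p \<in> ?P. u \<notin> p}"
      have D: "zariski_open R ?D" by (rule zariski_open_basic[OF u(1)])
      have "q \<in> ?D" using q u zariski_open_subset[OF Z] by auto
      then have "pre ?D \<noteq> {}" using surj[of q] by (auto simp: pre_iff)
      moreover have "\<psi> u \<otimes>\<^bsub>\<O> X W\<^esub> a = \<zero>\<^bsub>\<O> X W\<^esub>"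
        using \<psi>_mult[OF u(1) b(1)] u(3) \<psi>_zero b(2) by simp
      moreover have "res X W (pre ?D) (\<psi> u) \<in> Units (\<O> X (pre ?D))"
        by (rule \<psi>_unit[OF u(1) D]) simp
      ultimately show ?thesis
        by (intro bexI[of _ "\<psi> u"] conjI exI[of _ "pre ?D"] pre_open[OF D] pre_sub imageI[OF u(1)])
    qed
  qed
qed

end

section \<open>Stalks and integrality\<close>

context ringed
begin

lemma O_zero_closed: "opn X U \<Longrightarrow> \<zero>\<^bsub>\<O> X U\<^esub> \<in> carrier (\<O> X U)"
  by (rule cring.cring_simprules(2)[OF O_cring])

lemma O_one_closed: "opn X U \<Longrightarrow> \<one>\<^bsub>\<O> X U\<^esub> \<in> carrier (\<O> X U)"
  by (rule cring.cring_simprules(6)[OF O_cring])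

lemma O_mult_closed:
  "opn X U \<Longrightarrow> a \<in> carrier (\<O> X U) \<Longrightarrow> b \<in> carrier (\<O> X U) \<Longrightarrow> a \<otimes>\<^bsub>\<O> X U\<^esub> b \<in> carrier (\<O> X U)"
  by (rule cring.cring_simprules(5)[OF O_cring])

lemma opn_pts: "opn X (pts X)"
  by simp

lemma mem_germ_iff:
  "(V, t) \<in> germ X x U s \<longleftrightarrow> opn X V \<and> x \<in> V \<and> t \<in> carrier (\<O> X V) \<and>
     (\<exists>W. opn X W \<and> x \<in> W \<and> W \<subseteq> U \<and> W \<subseteq> V \<and> res X U W s = res X V W t)"
  by (simp add: germ_def)

lemma germ_self: "opn X U \<Longrightarrow> x \<in> U \<Longrightarrow> s \<in> carrier (\<O> X U) \<Longrightarrow> (U, s) \<in> germ X x U s"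
  by (auto simp: mem_germ_iff)

lemma germ_subset:
  assumes U: "opn X U" "s \<in> carrier (\<O> X U)" and V: "opn X V" "t \<in> carrier (\<O> X V)"
    and W: "opn X W" "x \<in> W" "W \<subseteq> U" "W \<subseteq> V" "res X U W s = res X V W t"
  shows "germ X x U s \<subseteq> germ X x V t"
proof
  fix p assume "p \<in> germ X x U s"
  then obtain V' r where p: "p = (V', r)" "(V', r) \<in> germ X x U s" by (cases p) auto
  then obtain W' where r: "opn X V'" "x \<in> V'" "r \<in> carrier (\<O> X V')" and
    W': "opn X W'" "x \<in> W'" "W' \<subseteq> U" "W' \<subseteq> V'" "res X U W' s = res X V' W' r"
    by (auto simp: mem_germ_iff)
  let ?N = "W \<inter> W'"
  have N: "opn X ?N" using W W' by auto
  have "res X V ?N t = res X W ?N (res X V W t)" by (rule res_res[OF V(1) W(1) N, symmetric]) (use W V in auto)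
  also have "\<dots> = res X U ?N s" unfolding W(5)[symmetric] by (rule res_res[OF U(1) W(1) N]) (use W U in auto)
  also have "\<dots> = res X W' ?N (res X U W' s)" by (rule res_res[OF U(1) W'(1) N, symmetric]) (use W' U in auto)
  also have "\<dots> = res X V' ?N r" unfolding W'(5) by (rule res_res[OF r(1) W'(1) N]) (use W' r in auto)
  finally show "p \<in> germ X x V t"
    unfolding p(1) mem_germ_iff using r N W W' by (intro conjI exI[of _ ?N]) auto
qed

lemma germ_eqI:
  assumes "opn X U" "s \<in> carrier (\<O> X U)" "opn X V" "t \<in> carrier (\<O> X V)"
    "opn X W" "x \<in> W" "W \<subseteq> U" "W \<subseteq> V" "res X U W s = res X V W t"
  shows "germ X x U s = germ X x V t"
  using germ_subset[OF assms] germ_subset[OF assms(3,4,1,2,5,6,8,7) assms(9)[symmetric]] by (rule equalityI)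

lemma germ_eqD:
  assumes "germ X x U s = germ X x V t" "opn X V" "x \<in> V" "t \<in> carrier (\<O> X V)"
  obtains W where "opn X W" "x \<in> W" "W \<subseteq> U" "W \<subseteq> V" "res X U W s = res X V W t"
proof -
  have "(V, t) \<in> germ X x U s" unfolding assms(1) by (rule germ_self[OF assms(2-4)])
  then show thesis using that by (auto simp: mem_germ_iff)
qed

text \<open>Any two representatives agree with s and t on a common neighbourhood W \<inter> W' of x,
  so all sets in the union that defines the product are one and the same germ.\<close>

lemma stalk_mult:
  assumes U: "opn X U" "x \<in> U" and s: "s \<in> carrier (\<O> X U)" and t: "t \<in> carrier (\<O> X U)"
  shows "germ X x U s \<otimes>\<^bsub>stalk X x\<^esub> germ X x U t = germ X x U (s \<otimes>\<^bsub>\<O> X U\<^esub> t)"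
proof -
  let ?m = "\<lambda>V r V' r'. germ X x (V \<inter> V') (res X V (V \<inter> V') r \<otimes>\<^bsub>\<O> X (V \<inter> V')\<^esub> res X V' (V \<inter> V') r')"
  have eq: "?m V r V' r' = germ X x U (s \<otimes>\<^bsub>\<O> X U\<^esub> t)"
    if "(V, r) \<in> germ X x U s" "(V', r') \<in> germ X x U t" for V r V' r'
  proof -
    from that(1) obtain W where V: "opn X V" "x \<in> V" "r \<in> carrier (\<O> X V)" and
      W: "opn X W" "x \<in> W" "W \<subseteq> U" "W \<subseteq> V" "res X U W s = res X V W r" by (auto simp: mem_germ_iff)
    from that(2) obtain W' where V': "opn X V'" "x \<in> V'" "r' \<in> carrier (\<O> X V')" and
      W': "opn X W'" "x \<in> W'" "W' \<subseteq> U" "W' \<subseteq> V'" "res X U W' t = res X V' W' r'" by (auto simp: mem_germ_iff)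
    let ?N = "W \<inter> W'" and ?M = "V \<inter> V'"
    have o: "opn X ?N" "opn X ?M" using W W' V V' by auto
    have sub: "?N \<subseteq> W" "?N \<subseteq> W'" "?N \<subseteq> ?M" "?M \<subseteq> V" "?M \<subseteq> V'" "?N \<subseteq> U" using W W' by auto
    have rc: "res X V ?M r \<in> carrier (\<O> X ?M)" "res X V' ?M r' \<in> carrier (\<O> X ?M)"
      by (rule res_closed[OF V(1) o(2) sub(4) V(3)], rule res_closed[OF V'(1) o(2) sub(5) V'(3)])
    have "res X V ?N r = res X W ?N (res X V W r)" by (rule res_res[OF V(1) W(1) o(1) sub(1) W(4) V(3), symmetric])
    also have "\<dots> = res X U ?N s" unfolding W(5)[symmetric] by (rule res_res[OF U(1) W(1) o(1) sub(1) W(3) s])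
    finally have 1: "res X V ?N r = res X U ?N s" .
    have "res X V' ?N r' = res X W' ?N (res X V' W' r')"
      by (rule res_res[OF V'(1) W'(1) o(1) sub(2) W'(4) V'(3), symmetric])
    also have "\<dots> = res X U ?N t" unfolding W'(5)[symmetric] by (rule res_res[OF U(1) W'(1) o(1) sub(2) W'(3) t])
    finally have 2: "res X V' ?N r' = res X U ?N t" .
    show ?thesis
    proof (rule germ_eqI[OF o(2) O_mult_closed[OF o(2) rc] U(1) O_mult_closed[OF U(1) s t] o(1) _ sub(3) sub(6)])
      show "x \<in> ?N" using W W' by auto
      show "res X ?M ?N (res X V ?M r \<otimes>\<^bsub>\<O> X ?M\<^esub> res X V' ?M r') = res X U ?N (s \<otimes>\<^bsub>\<O> X U\<^esub> t)"
        unfolding res_mult[OF o(2,1) sub(3) rc] res_mult[OF U(1) o(1) sub(6) s t]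
          res_res[OF V(1) o(2,1) sub(3,4) V(3)] res_res[OF V'(1) o(2,1) sub(3,5) V'(3)] 1 2 ..
    qed
  qed
  have "(\<Union>(V', r')\<in>germ X x U t. ?m V r V' r') = germ X x U (s \<otimes>\<^bsub>\<O> X U\<^esub> t)"
    if "(V, r) \<in> germ X x U s" for V r
    by (rule SUP_eq_const) (use eq[OF that] germ_self[OF U t] in auto)
  then have "(\<Union>(V, r)\<in>germ X x U s. \<Union>(V', r')\<in>germ X x U t. ?m V r V' r')
      = germ X x U (s \<otimes>\<^bsub>\<O> X U\<^esub> t)"
    by (intro SUP_eq_const) (use germ_self[OF U s] in auto)
  then show ?thesis by (simp add: stalk_def)
qed

lemma stalk_zero:
  assumes "opn X U" "x \<in> U"
  shows "\<zero>\<^bsub>stalk X x\<^esub> = germ X x U \<zero>\<^bsub>\<O> X U\<^esub>"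
proof -
  have "U \<subseteq> pts X" using assms(1) openin_subset by auto
  then have "germ X x (pts X) \<zero>\<^bsub>\<O> X (pts X)\<^esub> = germ X x U \<zero>\<^bsub>\<O> X U\<^esub>"
    by (intro germ_eqI[of _ _ _ _ U] opn_pts O_zero_closed) (use assms res_zero[OF opn_pts] res_id O_zero_closed in auto)
  then show ?thesis by (simp add: stalk_def)
qed

lemma stalk_one:
  assumes "opn X U" "x \<in> U"
  shows "\<one>\<^bsub>stalk X x\<^esub> = germ X x U \<one>\<^bsub>\<O> X U\<^esub>"
proof -
  have "U \<subseteq> pts X" using assms(1) openin_subset by auto
  then have "germ X x (pts X) \<one>\<^bsub>\<O> X (pts X)\<^esub> = germ X x U \<one>\<^bsub>\<O> X U\<^esub>"
    by (intro germ_eqI[of _ _ _ _ U] opn_pts O_one_closed) (use assms res_one[OF opn_pts] res_id O_one_closed in auto)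
  then show ?thesis by (simp add: stalk_def)
qed

lemma germ_in_stalk: "opn X U \<Longrightarrow> x \<in> U \<Longrightarrow> s \<in> carrier (\<O> X U) \<Longrightarrow> germ X x U s \<in> carrier (stalk X x)"
  by (auto simp: stalk_def)

lemma Units_res:
  assumes "opn X U" "opn X V" "V \<subseteq> U" "u \<in> Units (\<O> X U)"
  shows "res X U V u \<in> Units (\<O> X V)"
proof -
  interpret U: cring "\<O> X U" by (rule O_cring[OF assms(1)])
  interpret V: cring "\<O> X V" by (rule O_cring[OF assms(2)])
  have u: "u \<in> carrier (\<O> X U)" "inv\<^bsub>\<O> X U\<^esub> u \<in> carrier (\<O> X U)" using assms(4) by auto
  have "res X U V u \<otimes>\<^bsub>\<O> X V\<^esub> res X U V (inv\<^bsub>\<O> X U\<^esub> u) = \<one>\<^bsub>\<O> X V\<^esub>"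
    using res_mult[OF assms(1-3) u] res_one[OF assms(1-3)] assms(4) by simp
  then show ?thesis using res_closed[OF assms(1-3)] u by (intro V.UnitsI_comm) auto
qed

end

text \<open>The two axioms take the place of a function field: sections may be compared after
  restriction to any nonempty open set, and finitely many such sets have a nonempty
  intersection.\<close>

locale integral_ringed = ringed X for X :: "('x, 'r) ringed_space" +
  assumes irreducible: "opn X U \<Longrightarrow> opn X V \<Longrightarrow> U \<noteq> {} \<Longrightarrow> V \<noteq> {} \<Longrightarrow> U \<inter> V \<noteq> {}"
    and res_inj: "opn X U \<Longrightarrow> opn X V \<Longrightarrow> V \<subseteq> U \<Longrightarrow> V \<noteq> {} \<Longrightarrow> s \<in> carrier (\<O> X U) \<Longrightarrow>
      t \<in> carrier (\<O> X U) \<Longrightarrow> res X U V s = res X U V t \<Longrightarrow> s = t"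

lemma irreducible_subset_Int_nonempty:
  assumes "irreducible_subset T (topspace T)" "openin T U" "openin T V" "U \<noteq> {}" "V \<noteq> {}"
  shows "U \<inter> V \<noteq> {}"
proof
  assume "U \<inter> V = {}"
  then have "topspace T \<subseteq> (topspace T - U) \<union> (topspace T - V)" by auto
  moreover have "closedin T (topspace T - U)" "closedin T (topspace T - V)" using assms by auto
  ultimately have "topspace T \<subseteq> topspace T - U \<or> topspace T \<subseteq> topspace T - V"
    using assms(1) unfolding irreducible_subset_def by meson
  then show False using openin_subset[OF assms(2)] openin_subset[OF assms(3)] assms(4,5) by blast
qed

text \<open>A section s that vanishes somewhere has to vanish near every point x. Near x it is a
  fraction a/u, and the numerator a vanishes on a nonempty open set, so h a = 0 for some h that is
  invertible somewhere. The germ of h at x is not zero, and as the stalk is a domain, the germ of a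
  is.\<close>

lemma (in ringed) integral_ringed_of_stalks:
  assumes irr: "irreducible_subset (top_of X) (pts X)"
    and aff: "\<And>x. x \<in> pts X \<Longrightarrow> \<exists>U. x \<in> U \<and> affine_open X U"
    and dom: "\<And>x. x \<in> pts X \<Longrightarrow> domain (stalk X x)"
  shows "integral_ringed X"
proof -
  note int = irreducible_subset_Int_nonempty[OF irr]
  have zero: "s = \<zero>\<^bsub>\<O> X W\<^esub>" if W: "opn X W" and V: "opn X V" "V \<subseteq> W" "V \<noteq> {}"
    and s: "s \<in> carrier (\<O> X W)" and s0: "res X W V s = \<zero>\<^bsub>\<O> X V\<^esub>" for W V s
  proof (rule O_locality[OF W s O_zero_closed[OF W]])
    fix x assume x: "x \<in> W"
    then have xp: "x \<in> pts X" using openin_subset[OF W] by auto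
    then obtain A where A: "x \<in> A" "affine_open X A" using aff by blast
    then have oA: "opn X A" by (simp add: affine_open_def)
    let ?B = "A \<inter> W"
    have B: "opn X ?B" "?B \<subseteq> A" "?B \<subseteq> W" "x \<in> ?B" using oA W A x by auto
    obtain \<Psi> where \<Psi>: "\<Psi> \<subseteq> carrier (\<O> X A)"
      and frac: "\<And>V y t. opn X V \<Longrightarrow> V \<subseteq> A \<Longrightarrow> y \<in> V \<Longrightarrow> t \<in> carrier (\<O> X V) \<Longrightarrow>
        \<exists>D u a. opn X D \<and> y \<in> D \<and> D \<subseteq> V \<and> u \<in> \<Psi> \<and> a \<in> \<Psi> \<and> res X A D u \<in> Units (\<O> X D) \<and>
        res X A D u \<otimes>\<^bsub>\<O> X D\<^esub> res X V D t = res X A D a"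
      and ann: "\<And>a V. a \<in> \<Psi> \<Longrightarrow> opn X V \<Longrightarrow> V \<subseteq> A \<Longrightarrow> V \<noteq> {} \<Longrightarrow> res X A V a = \<zero>\<^bsub>\<O> X V\<^esub> \<Longrightarrow>
        \<exists>h\<in>\<Psi>. h \<otimes>\<^bsub>\<O> X A\<^esub> a = \<zero>\<^bsub>\<O> X A\<^esub> \<and>
          (\<exists>D. opn X D \<and> D \<subseteq> A \<and> D \<noteq> {} \<and> res X A D h \<in> Units (\<O> X D))"
      by (rule affine_fractions[OF A(2)]) (rule that)
    obtain D u a where D: "opn X D" "x \<in> D" "D \<subseteq> ?B" and ua: "u \<in> \<Psi>" "a \<in> \<Psi>"
      and unit: "res X A D u \<in> Units (\<O> X D)"
      and eq: "res X A D u \<otimes>\<^bsub>\<O> X D\<^esub> res X ?B D (res X W ?B s) = res X A D a"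
      using frac[OF B(1,2,4) res_closed[OF W B(1,3) s]] by (elim exE conjE) (rule that)
    have DA: "D \<subseteq> A" "D \<subseteq> W" using D B by auto
    have eq': "res X A D u \<otimes>\<^bsub>\<O> X D\<^esub> res X W D s = res X A D a"
      using eq unfolding res_res[OF W B(1) D(1,3) B(3) s] .
    have ua': "u \<in> carrier (\<O> X A)" "a \<in> carrier (\<O> X A)" using ua \<Psi> by auto
    have sD: "res X W D s \<in> carrier (\<O> X D)" by (rule res_closed[OF W D(1) DA(2) s])
    have uD: "res X A D u \<in> carrier (\<O> X D)" by (rule res_closed[OF oA D(1) DA(1) ua'(1)])
    \<comment> \<open>Irreducibility makes D \<inter> V nonempty; there s = 0 forces the numerator a
      to vanish.\<close>
    let ?DV = "D \<inter> V"
    have DV: "opn X ?DV" "?DV \<subseteq> D" "?DV \<subseteq> V" "?DV \<subseteq> A" "?DV \<noteq> {}"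
      using D V DA int[OF D(1) V(1)] by auto
    interpret DVr: cring "\<O> X ?DV" by (rule O_cring[OF DV(1)])
    have s0': "res X D ?DV (res X W D s) = \<zero>\<^bsub>\<O> X ?DV\<^esub>"
      using res_res[OF W D(1) DV(1,2) DA(2) s] res_res[OF W V(1) DV(1,3) V(2) s] s0 res_zero[OF V(1) DV(1,3)]
      by simp
    have "res X A ?DV a = res X D ?DV (res X A D a)"
      by (rule res_res[OF oA D(1) DV(1,2) DA(1) ua'(2), symmetric])
    also have "\<dots> = res X D ?DV (res X A D u) \<otimes>\<^bsub>\<O> X ?DV\<^esub> \<zero>\<^bsub>\<O> X ?DV\<^esub>"
      unfolding eq'[symmetric] res_mult[OF D(1) DV(1,2) uD sD] s0' ..
    also have "\<dots> = \<zero>\<^bsub>\<O> X ?DV\<^esub>" by (rule DVr.r_null[OF res_closed[OF D(1) DV(1,2) uD]])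
    finally obtain h D' where h: "h \<in> \<Psi>" "h \<otimes>\<^bsub>\<O> X A\<^esub> a = \<zero>\<^bsub>\<O> X A\<^esub>" and
      D': "opn X D'" "D' \<subseteq> A" "D' \<noteq> {}" "res X A D' h \<in> Units (\<O> X D')"
      using ann[OF ua(2) DV(1,4,5)] by blast
    have hA: "h \<in> carrier (\<O> X A)" using h \<Psi> by auto
    have "germ X x A h \<otimes>\<^bsub>stalk X x\<^esub> germ X x A a = \<zero>\<^bsub>stalk X x\<^esub>"
      unfolding stalk_mult[OF oA A(1) hA ua'(2)] h(2) stalk_zero[OF oA A(1)] ..
    then have "germ X x A h = \<zero>\<^bsub>stalk X x\<^esub> \<or> germ X x A a = \<zero>\<^bsub>stalk X x\<^esub>"
      by (rule domain.integral[OF dom[OF xp] _ germ_in_stalk[OF oA A(1) hA] germ_in_stalk[OF oA A(1) ua'(2)]])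
    \<comment> \<open>If h vanished near x, it would be both zero and a unit on a nonempty open set
      by irreducibility; then 1 = 0 there and in the stalks at its points.\<close>
    moreover have "germ X x A h \<noteq> \<zero>\<^bsub>stalk X x\<^esub>"
    proof
      assume "germ X x A h = \<zero>\<^bsub>stalk X x\<^esub>"
      then have "germ X x A h = germ X x A \<zero>\<^bsub>\<O> X A\<^esub>" unfolding stalk_zero[OF oA A(1)] .
      then obtain N where N: "opn X N" "x \<in> N" "N \<subseteq> A" "res X A N h = res X A N \<zero>\<^bsub>\<O> X A\<^esub>"
        by (rule germ_eqD[OF _ oA A(1) O_zero_closed[OF oA]]) (rule that)
      let ?M = "N \<inter> D'"
      have M: "opn X ?M" "?M \<subseteq> N" "?M \<subseteq> D'" "?M \<noteq> {}"
        using N D' int[OF N(1) D'(1)] by auto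
      interpret Mr: cring "\<O> X ?M" by (rule O_cring[OF M(1)])
      have "res X A ?M h = \<zero>\<^bsub>\<O> X ?M\<^esub>"
        using res_res[OF oA N(1) M(1,2) N(3) hA] N(4) res_zero[OF oA N(1,3)] res_zero[OF N(1) M(1,2)] by simp
      moreover have "res X A ?M h \<in> Units (\<O> X ?M)"
        using Units_res[OF D'(1) M(1,3) D'(4)] res_res[OF oA D'(1) M(1,3) D'(2) hA] by simp
      ultimately have "\<zero>\<^bsub>\<O> X ?M\<^esub> \<in> Units (\<O> X ?M)" by simp
      then obtain z where "z \<in> carrier (\<O> X ?M)" "z \<otimes>\<^bsub>\<O> X ?M\<^esub> \<zero>\<^bsub>\<O> X ?M\<^esub> = \<one>\<^bsub>\<O> X ?M\<^esub>"
        using Mr.Units_l_inv_ex by blast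
      then have M1: "\<one>\<^bsub>\<O> X ?M\<^esub> = \<zero>\<^bsub>\<O> X ?M\<^esub>" using Mr.r_null by metis
      obtain y where y: "y \<in> ?M" using M(4) by blast
      then have "y \<in> pts X" using openin_subset[OF M(1)] by auto
      then show False
        using domain.one_not_zero[OF dom] stalk_one[OF M(1) y] stalk_zero[OF M(1) y] M1 by metis
    qed
    ultimately have "germ X x A a = germ X x A \<zero>\<^bsub>\<O> X A\<^esub>" unfolding stalk_zero[OF oA A(1)] by simp
    then obtain N where N: "opn X N" "x \<in> N" "N \<subseteq> A" "res X A N a = res X A N \<zero>\<^bsub>\<O> X A\<^esub>"
      by (rule germ_eqD[OF _ oA A(1) O_zero_closed[OF oA]]) (rule that)
    let ?N = "N \<inter> D"
    have o: "opn X ?N" "?N \<subseteq> N" "?N \<subseteq> D" "x \<in> ?N" "?N \<subseteq> W" using N D DA by auto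
    interpret Nr: cring "\<O> X ?N" by (rule O_cring[OF o(1)])
    have uN: "res X D ?N (res X A D u) \<in> Units (\<O> X ?N)" by (rule Units_res[OF D(1) o(1,3) unit])
    have sN: "res X W ?N s \<in> carrier (\<O> X ?N)" by (rule res_closed[OF W o(1,5) s])
    have "res X D ?N (res X A D u) \<otimes>\<^bsub>\<O> X ?N\<^esub> res X W ?N s = res X A ?N a"
      using res_mult[OF D(1) o(1,3) uD sD] res_res[OF W D(1) o(1,3) DA(2) s]
        res_res[OF oA D(1) o(1,3) DA(1) ua'(2)] eq' by simp
    also have "\<dots> = \<zero>\<^bsub>\<O> X ?N\<^esub>"
      using res_res[OF oA N(1) o(1,2) N(3) ua'(2)] N(4) res_zero[OF oA N(1,3)] res_zero[OF N(1) o(1,2)] by simp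
    also have "\<dots> = res X D ?N (res X A D u) \<otimes>\<^bsub>\<O> X ?N\<^esub> \<zero>\<^bsub>\<O> X ?N\<^esub>"
      by (rule Nr.r_null[OF Nr.Units_closed[OF uN], symmetric])
    finally have "res X W ?N s = \<zero>\<^bsub>\<O> X ?N\<^esub>"
      using Nr.Units_l_cancel[OF uN sN] by simp
    then show "\<exists>N. opn X N \<and> x \<in> N \<and> N \<subseteq> W \<and> res X W N s = res X W N \<zero>\<^bsub>\<O> X W\<^esub>"
      using o res_zero[OF W o(1,5)] by (intro exI[of _ ?N]) simp
  qed
  show ?thesis
  proof (intro integral_ringed.intro integral_ringed_axioms.intro)
    show "ringed X" by (rule ringed_axioms)
    show "U \<inter> V \<noteq> {}" if "opn X U" "opn X V" "U \<noteq> {}" "V \<noteq> {}" for U V by (rule int[OF that])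
    show "s = t" if U: "opn X U" "opn X V" "V \<subseteq> U" "V \<noteq> {}" and st: "s \<in> carrier (\<O> X U)"
      "t \<in> carrier (\<O> X U)" "res X U V s = res X U V t" for U V s t
    proof -
      interpret Ur: cring "\<O> X U" by (rule O_cring[OF U(1)])
      interpret Vr: cring "\<O> X V" by (rule O_cring[OF U(2)])
      define d where "d = s \<ominus>\<^bsub>\<O> X U\<^esub> t"
      have d: "d \<in> carrier (\<O> X U)" "d \<oplus>\<^bsub>\<O> X U\<^esub> t = s"
        using st by (simp_all add: d_def Ur.minus_eq Ur.a_assoc Ur.l_neg)
      have "res X U V d \<oplus>\<^bsub>\<O> X V\<^esub> res X U V t = res X U V t"
        using res_add[OF U(1-3) d(1) st(2)] d(2) st(3) by simp
      then have "res X U V d = \<zero>\<^bsub>\<O> X V\<^esub>"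
        using res_closed[OF U(1-3) d(1)] res_closed[OF U(1-3) st(2)] by (simp add: Vr.add.r_cancel_one)
      then have "d = \<zero>\<^bsub>\<O> X U\<^esub>" by (rule zero[OF U(1-4) d(1)])
      then show ?thesis using d(2) st by simp
    qed
  qed
qed

section \<open>Noetherian neighbourhoods\<close>

text \<open>Over \<open>W\<close>, sections are locally quotients of sections defined on all of \<open>W\<close>, as on affine opens.\<close>

definition has_fractions :: "('x, 'r) ringed_space \<Rightarrow> 'x set \<Rightarrow> bool" where
  "has_fractions X W \<longleftrightarrow>
    (\<forall>V y t. opn X V \<longrightarrow> V \<subseteq> W \<longrightarrow> y \<in> V \<longrightarrow> t \<in> carrier (\<O> X V) \<longrightarrow>
      (\<exists>D u a. opn X D \<and> y \<in> D \<and> D \<subseteq> V \<and> u \<in> carrier (\<O> X W) \<and> a \<in> carrier (\<O> X W) \<and>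
        res X W D u \<in> Units (\<O> X D) \<and> res X W D u \<otimes>\<^bsub>\<O> X D\<^esub> res X V D t = res X W D a))"

text \<open>What is retained of the affine cover: the coherence arguments below take place over such
  a W, clear denominators into \<open>\<O> X W\<close> and use its noetherian property.\<close>

locale noetherian_ringed = integral_ringed X for X :: "('x, 'r) ringed_space" +
  assumes noetherian_nbhd:
    "x \<in> pts X \<Longrightarrow> \<exists>W. opn X W \<and> x \<in> W \<and> noetherian_ring (\<O> X W) \<and> has_fractions X W"

text \<open>The spectrum of a field is the single point {0}, so a section is one fraction a/f with f
  nonzero; its inverse is f/a unless a is zero.\<close>

lemma Spec_section_inverse:
  fixes R :: "'a ring" (structure)
  assumes R: "field R" and V: "zariski_open R V" "V \<noteq> {}" and s: "s \<in> carrier (\<O> (Spec R) V)"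
  shows "s = \<zero>\<^bsub>\<O> (Spec R) V\<^esub> \<or> (\<exists>t \<in> carrier (\<O> (Spec R) V). s \<otimes>\<^bsub>\<O> (Spec R) V\<^esub> t = \<one>\<^bsub>\<O> (Spec R) V\<^esub>)"
proof -
  interpret field R by (rule R)
  have "q = {\<zero>}" if "q \<in> spec_points R" for q
  proof -
    interpret q: primeideal q R using that by (simp add: spec_points_def)
    have "q \<in> {{\<zero>}, carrier R}" using all_ideals q.is_ideal by blast
    then show ?thesis using q.I_notcarr by auto
  qed
  then have V0: "V = {{\<zero>}}" using V zariski_open_subset[OF V(1)] by blast
  obtain W a f where W: "{\<zero>} \<in> W" "W \<subseteq> V" and af: "a \<in> carrier R" "f \<in> carrier R"
    and loc: "\<forall>q\<in>W. f \<notin> q \<and> s q = fraction R (carrier R - q) a f"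
    using spec_sections_local[OF s, of "{\<zero>}"] V0 by auto
  have f0: "f \<noteq> \<zero>" and s0: "s {\<zero>} = fraction R (carrier R - {\<zero>}) a f" using loc W by auto
  have "s \<in> extensional V" using s by (auto simp: Spec_def spec_sections_def PiE_iff)
  then have sf: "s = frac_section R V a f"
    using s0 V0 by (intro ext) (auto simp: frac_section_def extensional_def)
  show ?thesis
  proof (cases "a = \<zero>")
    case True
    have "s = frac_section R V \<zero> \<one>"
      unfolding sf True by (rule frac_section_eqI[OF V(1)]) (use af f0 V0 in auto)
    then show ?thesis using frac_section_zero[OF V(1)] by simp
  next
    case False
    have t: "frac_section R V f a \<in> carrier (\<O> (Spec R) V)"
      by (rule frac_section_closed[OF V(1)]) (use af False V0 in auto)
    have "s \<otimes>\<^bsub>\<O> (Spec R) V\<^esub> frac_section R V f a = frac_section R V (a \<otimes> f) (f \<otimes> a)"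
      unfolding sf by (rule frac_section_mult[OF V(1)]) (use af False f0 V0 in auto)
    also have "\<dots> = \<one>\<^bsub>\<O> (Spec R) V\<^esub>"
      unfolding frac_section_one[OF V(1)]
      by (rule frac_section_eqI[OF V(1)]) (use af False f0 V0 integral[of f a] in \<open>auto simp: m_comm\<close>)
    finally show ?thesis using t by blast
  qed
qed

text \<open>The ring of U is generated by finitely many elements over the image of the sections over
  an open part of the spectrum of k. In that image every nonzero element has an inverse, so
  Hilbert's basis theorem applies.\<close>

lemma (in ringed) noetherian_ring_of_finite_type:
  assumes k: "field k" and mor: "rs_morphism X (Spec k) \<pi>"
    and ft: "finite_type_morphism X (Spec k) \<pi>" and x: "x \<in> pts X"
  obtains U where "affine_open X U" "x \<in> U" "noetherian_ring (\<O> X U)"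
proof -
  obtain \<V> where \<V>: "\<forall>V\<in>\<V>. affine_open (Spec k) V" "\<Union>\<V> = pts (Spec k)"
    and fin: "\<forall>V\<in>\<V>. \<exists>\<U>. finite \<U> \<and> (\<forall>U\<in>\<U>. affine_open X U) \<and> \<Union>\<U> = preim X \<pi> V \<and>
          (\<forall>U\<in>\<U>. \<exists>G. finite G \<and> G \<subseteq> carrier (\<O> X U) \<and>
             carrier (\<O> X U) = generate_ring (\<O> X U)
               ((\<lambda>a. res X (preim X \<pi> V) U (comor \<pi> V a)) ` carrier (\<O> (Spec k) V) \<union> G))"
    using ft unfolding finite_type_morphism_def by (elim exE conjE) (rule that)
  have cont: "continuous_map (top_of X) (top_of (Spec k)) (base \<pi>)"
    using mor by (simp add: rs_morphism_def)
  then have "base \<pi> x \<in> pts (Spec k)" using x by (rule continuous_map_funspace[THEN funcset_mem])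
  then obtain V where V: "V \<in> \<V>" "base \<pi> x \<in> V" using \<V>(2) by auto
  then have Vaff: "affine_open (Spec k) V" using \<V>(1) by simp
  then have oV: "opn (Spec k) V" by (simp add: affine_open_def)
  \<comment> \<open>Sections over V form a ring because affine open sets are ringed spaces by
    definition.\<close>
  have ringV: "cring (\<O> (Spec k) V)"
    using Vaff oV unfolding affine_open_def is_affine_def is_ringed_space_def by auto
  let ?P = "preim X \<pi> V"
  have oP: "opn X ?P" unfolding preim_def by (rule openin_continuous_map_preimage[OF cont oV])
  obtain \<U> where \<U>: "\<forall>U\<in>\<U>. affine_open X U" "\<Union>\<U> = ?P"
    and gen: "\<forall>U\<in>\<U>. \<exists>G. finite G \<and> G \<subseteq> carrier (\<O> X U) \<and>
             carrier (\<O> X U) = generate_ring (\<O> X U)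
               ((\<lambda>a. res X ?P U (comor \<pi> V a)) ` carrier (\<O> (Spec k) V) \<union> G)"
    using fin[THEN bspec, OF V(1)] by (elim exE conjE) (rule that)
  have "x \<in> ?P" using x V(2) by (simp add: preim_def)
  then obtain U where U: "U \<in> \<U>" "x \<in> U" using \<U>(2) by auto
  then have Uaff: "affine_open X U" using \<U>(1) by simp
  then have oU: "opn X U" by (simp add: affine_open_def)
  have UP: "U \<subseteq> ?P" using U \<U>(2) by auto
  interpret OU: cring "\<O> X U" by (rule O_cring[OF oU])
  interpret OV: cring "\<O> (Spec k) V" by (rule ringV)
  let ?\<phi> = "\<lambda>a. res X ?P U (comor \<pi> V a)"
  have "comor \<pi> V \<in> ring_hom (\<O> (Spec k) V) (\<O> X ?P)" using mor oV unfolding rs_morphism_def by blast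
  from ring_hom_trans[OF this res_hom[OF oP oU UP]]
  have hom: "?\<phi> \<in> ring_hom (\<O> (Spec k) V) (\<O> X U)" by (simp add: comp_def)
  interpret \<phi>: ring_hom_ring "\<O> (Spec k) V" "\<O> X U" ?\<phi>
    by (rule ring_hom_ringI2[OF OV.ring_axioms OU.ring_axioms hom])
  let ?K = "?\<phi> ` carrier (\<O> (Spec k) V)"
  have K: "subring ?K (\<O> X U)" by (rule \<phi>.img_is_subring[OF OV.carrier_is_subring])
  have "noetherian_ring (\<O> X U\<lparr>carrier := ?K\<rparr>)"
  proof (rule OU.noetherian_ring_of_inverses[OF K])
    fix y assume "y \<in> ?K"
    then obtain s where s: "s \<in> carrier (\<O> (Spec k) V)" "y = ?\<phi> s" by blast
    have "V \<noteq> {}" using V(2) by auto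
    with Spec_section_inverse[OF k _ this s(1)] oV
    have "s = \<zero>\<^bsub>\<O> (Spec k) V\<^esub> \<or> (\<exists>t \<in> carrier (\<O> (Spec k) V). s \<otimes>\<^bsub>\<O> (Spec k) V\<^esub> t = \<one>\<^bsub>\<O> (Spec k) V\<^esub>)" by simp
    then show "y = \<zero>\<^bsub>\<O> X U\<^esub> \<or> (\<exists>z\<in>?K. y \<otimes>\<^bsub>\<O> X U\<^esub> z = \<one>\<^bsub>\<O> X U\<^esub>)"
    proof
      assume "s = \<zero>\<^bsub>\<O> (Spec k) V\<^esub>"
      then show ?thesis using \<phi>.hom_zero s(2) by simp
    next
      assume "\<exists>t \<in> carrier (\<O> (Spec k) V). s \<otimes>\<^bsub>\<O> (Spec k) V\<^esub> t = \<one>\<^bsub>\<O> (Spec k) V\<^esub>"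
      then obtain t where t: "t \<in> carrier (\<O> (Spec k) V)" "s \<otimes>\<^bsub>\<O> (Spec k) V\<^esub> t = \<one>\<^bsub>\<O> (Spec k) V\<^esub>" by blast
      have "y \<otimes>\<^bsub>\<O> X U\<^esub> ?\<phi> t = \<one>\<^bsub>\<O> X U\<^esub>"
        using \<phi>.hom_mult[OF s(1) t(1)] t(2) \<phi>.hom_one s(2) by simp
      then show ?thesis using t(1) by blast
    qed
  qed
  moreover obtain G where G: "finite G" "G \<subseteq> carrier (\<O> X U)"
    "carrier (\<O> X U) = generate_ring (\<O> X U) (?K \<union> G)"
    using gen[THEN bspec, OF U(1)] by (elim exE conjE) (rule that)
  ultimately have "noetherian_ring (\<O> X U\<lparr>carrier := generate_ring (\<O> X U) (?K \<union> G)\<rparr>)"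
    by (intro OU.noetherian_ring_generate[OF K])
  then have "noetherian_ring (\<O> X U)" unfolding G(3)[symmetric] by simp
  then show thesis by (rule that[OF Uaff U(2)])
qed

text \<open>Irreducibility together with the domains that normality supplies as stalks gives
  integrality; finite type over the field gives the noetherian rings.\<close>

lemma normal_surface_noetherian_ringed:
  assumes k: "field k" and X: "normal_surface k X \<pi>"
  shows "noetherian_ringed X"
proof -
  have sch: "is_scheme X" and irr: "irreducible_subset (top_of X) (pts X)"
    and nor: "normal_scheme X" and ft: "finite_type_morphism X (Spec k) \<pi>"
    and mor: "rs_morphism X (Spec k) \<pi>"
    using X by (simp_all add: normal_surface_def local_morphism_def)
  interpret ringed X by unfold_locales (use sch in \<open>simp add: is_scheme_def\<close>)
  have "integral_ringed X"
    by (rule integral_ringed_of_stalks[OF irr])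
       (use sch nor in \<open>auto simp: is_scheme_def normal_scheme_def integrally_closed_domain_def\<close>)
  then interpret integral_ringed X .
  show ?thesis
  proof
    fix x assume x: "x \<in> pts X"
    obtain W where W: "affine_open X W" "x \<in> W" "noetherian_ring (\<O> X W)"
      by (rule noetherian_ring_of_finite_type[OF k mor ft x]) (rule that)
    obtain \<Psi> where \<Psi>: "\<Psi> \<subseteq> carrier (\<O> X W)"
      and frac: "\<And>V y t. opn X V \<Longrightarrow> V \<subseteq> W \<Longrightarrow> y \<in> V \<Longrightarrow> t \<in> carrier (\<O> X V) \<Longrightarrow>
        \<exists>D u a. opn X D \<and> y \<in> D \<and> D \<subseteq> V \<and> u \<in> \<Psi> \<and> a \<in> \<Psi> \<and> res X W D u \<in> Units (\<O> X D) \<and>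
        res X W D u \<otimes>\<^bsub>\<O> X D\<^esub> res X V D t = res X W D a"
      by (rule affine_fractions[OF W(1)]) (rule that)
    have fr: "\<exists>D u a. opn X D \<and> y \<in> D \<and> D \<subseteq> V \<and> u \<in> carrier (\<O> X W) \<and> a \<in> carrier (\<O> X W) \<and>
        res X W D u \<in> Units (\<O> X D) \<and> res X W D u \<otimes>\<^bsub>\<O> X D\<^esub> res X V D t = res X W D a"
      if V: "opn X V" "V \<subseteq> W" "y \<in> V" "t \<in> carrier (\<O> X V)" for V y t
    proof -
      obtain D u a where "opn X D" "y \<in> D" "D \<subseteq> V" "u \<in> \<Psi>" "a \<in> \<Psi>" "res X W D u \<in> Units (\<O> X D)"
        "res X W D u \<otimes>\<^bsub>\<O> X D\<^esub> res X V D t = res X W D a"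
        using frac[OF V] by (elim exE conjE) (rule that)
      then show ?thesis using \<Psi> by (intro exI[of _ D] exI[of _ u] exI[of _ a]) auto
    qed
    show "\<exists>W. opn X W \<and> x \<in> W \<and> noetherian_ring (\<O> X W) \<and> has_fractions X W"
    proof (intro exI[of _ W] conjI)
      show "has_fractions X W"
        unfolding has_fractions_def by (intro allI impI) (rule fr)
    qed (use W in \<open>simp_all add: affine_open_def\<close>)
  qed
qed

section \<open>Homomorphisms, duals and biduals\<close>

lemma open_subspace_pts [simp]: "open_subspace X (pts X) = X"
  by (simp add: open_subspace_def)

lemma hom_ext_apply: "opn X U \<Longrightarrow> s \<in> carrier (sec F U) \<Longrightarrow> hom_ext X F h U s = h U s"
  by (simp add: hom_ext_def)

lemma hom_ext_apply_sub:
  "opn X U \<Longrightarrow> opn X V \<Longrightarrow> V \<subseteq> U \<Longrightarrow> s \<in> carrier (sec F V) \<Longrightarrow>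
    hom_ext (open_subspace X U) F h V s = h V s"
  by (simp add: hom_ext_def)

lemma hom_ext_idem: "hom_ext X F (hom_ext X F h) = hom_ext X F h"
  by (simp add: hom_ext_def fun_eq_iff)

lemma hom_ext_eqI:
  assumes "opn X U" "\<And>V s. opn X V \<Longrightarrow> V \<subseteq> U \<Longrightarrow> s \<in> carrier (sec F V) \<Longrightarrow> h V s = k V s"
  shows "hom_ext (open_subspace X U) F h = hom_ext (open_subspace X U) F k"
  using assms by (auto simp: hom_ext_def fun_eq_iff)

text \<open>Removes the subspace once and for all. For W inside V the demand that W also lie in U is
  absorbed by transitivity.\<close>

lemma sheaf_hom_open_iff:
  assumes "opn X U"
  shows "h \<in> sheaf_hom (open_subspace X U) F G \<longleftrightarrow> hom_ext (open_subspace X U) F h = h \<and>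
    (\<forall>V s. opn X V \<longrightarrow> V \<subseteq> U \<longrightarrow> s \<in> carrier (sec F V) \<longrightarrow> h V s \<in> carrier (sec G V)) \<and>
    (\<forall>V s t. opn X V \<longrightarrow> V \<subseteq> U \<longrightarrow> s \<in> carrier (sec F V) \<longrightarrow> t \<in> carrier (sec F V) \<longrightarrow>
       h V (s \<oplus>\<^bsub>sec F V\<^esub> t) = h V s \<oplus>\<^bsub>sec G V\<^esub> h V t) \<and>
    (\<forall>V a s. opn X V \<longrightarrow> V \<subseteq> U \<longrightarrow> a \<in> carrier (\<O> X V) \<longrightarrow> s \<in> carrier (sec F V) \<longrightarrow>
       h V (a \<odot>\<^bsub>sec F V\<^esub> s) = a \<odot>\<^bsub>sec G V\<^esub> h V s) \<and>
    (\<forall>V W s. opn X V \<longrightarrow> opn X W \<longrightarrow> V \<subseteq> U \<longrightarrow> W \<subseteq> V \<longrightarrow> s \<in> carrier (sec F V) \<longrightarrow>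
       h W (mres F V W s) = mres G V W (h V s))"
proof -
  have 1: "(\<forall>V. V \<subseteq> U \<longrightarrow> opn X V \<longrightarrow> h V \<in> carrier (sec F V) \<rightarrow> carrier (sec G V)) \<longleftrightarrow>
    (\<forall>V s. opn X V \<longrightarrow> V \<subseteq> U \<longrightarrow> s \<in> carrier (sec F V) \<longrightarrow> h V s \<in> carrier (sec G V))"
    by (auto simp: Pi_iff)
  have 2: "(\<forall>V W s. opn X V \<and> V \<subseteq> U \<longrightarrow> opn X W \<and> W \<subseteq> U \<longrightarrow> W \<subseteq> V \<longrightarrow> s \<in> carrier (sec F V) \<longrightarrow>
       h W (mres F V W s) = mres G V W (h V s)) \<longleftrightarrow>
    (\<forall>V W s. opn X V \<longrightarrow> opn X W \<longrightarrow> V \<subseteq> U \<longrightarrow> W \<subseteq> V \<longrightarrow> s \<in> carrier (sec F V) \<longrightarrow>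
       h W (mres F V W s) = mres G V W (h V s))"
    by (meson order_trans)
  show ?thesis
    unfolding sheaf_hom_def mem_Collect_eq openin_open_subspace[OF assms] open_subspace_simps 2
    using 1 by (intro conj_cong refl) (auto simp: Pi_iff)
qed

lemma sheaf_hom_open:
  assumes h: "h \<in> sheaf_hom (open_subspace X U) F G" and U: "opn X U" and V: "opn X V" "V \<subseteq> U"
  shows sheaf_hom_closed: "s \<in> carrier (sec F V) \<Longrightarrow> h V s \<in> carrier (sec G V)"
    and sheaf_hom_add: "s \<in> carrier (sec F V) \<Longrightarrow> t \<in> carrier (sec F V) \<Longrightarrow>
      h V (s \<oplus>\<^bsub>sec F V\<^esub> t) = h V s \<oplus>\<^bsub>sec G V\<^esub> h V t"
    and sheaf_hom_smult: "a \<in> carrier (\<O> X V) \<Longrightarrow> s \<in> carrier (sec F V) \<Longrightarrow>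
      h V (a \<odot>\<^bsub>sec F V\<^esub> s) = a \<odot>\<^bsub>sec G V\<^esub> h V s"
    and sheaf_hom_res: "opn X W \<Longrightarrow> W \<subseteq> V \<Longrightarrow> s \<in> carrier (sec F V) \<Longrightarrow>
      h W (mres F V W s) = mres G V W (h V s)"
  using h V unfolding sheaf_hom_open_iff[OF U] by simp_all

lemma sheaf_hom_ext_id: "h \<in> sheaf_hom X F G \<Longrightarrow> hom_ext X F h = h"
  by (simp add: sheaf_hom_def)

lemma sheaf_hom_eqI:
  assumes "opn X U" "h \<in> sheaf_hom (open_subspace X U) F G" "k \<in> sheaf_hom (open_subspace X U) F G'"
    "\<And>V s. opn X V \<Longrightarrow> V \<subseteq> U \<Longrightarrow> s \<in> carrier (sec F V) \<Longrightarrow> h V s = k V s"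
  shows "h = k"
proof -
  have "hom_ext (open_subspace X U) F h = hom_ext (open_subspace X U) F k"
    by (rule hom_ext_eqI[OF assms(1)]) (rule assms(4))
  then show ?thesis using assms(2,3) by (simp add: sheaf_hom_ext_id)
qed

text \<open>What \<open>sheaf_hom_hom_extI\<close> requires of the source: the normalization by
  \<open>hom_ext\<close> forces the arguments to stay inside the carriers. It passes to duals by
  direct computation, whereas the sheaf axiom for a dual would take gluing of homomorphisms.\<close>

definition module_closed :: "('x, 'r) ringed_space \<Rightarrow> ('x, 'r, 'm) mod_sheaf \<Rightarrow> bool" where
  "module_closed X F \<longleftrightarrow>
    (\<forall>U s t. opn X U \<longrightarrow> s \<in> carrier (sec F U) \<longrightarrow> t \<in> carrier (sec F U) \<longrightarrow>
      s \<oplus>\<^bsub>sec F U\<^esub> t \<in> carrier (sec F U)) \<and>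
    (\<forall>U a s. opn X U \<longrightarrow> a \<in> carrier (\<O> X U) \<longrightarrow> s \<in> carrier (sec F U) \<longrightarrow>
      a \<odot>\<^bsub>sec F U\<^esub> s \<in> carrier (sec F U)) \<and>
    (\<forall>U V s. opn X U \<longrightarrow> opn X V \<longrightarrow> V \<subseteq> U \<longrightarrow> s \<in> carrier (sec F U) \<longrightarrow>
      mres F U V s \<in> carrier (sec F V))"

lemma module_closedD:
  assumes "module_closed X F" "opn X U" "s \<in> carrier (sec F U)"
  shows "t \<in> carrier (sec F U) \<Longrightarrow> s \<oplus>\<^bsub>sec F U\<^esub> t \<in> carrier (sec F U)"
    and "a \<in> carrier (\<O> X U) \<Longrightarrow> a \<odot>\<^bsub>sec F U\<^esub> s \<in> carrier (sec F U)"
    and "opn X V \<Longrightarrow> V \<subseteq> U \<Longrightarrow> mres F U V s \<in> carrier (sec F V)"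
  using assms unfolding module_closed_def by simp_all

text \<open>Lets a homomorphism be given by any formula on the carriers: \<open>hom_ext\<close>
  normalizes it, and closure of F guarantees that the normalization does not disturb the
  laws.\<close>

lemma sheaf_hom_hom_extI:
  assumes U: "opn X U" and F: "module_closed X F"
    and closed: "\<And>V s. opn X V \<Longrightarrow> V \<subseteq> U \<Longrightarrow> s \<in> carrier (sec F V) \<Longrightarrow> h V s \<in> carrier (sec G V)"
    and add: "\<And>V s t. opn X V \<Longrightarrow> V \<subseteq> U \<Longrightarrow> s \<in> carrier (sec F V) \<Longrightarrow> t \<in> carrier (sec F V) \<Longrightarrow>
       h V (s \<oplus>\<^bsub>sec F V\<^esub> t) = h V s \<oplus>\<^bsub>sec G V\<^esub> h V t"
    and smult: "\<And>V a s. opn X V \<Longrightarrow> V \<subseteq> U \<Longrightarrow> a \<in> carrier (\<O> X V) \<Longrightarrow> s \<in> carrier (sec F V) \<Longrightarrow>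
       h V (a \<odot>\<^bsub>sec F V\<^esub> s) = a \<odot>\<^bsub>sec G V\<^esub> h V s"
    and res: "\<And>V W s. opn X V \<Longrightarrow> opn X W \<Longrightarrow> V \<subseteq> U \<Longrightarrow> W \<subseteq> V \<Longrightarrow> s \<in> carrier (sec F V) \<Longrightarrow>
       h W (mres F V W s) = mres G V W (h V s)"
  shows "hom_ext (open_subspace X U) F h \<in> sheaf_hom (open_subspace X U) F G"
proof -
  have [simp]: "hom_ext (open_subspace X U) F h V s = h V s" if "opn X V" "V \<subseteq> U" "s \<in> carrier (sec F V)" for V s
    by (rule hom_ext_apply_sub[OF U that])
  show ?thesis
    unfolding sheaf_hom_open_iff[OF U]
    using F closed add smult res unfolding module_closed_def
    by (auto simp: hom_ext_idem dest: subset_trans)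
qed

lemma structure_module_simps [simp]:
  "carrier (sec (structure_module X) U) = carrier (\<O> X U)"
  "a \<oplus>\<^bsub>sec (structure_module X) U\<^esub> b = a \<oplus>\<^bsub>\<O> X U\<^esub> b"
  "a \<odot>\<^bsub>sec (structure_module X) U\<^esub> b = a \<otimes>\<^bsub>\<O> X U\<^esub> b"
  "mres (structure_module X) = res X"
  by (simp_all add: structure_module_def)

lemma dual_simps [simp]:
  "carrier (sec (dual X F) U) = sheaf_hom (open_subspace X U) F (structure_module X)"
  "g \<oplus>\<^bsub>sec (dual X F) U\<^esub> h = hom_ext (open_subspace X U) F (\<lambda>V s. g V s \<oplus>\<^bsub>\<O> X V\<^esub> h V s)"
  "a \<odot>\<^bsub>sec (dual X F) U\<^esub> h = hom_ext (open_subspace X U) F (\<lambda>V s. res X U V a \<otimes>\<^bsub>\<O> X V\<^esub> h V s)"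
  "mres (dual X F) U V h = hom_ext (open_subspace X V) F h"
  by (simp_all add: dual_def)

lemmas dual_closed = sheaf_hom_closed[where G="structure_module _", unfolded structure_module_simps]
lemmas dual_add = sheaf_hom_add[where G="structure_module _", unfolded structure_module_simps]
lemmas dual_smult = sheaf_hom_smult[where G="structure_module _", unfolded structure_module_simps]
lemmas dual_res = sheaf_hom_res[where G="structure_module _", unfolded structure_module_simps]

context ringed
begin

lemma module_closed_dual:
  assumes F: "module_closed X F"
  shows "module_closed X (dual X F)"
  unfolding module_closed_def
proof (intro conjI allI impI)
  fix U g h assume U: "opn X U" and g: "g \<in> carrier (sec (dual X F) U)" and h: "h \<in> carrier (sec (dual X F) U)"
  show "g \<oplus>\<^bsub>sec (dual X F) U\<^esub> h \<in> carrier (sec (dual X F) U)"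
    unfolding dual_simps
  proof (rule sheaf_hom_hom_extI[OF U F])
    fix V s assume V: "opn X V" "V \<subseteq> U" and s: "s \<in> carrier (sec F V)"
    interpret V: cring "\<O> X V" by (rule O_cring[OF V(1)])
    note gh = dual_closed[OF g[unfolded dual_simps] U V] dual_closed[OF h[unfolded dual_simps] U V]
    show "g V s \<oplus>\<^bsub>\<O> X V\<^esub> h V s \<in> carrier (sec (structure_module X) V)" using gh s by simp
    show "g V (s \<oplus>\<^bsub>sec F V\<^esub> t) \<oplus>\<^bsub>\<O> X V\<^esub> h V (s \<oplus>\<^bsub>sec F V\<^esub> t) =
       g V s \<oplus>\<^bsub>\<O> X V\<^esub> h V s \<oplus>\<^bsub>sec (structure_module X) V\<^esub> (g V t \<oplus>\<^bsub>\<O> X V\<^esub> h V t)"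
      if t: "t \<in> carrier (sec F V)" for t
      using gh s t dual_add[OF g[unfolded dual_simps] U V s t] dual_add[OF h[unfolded dual_simps] U V s t]
      by (simp add: V.a_ac)
    show "g V (a \<odot>\<^bsub>sec F V\<^esub> s) \<oplus>\<^bsub>\<O> X V\<^esub> h V (a \<odot>\<^bsub>sec F V\<^esub> s) =
       a \<odot>\<^bsub>sec (structure_module X) V\<^esub> (g V s \<oplus>\<^bsub>\<O> X V\<^esub> h V s)" if a: "a \<in> carrier (\<O> X V)" for a
      using gh s a dual_smult[OF g[unfolded dual_simps] U V a s] dual_smult[OF h[unfolded dual_simps] U V a s]
      by (simp add: V.r_distr)
    show "g W (mres F V W s) \<oplus>\<^bsub>\<O> X W\<^esub> h W (mres F V W s) =
       mres (structure_module X) V W (g V s \<oplus>\<^bsub>\<O> X V\<^esub> h V s)" if W: "opn X W" "W \<subseteq> V" for W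
      using gh s dual_res[OF g[unfolded dual_simps] U V W s] dual_res[OF h[unfolded dual_simps] U V W s]
        res_add[OF V(1) W] by simp
  qed
next
  fix U a h assume U: "opn X U" and a: "a \<in> carrier (\<O> X U)" and h: "h \<in> carrier (sec (dual X F) U)"
  show "a \<odot>\<^bsub>sec (dual X F) U\<^esub> h \<in> carrier (sec (dual X F) U)"
    unfolding dual_simps
  proof (rule sheaf_hom_hom_extI[OF U F])
    fix V s assume V: "opn X V" "V \<subseteq> U" and s: "s \<in> carrier (sec F V)"
    interpret V: cring "\<O> X V" by (rule O_cring[OF V(1)])
    note gh = dual_closed[OF h[unfolded dual_simps] U V] res_closed[OF U V a]
    show "res X U V a \<otimes>\<^bsub>\<O> X V\<^esub> h V s \<in> carrier (sec (structure_module X) V)" using gh s by simp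
    show "res X U V a \<otimes>\<^bsub>\<O> X V\<^esub> h V (s \<oplus>\<^bsub>sec F V\<^esub> t) =
       res X U V a \<otimes>\<^bsub>\<O> X V\<^esub> h V s \<oplus>\<^bsub>sec (structure_module X) V\<^esub> (res X U V a \<otimes>\<^bsub>\<O> X V\<^esub> h V t)"
      if t: "t \<in> carrier (sec F V)" for t
      using gh s t dual_add[OF h[unfolded dual_simps] U V s t] by (simp add: V.r_distr)
    show "res X U V a \<otimes>\<^bsub>\<O> X V\<^esub> h V (b \<odot>\<^bsub>sec F V\<^esub> s) =
       b \<odot>\<^bsub>sec (structure_module X) V\<^esub> (res X U V a \<otimes>\<^bsub>\<O> X V\<^esub> h V s)" if b: "b \<in> carrier (\<O> X V)" for b
      using gh s b dual_smult[OF h[unfolded dual_simps] U V b s] by (simp add: V.m_lcomm)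
    show "res X U W a \<otimes>\<^bsub>\<O> X W\<^esub> h W (mres F V W s) =
       mres (structure_module X) V W (res X U V a \<otimes>\<^bsub>\<O> X V\<^esub> h V s)" if W: "opn X W" "W \<subseteq> V" for W
      using gh s dual_res[OF h[unfolded dual_simps] U V W s] res_mult[OF V(1) W]
        res_res[OF U V(1) W V(2) a] by simp
  qed
next
  fix U V h assume U: "opn X U" and V: "opn X V" "V \<subseteq> U" and h: "h \<in> carrier (sec (dual X F) U)"
  note h = h[unfolded dual_simps]
  show "mres (dual X F) U V h \<in> carrier (sec (dual X F) V)"
    unfolding dual_simps
  proof (rule sheaf_hom_hom_extI[OF V(1) F])
    fix W s assume W: "opn X W" "W \<subseteq> V" and s: "s \<in> carrier (sec F W)"
    then have WU: "W \<subseteq> U" using V by auto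
    show "h W s \<in> carrier (sec (structure_module X) W)" using dual_closed[OF h U W(1) WU s] by simp
    show "h W (s \<oplus>\<^bsub>sec F W\<^esub> t) = h W s \<oplus>\<^bsub>sec (structure_module X) W\<^esub> h W t" if "t \<in> carrier (sec F W)" for t
      using dual_add[OF h U W(1) WU s that] by simp
    show "h W (b \<odot>\<^bsub>sec F W\<^esub> s) = b \<odot>\<^bsub>sec (structure_module X) W\<^esub> h W s" if "b \<in> carrier (\<O> X W)" for b
      using dual_smult[OF h U W(1) WU that s] by simp
    show "h W' (mres F W W' s) = mres (structure_module X) W W' (h W s)" if "opn X W'" "W' \<subseteq> W" for W'
      using dual_res[OF h U W(1) WU that s] by simp
  qed
qed

lemma to_bidual_apply:
  assumes "opn X U" "s \<in> carrier (sec F U)" "opn X V" "V \<subseteq> U" "h \<in> carrier (sec (dual X F) V)"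
  shows "to_bidual X F U s V h = h V (mres F U V s)"
  unfolding to_bidual_def hom_ext_apply[OF assms(1,2)] by (rule hom_ext_apply_sub[OF assms(1,3,4,5)])

end

locale sheaf_module = ringed X for X :: "('x, 'r) ringed_space" +
  fixes F :: "('x, 'r, 'm) mod_sheaf"
  assumes sheaf_of_modules: "sheaf_of_modules X F"
begin

lemma sec_module: "opn X U \<Longrightarrow> module (\<O> X U) (sec F U)"
  using sheaf_of_modules by (simp add: sheaf_of_modules_def)

lemma sec_sheaf: "is_sheaf (top_of X) (\<lambda>U. carrier (sec F U)) (mres F)"
  using sheaf_of_modules by (simp add: sheaf_of_modules_def)

lemmas mres_id = sheaf_restrict_id[OF sec_sheaf]
lemmas mres_mres = sheaf_restrict_restrict[OF sec_sheaf]
lemmas mres_closed = sheaf_restrict_closed[OF sec_sheaf]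
lemmas sec_locality = sheaf_locality[OF sec_sheaf]
lemmas sec_empty = sheaf_empty_unique[OF sec_sheaf]

lemma mres_add:
  "opn X U \<Longrightarrow> opn X V \<Longrightarrow> V \<subseteq> U \<Longrightarrow> s \<in> carrier (sec F U) \<Longrightarrow> t \<in> carrier (sec F U) \<Longrightarrow>
    mres F U V (s \<oplus>\<^bsub>sec F U\<^esub> t) = mres F U V s \<oplus>\<^bsub>sec F V\<^esub> mres F U V t"
  using sheaf_of_modules by (simp add: sheaf_of_modules_def)

lemma mres_smult:
  "opn X U \<Longrightarrow> opn X V \<Longrightarrow> V \<subseteq> U \<Longrightarrow> a \<in> carrier (\<O> X U) \<Longrightarrow> s \<in> carrier (sec F U) \<Longrightarrow>
    mres F U V (a \<odot>\<^bsub>sec F U\<^esub> s) = res X U V a \<odot>\<^bsub>sec F V\<^esub> mres F U V s"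
  using sheaf_of_modules by (simp add: sheaf_of_modules_def)

lemma sec_smult_closed:
  "opn X U \<Longrightarrow> a \<in> carrier (\<O> X U) \<Longrightarrow> s \<in> carrier (sec F U) \<Longrightarrow> a \<odot>\<^bsub>sec F U\<^esub> s \<in> carrier (sec F U)"
  by (rule module.smult_closed[OF sec_module])

lemma sec_add_closed:
  "opn X U \<Longrightarrow> s \<in> carrier (sec F U) \<Longrightarrow> t \<in> carrier (sec F U) \<Longrightarrow> s \<oplus>\<^bsub>sec F U\<^esub> t \<in> carrier (sec F U)"
  by (rule abelian_monoid.a_closed[OF abelian_group.axioms(1)[OF module.axioms(2)[OF sec_module]]])

lemma sec_abelian_monoid: "opn X U \<Longrightarrow> abelian_monoid (sec F U)"
  by (rule abelian_group.axioms(1)[OF module.axioms(2)[OF sec_module]])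

lemma sec_zero_closed: "opn X U \<Longrightarrow> \<zero>\<^bsub>sec F U\<^esub> \<in> carrier (sec F U)"
  by (rule abelian_monoid.zero_closed[OF sec_abelian_monoid])

lemma mres_zero: "opn X U \<Longrightarrow> opn X V \<Longrightarrow> V \<subseteq> U \<Longrightarrow> mres F U V \<zero>\<^bsub>sec F U\<^esub> = \<zero>\<^bsub>sec F V\<^esub>"
proof -
  assume U: "opn X U" and V: "opn X V" "V \<subseteq> U"
  interpret MU: module "\<O> X U" "sec F U" by (rule sec_module[OF U])
  interpret MV: module "\<O> X V" "sec F V" by (rule sec_module[OF V(1)])
  have "mres F U V (\<zero>\<^bsub>\<O> X U\<^esub> \<odot>\<^bsub>sec F U\<^esub> \<zero>\<^bsub>sec F U\<^esub>) = \<zero>\<^bsub>sec F V\<^esub>"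
    using mres_smult[OF U V O_zero_closed[OF U] sec_zero_closed[OF U]] res_zero[OF U V]
      mres_closed[OF U V sec_zero_closed[OF U]] by simp
  then show ?thesis using MU.smult_l_null[OF sec_zero_closed[OF U]] by simp
qed

lemma module_closed: "module_closed X F"
  unfolding module_closed_def using sec_add_closed sec_smult_closed mres_closed by blast

lemma to_bidual_closed:
  assumes U: "opn X U" and s: "s \<in> carrier (sec F U)"
  shows "to_bidual X F U s \<in> carrier (sec (dual X (dual X F)) U)"
  unfolding to_bidual_def hom_ext_apply[OF U s] dual_simps(1)[of X "dual X F"]
proof (rule sheaf_hom_hom_extI[OF U module_closed_dual[OF module_closed]])
  fix V h assume V: "opn X V" "V \<subseteq> U" and h: "h \<in> carrier (sec (dual X F) V)"
  note h' = h[unfolded dual_simps]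
  have sV: "mres F U V s \<in> carrier (sec F V)" by (rule mres_closed[OF U V s])
  note hc = dual_closed[OF h' V(1) V(1) order_refl sV]
  show "h V (mres F U V s) \<in> carrier (sec (structure_module X) V)" using hc by simp
  show "(h \<oplus>\<^bsub>sec (dual X F) V\<^esub> k) V (mres F U V s) =
      h V (mres F U V s) \<oplus>\<^bsub>sec (structure_module X) V\<^esub> k V (mres F U V s)"
    if "k \<in> carrier (sec (dual X F) V)" for k
    using hom_ext_apply_sub[OF V(1) V(1) order_refl sV] by simp
  show "(a \<odot>\<^bsub>sec (dual X F) V\<^esub> h) V (mres F U V s) =
      a \<odot>\<^bsub>sec (structure_module X) V\<^esub> h V (mres F U V s)"
    if "a \<in> carrier (\<O> X V)" for a
    unfolding dual_simps(3) hom_ext_apply_sub[OF V(1) V(1) order_refl sV] res_id[OF V(1) that] by simp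
  show "(mres (dual X F) V W h) W (mres F U W s) = mres (structure_module X) V W (h V (mres F U V s))"
    if W: "opn X W" "W \<subseteq> V" for W
  proof -
    have sW: "mres F U W s \<in> carrier (sec F W)" by (rule mres_closed[OF U W(1) _ s]) (use W V in auto)
    have "mres F V W (mres F U V s) = mres F U W s" by (rule mres_mres[OF U V(1) W V(2) s])
    then show ?thesis
      unfolding dual_simps(4) hom_ext_apply_sub[OF W(1) W(1) order_refl sW]
      using dual_res[OF h' V(1) V(1) order_refl W sV] by simp
  qed
qed

lemma bidual_eqI:
  assumes "opn X U" "\<phi> \<in> carrier (sec (dual X (dual X F)) U)" "\<phi>' \<in> carrier (sec (dual X (dual X F)) U)"
    "\<And>V h. opn X V \<Longrightarrow> V \<subseteq> U \<Longrightarrow> h \<in> carrier (sec (dual X F) V) \<Longrightarrow> \<phi> V h = \<phi>' V h"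
  shows "\<phi> = \<phi>'"
  by (rule sheaf_hom_eqI[OF assms(1) assms(2)[unfolded dual_simps(1)[of X "dual X F"]]
    assms(3)[unfolded dual_simps(1)[of X "dual X F"]] assms(4)])

text \<open>Both sides of each law are elements of the bidual, hence determined by their values on
  functionals h, and on h the law becomes the same law for h itself.\<close>

lemma to_bidual_hom: "to_bidual X F \<in> sheaf_hom X F (dual X (dual X F))"
proof -
  have ext: "hom_ext X F (to_bidual X F) = to_bidual X F"
    by (simp add: to_bidual_def hom_ext_idem)
  note cl = module_closedD[OF module_closed_dual[OF module_closed_dual[OF module_closed]]]
  have "hom_ext (open_subspace X (pts X)) F (to_bidual X F)
      \<in> sheaf_hom (open_subspace X (pts X)) F (dual X (dual X F))"
  proof (rule sheaf_hom_hom_extI[OF opn_pts module_closed to_bidual_closed])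
    fix V s assume V: "opn X V" and s: "s \<in> carrier (sec F V)"
    have mc: "mres F V W s \<in> carrier (sec F W)" if "opn X W" "W \<subseteq> V" for W by (rule mres_closed[OF V that s])
    show "to_bidual X F V (s \<oplus>\<^bsub>sec F V\<^esub> t) =
        to_bidual X F V s \<oplus>\<^bsub>sec (dual X (dual X F)) V\<^esub> to_bidual X F V t" if t: "t \<in> carrier (sec F V)" for t
    proof (rule bidual_eqI[OF V to_bidual_closed[OF V sec_add_closed[OF V s t]]])
      show "to_bidual X F V s \<oplus>\<^bsub>sec (dual X (dual X F)) V\<^esub> to_bidual X F V t
          \<in> carrier (sec (dual X (dual X F)) V)"
        by (rule cl(1)[OF V to_bidual_closed[OF V s] to_bidual_closed[OF V t]])
      fix W h assume W: "opn X W" "W \<subseteq> V" and h: "h \<in> carrier (sec (dual X F) W)"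
      show "to_bidual X F V (s \<oplus>\<^bsub>sec F V\<^esub> t) W h =
          (to_bidual X F V s \<oplus>\<^bsub>sec (dual X (dual X F)) V\<^esub> to_bidual X F V t) W h"
        unfolding dual_simps(2)[of X "dual X F"] hom_ext_apply_sub[OF V W h]
          to_bidual_apply[OF V s W h] to_bidual_apply[OF V t W h] to_bidual_apply[OF V sec_add_closed[OF V s t] W h]
          mres_add[OF V W s t]
        by (rule dual_add[OF h[unfolded dual_simps] W(1) W(1) order_refl mc[OF W] mres_closed[OF V W t]])
    qed
    show "to_bidual X F V (a \<odot>\<^bsub>sec F V\<^esub> s) = a \<odot>\<^bsub>sec (dual X (dual X F)) V\<^esub> to_bidual X F V s"
      if a: "a \<in> carrier (\<O> X V)" for a
    proof (rule bidual_eqI[OF V to_bidual_closed[OF V sec_smult_closed[OF V a s]]])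
      show "a \<odot>\<^bsub>sec (dual X (dual X F)) V\<^esub> to_bidual X F V s \<in> carrier (sec (dual X (dual X F)) V)"
        by (rule cl(2)[OF V to_bidual_closed[OF V s] a])
      fix W h assume W: "opn X W" "W \<subseteq> V" and h: "h \<in> carrier (sec (dual X F) W)"
      show "to_bidual X F V (a \<odot>\<^bsub>sec F V\<^esub> s) W h = (a \<odot>\<^bsub>sec (dual X (dual X F)) V\<^esub> to_bidual X F V s) W h"
        unfolding dual_simps(3)[of X "dual X F"] hom_ext_apply_sub[OF V W h]
          to_bidual_apply[OF V s W h] to_bidual_apply[OF V sec_smult_closed[OF V a s] W h] mres_smult[OF V W a s]
        by (rule dual_smult[OF h[unfolded dual_simps] W(1) W(1) order_refl res_closed[OF V W a] mc[OF W]])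
    qed
    show "to_bidual X F W (mres F V W s) = mres (dual X (dual X F)) V W (to_bidual X F V s)"
      if W: "opn X W" "W \<subseteq> V" for W
    proof (rule bidual_eqI[OF W(1) to_bidual_closed[OF W(1) mc[OF W]]])
      show "mres (dual X (dual X F)) V W (to_bidual X F V s) \<in> carrier (sec (dual X (dual X F)) W)"
        by (rule cl(3)[OF V to_bidual_closed[OF V s] W])
      fix W' h assume W': "opn X W'" "W' \<subseteq> W" and h: "h \<in> carrier (sec (dual X F) W')"
      have W'V: "W' \<subseteq> V" using W W' by auto
      show "to_bidual X F W (mres F V W s) W' h = mres (dual X (dual X F)) V W (to_bidual X F V s) W' h"
        unfolding dual_simps(4)[of X "dual X F"] hom_ext_apply_sub[OF W(1) W' h]
          to_bidual_apply[OF V s W'(1) W'V h] to_bidual_apply[OF W(1) mc[OF W] W' h]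
          mres_mres[OF V W(1) W' W(2) s] ..
    qed
  qed
  then show ?thesis using ext by simp
qed

end

section \<open>Ideal sheaves\<close>

text \<open>Serves for restriction maps, for the coordinates of tuples and for undoing \<epsilon>,
  all of them additive maps between records of different kinds.\<close>

lemma finsum_hom_lessThan:
  assumes M: "abelian_monoid M" and N: "abelian_monoid N" and zero: "\<phi> \<zero>\<^bsub>M\<^esub> = \<zero>\<^bsub>N\<^esub>"
    and closed: "\<And>x. x \<in> carrier M \<Longrightarrow> \<phi> x \<in> carrier N"
    and add: "\<And>x y. x \<in> carrier M \<Longrightarrow> y \<in> carrier M \<Longrightarrow> \<phi> (x \<oplus>\<^bsub>M\<^esub> y) = \<phi> x \<oplus>\<^bsub>N\<^esub> \<phi> y"
    and h: "h \<in> {..<k::nat} \<rightarrow> carrier M"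
  shows "\<phi> (\<Oplus>\<^bsub>M\<^esub>i\<in>{..<k}. h i) = (\<Oplus>\<^bsub>N\<^esub>i\<in>{..<k}. \<phi> (h i))"
  using h
proof (induction k)
  case 0
  interpret M: abelian_monoid M by (rule M)
  interpret N: abelian_monoid N by (rule N)
  show ?case by (simp add: zero)
next
  case (Suc k)
  interpret M: abelian_monoid M by (rule M)
  interpret N: abelian_monoid N by (rule N)
  have h: "h k \<in> carrier M" "h \<in> {..<k} \<rightarrow> carrier M" using Suc.prems by (auto simp: Pi_iff)
  have "\<phi> (\<Oplus>\<^bsub>M\<^esub>i\<in>{..<Suc k}. h i) = \<phi> (h k \<oplus>\<^bsub>M\<^esub> (\<Oplus>\<^bsub>M\<^esub>i\<in>{..<k}. h i))"
    unfolding lessThan_Suc by (subst M.finsum_insert) (use h in auto)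
  also have "\<dots> = \<phi> (h k) \<oplus>\<^bsub>N\<^esub> (\<Oplus>\<^bsub>N\<^esub>i\<in>{..<k}. \<phi> (h i))"
    using add[OF h(1) M.finsum_closed[OF h(2)]] Suc.IH[OF h(2)] by simp
  also have "\<dots> = (\<Oplus>\<^bsub>N\<^esub>i\<in>{..<Suc k}. \<phi> (h i))"
    unfolding lessThan_Suc by (subst N.finsum_insert) (use h closed in \<open>auto simp: Pi_iff\<close>)
  finally show ?case .
qed

context ringed
begin

lemma O_abelian_monoid: "opn X U \<Longrightarrow> abelian_monoid (\<O> X U)"
  by (rule abelian_group.axioms(1)[OF ring.is_abelian_group[OF cring.axioms(1)[OF O_cring]]])

lemma res_finsum:
  assumes "opn X U" "opn X V" "V \<subseteq> U" "h \<in> {..<k::nat} \<rightarrow> carrier (\<O> X U)"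
  shows "res X U V (\<Oplus>\<^bsub>\<O> X U\<^esub>i\<in>{..<k}. h i) = (\<Oplus>\<^bsub>\<O> X V\<^esub>i\<in>{..<k}. res X U V (h i))"
  by (rule finsum_hom_lessThan[OF O_abelian_monoid[OF assms(1)] O_abelian_monoid[OF assms(2)]
        res_zero[OF assms(1-3)] res_closed[OF assms(1-3)] res_add[OF assms(1-3)] assms(4)])

text \<open>At each step of the induction the neighbourhood of y shrinks and the new denominator is
  multiplied to the old one. Denominator and numerators are functions on all of W, so that ideals
  and modules over \<open>\<O> X W\<close> can receive them.\<close>

lemma common_denominator:
  assumes W: "opn X W" "has_fractions X W" and V: "opn X V" "V \<subseteq> W" "y \<in> V"
    and \<tau>: "\<tau> \<in> {..<n::nat} \<rightarrow> carrier (\<O> X V)"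
  shows "\<exists>D u a. opn X D \<and> y \<in> D \<and> D \<subseteq> V \<and> u \<in> carrier (\<O> X W) \<and> a \<in> {..<n} \<rightarrow> carrier (\<O> X W) \<and>
        res X W D u \<in> Units (\<O> X D) \<and>
        (\<forall>i<n. res X W D u \<otimes>\<^bsub>\<O> X D\<^esub> res X V D (\<tau> i) = res X W D (a i))"
  using \<tau>
proof (induction n)
  case 0
  interpret V: cring "\<O> X V" by (rule O_cring[OF V(1)])
  show ?case
    by (intro exI[of _ V] exI[of _ "\<one>\<^bsub>\<O> X W\<^esub>"])
       (use V O_one_closed[OF W(1)] res_one[OF W(1) V(1,2)] in auto)
next
  case (Suc n)
  then have "\<tau> \<in> {..<n} \<rightarrow> carrier (\<O> X V)" and \<tau>n: "\<tau> n \<in> carrier (\<O> X V)" by (auto simp: Pi_iff)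
  from Suc.IH[OF this(1)] obtain D u a where D: "opn X D" "y \<in> D" "D \<subseteq> V" and u: "u \<in> carrier (\<O> X W)"
    and a: "a \<in> {..<n} \<rightarrow> carrier (\<O> X W)" and un: "res X W D u \<in> Units (\<O> X D)"
    and eq: "\<forall>i<n. res X W D u \<otimes>\<^bsub>\<O> X D\<^esub> res X V D (\<tau> i) = res X W D (a i)" by (elim exE conjE) (rule that)
  have DW: "D \<subseteq> W" using D V by auto
  have \<tau>D: "res X V D (\<tau> n) \<in> carrier (\<O> X D)" by (rule res_closed[OF V(1) D(1,3) \<tau>n])
  obtain E v b where E: "opn X E" "y \<in> E" "E \<subseteq> D" and v: "v \<in> carrier (\<O> X W)" "b \<in> carrier (\<O> X W)"
    and vn: "res X W E v \<in> Units (\<O> X E)"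
    and eqn: "res X W E v \<otimes>\<^bsub>\<O> X E\<^esub> res X D E (res X V D (\<tau> n)) = res X W E b"
    using W(2)[unfolded has_fractions_def, rule_format, OF D(1) DW D(2) \<tau>D] by (elim exE conjE) (rule that)
  have EW: "E \<subseteq> W" "E \<subseteq> V" using E D DW by auto
  interpret W: cring "\<O> X W" by (rule O_cring[OF W(1)])
  interpret E: cring "\<O> X E" by (rule O_cring[OF E(1)])
  note rW = res_closed[OF W(1) E(1) EW(1)]
  \<comment> \<open>The old denominator u clears the first n sections and v clears the last one;
    accordingly the old numerators pick up v and the new numerator b picks up u.\<close>
  let ?u = "u \<otimes>\<^bsub>\<O> X W\<^esub> v"
  let ?a = "\<lambda>i. if i < n then v \<otimes>\<^bsub>\<O> X W\<^esub> a i else u \<otimes>\<^bsub>\<O> X W\<^esub> b"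
  have "res X W E u \<in> Units (\<O> X E)"
    using Units_res[OF D(1) E(1,3) un] unfolding res_res[OF W(1) D(1) E(1,3) DW u] .
  then have unit: "res X W E ?u \<in> Units (\<O> X E)"
    using vn res_mult[OF W(1) E(1) EW(1) u v(1)] by simp
  have "res X W E ?u \<otimes>\<^bsub>\<O> X E\<^esub> res X V E (\<tau> i) = res X W E (?a i)" if i: "i < Suc n" for i
  proof -
    have \<tau>i: "\<tau> i \<in> carrier (\<O> X V)" using Suc.prems i by (auto simp: Pi_iff)
    note \<tau>E = res_closed[OF V(1) E(1) EW(2) \<tau>i]
    show ?thesis
    proof (cases "i < n")
      case True
      then have ai: "a i \<in> carrier (\<O> X W)" using a by auto
      have "res X D E (res X W D u \<otimes>\<^bsub>\<O> X D\<^esub> res X V D (\<tau> i)) = res X D E (res X W D (a i))"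
        using eq True by simp
      then have "res X W E u \<otimes>\<^bsub>\<O> X E\<^esub> res X V E (\<tau> i) = res X W E (a i)"
        unfolding res_mult[OF D(1) E(1,3) res_closed[OF W(1) D(1) DW u] res_closed[OF V(1) D(1,3) \<tau>i]]
          res_res[OF W(1) D(1) E(1,3) DW u] res_res[OF W(1) D(1) E(1,3) DW ai]
          res_res[OF V(1) D(1) E(1,3) D(3) \<tau>i] .
      then have "res X W E ?u \<otimes>\<^bsub>\<O> X E\<^esub> res X V E (\<tau> i) = res X W E v \<otimes>\<^bsub>\<O> X E\<^esub> res X W E (a i)"
        using rW[OF u] rW[OF v(1)] \<tau>E res_mult[OF W(1) E(1) EW(1) u v(1)] by (metis E.m_assoc E.m_comm)
      then show ?thesis using True res_mult[OF W(1) E(1) EW(1) v(1) ai] by simp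
    next
      case False
      then have i: "i = n" using i by simp
      have "res X W E ?u \<otimes>\<^bsub>\<O> X E\<^esub> res X V E (\<tau> n) = res X W E u \<otimes>\<^bsub>\<O> X E\<^esub> res X W E b"
        using eqn rW[OF u] rW[OF v(1)] \<tau>E[unfolded i] res_mult[OF W(1) E(1) EW(1) u v(1)]
        unfolding res_res[OF V(1) D(1) E(1,3) D(3) \<tau>n] by (metis E.m_assoc)
      then show ?thesis using i res_mult[OF W(1) E(1) EW(1) u v(2)] by simp
    qed
  qed
  then show ?case
    using unit E EW u v a
    by (intro exI[of _ E] exI[of _ ?u] exI[of _ ?a]) (auto simp: Pi_iff)
qed

end

text \<open>A copy of the ideals J U in another type, with the operations of \<open>\<O>\<close>
  read through \<epsilon>. The objects of \<open>Ref X\<close> have sections of a fixed type, so the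
  structure sheaf and its ideals become objects only as such copies.\<close>

definition ideal_module ::
    "('x, 'r) ringed_space \<Rightarrow> ('r \<Rightarrow> 'm) \<Rightarrow> ('x set \<Rightarrow> 'r set) \<Rightarrow> ('x, 'r, 'm) mod_sheaf" where
  "ideal_module X \<epsilon> J =
    \<lparr>sec = (\<lambda>U. \<lparr>carrier = \<epsilon> ` J U, monoid.mult = undefined, one = undefined, zero = \<epsilon> \<zero>\<^bsub>\<O> X U\<^esub>,
       add = (\<lambda>x y. \<epsilon> (inv_into UNIV \<epsilon> x \<oplus>\<^bsub>\<O> X U\<^esub> inv_into UNIV \<epsilon> y)), smult = (\<lambda>a x. \<epsilon> (a \<otimes>\<^bsub>\<O> X U\<^esub> inv_into UNIV \<epsilon> x))\<rparr>),
     mres = (\<lambda>U V x. \<epsilon> (res X U V (inv_into UNIV \<epsilon> x)))\<rparr>"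

lemma ideal_module_simps [simp]:
  "carrier (sec (ideal_module X \<epsilon> J) U) = \<epsilon> ` J U"
  "\<zero>\<^bsub>sec (ideal_module X \<epsilon> J) U\<^esub> = \<epsilon> \<zero>\<^bsub>\<O> X U\<^esub>"
  "x \<oplus>\<^bsub>sec (ideal_module X \<epsilon> J) U\<^esub> y = \<epsilon> (inv_into UNIV \<epsilon> x \<oplus>\<^bsub>\<O> X U\<^esub> inv_into UNIV \<epsilon> y)"
  "a \<odot>\<^bsub>sec (ideal_module X \<epsilon> J) U\<^esub> x = \<epsilon> (a \<otimes>\<^bsub>\<O> X U\<^esub> inv_into UNIV \<epsilon> x)"
  "mres (ideal_module X \<epsilon> J) U V x = \<epsilon> (res X U V (inv_into UNIV \<epsilon> x))"
  by (simp_all add: ideal_module_def)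

text \<open>J is a parameter because two cases occur, the whole structure sheaf and the conductor.
  Membership in J being local is what turns a family of ideals stable under restriction into a
  sheaf.\<close>

locale ideal_sheaf = noetherian_ringed X for X :: "('x, 'r) ringed_space" +
  fixes \<epsilon> :: "'r \<Rightarrow> 'm" and J :: "'x set \<Rightarrow> 'r set"
  assumes inj: "inj \<epsilon>"
    and J_ideal: "opn X U \<Longrightarrow> ideal (J U) (\<O> X U)"
    and J_res: "opn X U \<Longrightarrow> opn X V \<Longrightarrow> V \<subseteq> U \<Longrightarrow> a \<in> J U \<Longrightarrow> res X U V a \<in> J V"
    and J_local: "opn X U \<Longrightarrow> t \<in> carrier (\<O> X U) \<Longrightarrow>
      (\<And>x. x \<in> U \<Longrightarrow> \<exists>W. opn X W \<and> x \<in> W \<and> W \<subseteq> U \<and> res X U W t \<in> J W) \<Longrightarrow> t \<in> J U"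
begin

abbreviation JM :: "('x, 'r, 'm) mod_sheaf" where "JM \<equiv> ideal_module X \<epsilon> J"

lemma inv_\<epsilon> [simp]: "inv_into UNIV \<epsilon> (\<epsilon> a) = a"
  by (rule inv_f_f[OF inj])

lemma J_carrier: "opn X U \<Longrightarrow> a \<in> J U \<Longrightarrow> a \<in> carrier (\<O> X U)"
  using ideal.Icarr[OF J_ideal] .

lemma J_zero: "opn X U \<Longrightarrow> \<zero>\<^bsub>\<O> X U\<^esub> \<in> J U"
  by (rule additive_subgroup.zero_closed[OF ideal.axioms(1)[OF J_ideal]])

lemma J_add: "opn X U \<Longrightarrow> a \<in> J U \<Longrightarrow> b \<in> J U \<Longrightarrow> a \<oplus>\<^bsub>\<O> X U\<^esub> b \<in> J U"
  by (rule additive_subgroup.a_closed[OF ideal.axioms(1)[OF J_ideal]])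

lemma J_mult: "opn X U \<Longrightarrow> a \<in> carrier (\<O> X U) \<Longrightarrow> b \<in> J U \<Longrightarrow> a \<otimes>\<^bsub>\<O> X U\<^esub> b \<in> J U"
  by (rule ideal.I_l_closed[OF J_ideal])

lemma sec_JM_module:
  assumes U: "opn X U"
  shows "module (\<O> X U) (sec JM U)"
proof -
  interpret cring "\<O> X U" by (rule O_cring[OF U])
  note [simp] = J_carrier[OF U] J_zero[OF U] J_add[OF U] J_mult[OF U]
  show ?thesis
  proof (rule moduleI)
    show "abelian_group (sec JM U)"
    proof (rule abelian_groupI)
      fix x assume "x \<in> carrier (sec JM U)"
      then obtain a where a: "a \<in> J U" "x = \<epsilon> a" by auto
      have "\<ominus>\<^bsub>\<O> X U\<^esub> a = (\<ominus>\<^bsub>\<O> X U\<^esub> \<one>\<^bsub>\<O> X U\<^esub>) \<otimes>\<^bsub>\<O> X U\<^esub> a" using a by (simp add: l_minus)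
      then have "\<ominus>\<^bsub>\<O> X U\<^esub> a \<in> J U" using a by simp
      then show "\<exists>y\<in>carrier (sec JM U). y \<oplus>\<^bsub>sec JM U\<^esub> x = \<zero>\<^bsub>sec JM U\<^esub>"
        using a by (intro bexI[of _ "\<epsilon> (\<ominus>\<^bsub>\<O> X U\<^esub> a)"]) (auto simp: l_neg)
    qed (auto simp: a_ac)
  qed (auto simp: is_cring l_distr r_distr m_assoc)
qed

lemma JM_sheaf: "is_sheaf (top_of X) (\<lambda>U. carrier (sec JM U)) (mres JM)"
  unfolding is_sheaf_def
proof (intro conjI allI impI)
  fix \<U> s
  assume sec: "\<forall>U\<in>\<U>. opn X U \<and> s U \<in> carrier (sec JM U)"
    and comp: "\<forall>U\<in>\<U>. \<forall>V\<in>\<U>. mres JM U (U \<inter> V) (s U) = mres JM V (U \<inter> V) (s V)"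
  let ?b = "\<lambda>U. inv_into UNIV \<epsilon> (s U)"
  have b: "?b U \<in> J U" "s U = \<epsilon> (?b U)" "opn X U" if "U \<in> \<U>" for U using sec that by fastforce+
  have oU: "opn X (\<Union>\<U>)" using b(3) by auto
  have "\<exists>!t. t \<in> carrier (\<O> X (\<Union>\<U>)) \<and> (\<forall>U\<in>\<U>. res X (\<Union>\<U>) U t = ?b U)"
  proof (rule sheaf_glue[OF O_sheaf])
    show "?b U \<in> carrier (\<O> X U)" if "U \<in> \<U>" for U by (rule J_carrier[OF b(3,1)[OF that]])
    show "res X U (U \<inter> V) (?b U) = res X V (U \<inter> V) (?b V)" if "U \<in> \<U>" "V \<in> \<U>" for U V
      using comp[THEN bspec, OF that(1), THEN bspec, OF that(2)] inj_eq[OF inj] by simp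
  qed (rule b(3))
  then obtain t where t: "t \<in> carrier (\<O> X (\<Union>\<U>))" "\<forall>U\<in>\<U>. res X (\<Union>\<U>) U t = ?b U"
    and uniq: "\<And>t'. t' \<in> carrier (\<O> X (\<Union>\<U>)) \<Longrightarrow> \<forall>U\<in>\<U>. res X (\<Union>\<U>) U t' = ?b U \<Longrightarrow> t' = t"
    by (elim ex1E) (rule that, blast+)
  \<comment> \<open>Gluing takes place in \<open>\<O>\<close>; the local pieces then put the result
    into J.\<close>
  have tJ: "t \<in> J (\<Union>\<U>)"
  proof (rule J_local[OF oU t(1)])
    fix x assume "x \<in> \<Union>\<U>"
    then obtain U where "U \<in> \<U>" "x \<in> U" by auto
    then show "\<exists>W. opn X W \<and> x \<in> W \<and> W \<subseteq> \<Union>\<U> \<and> res X (\<Union>\<U>) W t \<in> J W"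
      using b t(2) by (intro exI[of _ U]) auto
  qed
  show "\<exists>!t. t \<in> carrier (sec JM (\<Union>\<U>)) \<and> (\<forall>U\<in>\<U>. mres JM (\<Union>\<U>) U t = s U)"
  proof (rule ex1I[of _ "\<epsilon> t"])
    show "\<epsilon> t \<in> carrier (sec JM (\<Union>\<U>)) \<and> (\<forall>U\<in>\<U>. mres JM (\<Union>\<U>) U (\<epsilon> t) = s U)"
      using tJ t(2) b(2) by simp
    fix r assume r: "r \<in> carrier (sec JM (\<Union>\<U>)) \<and> (\<forall>U\<in>\<U>. mres JM (\<Union>\<U>) U r = s U)"
    then obtain t' where t': "t' \<in> J (\<Union>\<U>)" "r = \<epsilon> t'" by auto
    have "\<forall>U\<in>\<U>. res X (\<Union>\<U>) U t' = ?b U"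
    proof
      fix U assume "U \<in> \<U>"
      then have "\<epsilon> (res X (\<Union>\<U>) U t') = s U" using r t'(2) by simp
      then show "res X (\<Union>\<U>) U t' = ?b U" by (metis inv_\<epsilon>)
    qed
    then show "r = \<epsilon> t" using uniq[OF J_carrier[OF oU t'(1)]] t'(2) by simp
  qed
qed (auto simp: J_res J_carrier res_id res_res)

lemma JM_sheaf_of_modules: "sheaf_of_modules X JM"
  unfolding sheaf_of_modules_def
  using sec_JM_module JM_sheaf by (auto simp: res_add res_mult J_carrier)

end

sublocale ideal_sheaf \<subseteq> JM: sheaf_module X JM
  by unfold_locales (rule JM_sheaf_of_modules)

context ideal_sheaf
begin

text \<open>Proved backwards: undoing \<epsilon> is an additive map from the copy to the ring of
  functions, and both of these are records in which sums can be formed.\<close>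

lemma JM_finsum:
  assumes U: "opn X U" and b: "b \<in> {..<k::nat} \<rightarrow> J U"
  shows "(\<Oplus>\<^bsub>sec JM U\<^esub>i\<in>{..<k}. \<epsilon> (b i)) = \<epsilon> (\<Oplus>\<^bsub>\<O> X U\<^esub>i\<in>{..<k}. b i)"
proof -
  have "inv_into UNIV \<epsilon> (\<Oplus>\<^bsub>sec JM U\<^esub>i\<in>{..<k}. \<epsilon> (b i)) = (\<Oplus>\<^bsub>\<O> X U\<^esub>i\<in>{..<k}. inv_into UNIV \<epsilon> (\<epsilon> (b i)))"
    by (rule finsum_hom_lessThan[OF JM.sec_abelian_monoid[OF U] O_abelian_monoid[OF U]])
       (use b J_carrier[OF U] in \<open>auto simp: Pi_iff\<close>)
  then have eq: "inv_into UNIV \<epsilon> (\<Oplus>\<^bsub>sec JM U\<^esub>i\<in>{..<k}. \<epsilon> (b i)) = (\<Oplus>\<^bsub>\<O> X U\<^esub>i\<in>{..<k}. b i)" by simp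
  have "(\<Oplus>\<^bsub>sec JM U\<^esub>i\<in>{..<k}. \<epsilon> (b i)) \<in> carrier (sec JM U)"
    by (rule abelian_monoid.finsum_closed[OF JM.sec_abelian_monoid[OF U]]) (use b in auto)
  then obtain c where "(\<Oplus>\<^bsub>sec JM U\<^esub>i\<in>{..<k}. \<epsilon> (b i)) = \<epsilon> c" by auto
  then show ?thesis using eq by simp
qed

text \<open>The definition read on functions, so that \<epsilon> disappears and the sums are taken
  in rings of functions.\<close>

lemma JM_finite_type:
  assumes "\<And>x. x \<in> pts X \<Longrightarrow> \<exists>N (m::nat) l. opn X N \<and> x \<in> N \<and> l \<in> {..<m} \<rightarrow> J N \<and>
    (\<forall>V y b. opn X V \<longrightarrow> V \<subseteq> N \<longrightarrow> y \<in> V \<longrightarrow> b \<in> J V \<longrightarrow>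
      (\<exists>D e. opn X D \<and> y \<in> D \<and> D \<subseteq> V \<and> e \<in> {..<m} \<rightarrow> carrier (\<O> X D) \<and>
        res X V D b = (\<Oplus>\<^bsub>\<O> X D\<^esub>j\<in>{..<m}. e j \<otimes>\<^bsub>\<O> X D\<^esub> res X N D (l j))))"
  shows "finite_type_sheaf X JM"
  unfolding finite_type_sheaf_def
proof
  fix x assume x: "x \<in> pts X"
  obtain N and m :: nat and l where N: "opn X N" "x \<in> N" and l: "l \<in> {..<m} \<rightarrow> J N"
    and gen: "\<forall>V y b. opn X V \<longrightarrow> V \<subseteq> N \<longrightarrow> y \<in> V \<longrightarrow> b \<in> J V \<longrightarrow>
      (\<exists>D e. opn X D \<and> y \<in> D \<and> D \<subseteq> V \<and> e \<in> {..<m} \<rightarrow> carrier (\<O> X D) \<and>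
        res X V D b = (\<Oplus>\<^bsub>\<O> X D\<^esub>j\<in>{..<m}. e j \<otimes>\<^bsub>\<O> X D\<^esub> res X N D (l j)))"
    using assms[OF x] by (elim exE conjE) (rule that)
  have gen': "\<exists>D e. opn X D \<and> y \<in> D \<and> D \<subseteq> V \<and> e \<in> {..<m} \<rightarrow> carrier (\<O> X D) \<and>
      mres JM V D s = (\<Oplus>\<^bsub>sec JM D\<^esub>j\<in>{..<m}. e j \<odot>\<^bsub>sec JM D\<^esub> mres JM N D (\<epsilon> (l j)))"
    if V: "opn X V" "V \<subseteq> N" "y \<in> V" and s: "s \<in> carrier (sec JM V)" for V y s
  proof -
    obtain b where b: "b \<in> J V" "s = \<epsilon> b" using s by auto
    obtain D e where D: "opn X D" "y \<in> D" "D \<subseteq> V" and e: "e \<in> {..<m} \<rightarrow> carrier (\<O> X D)"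
      and eq: "res X V D b = (\<Oplus>\<^bsub>\<O> X D\<^esub>j\<in>{..<m}. e j \<otimes>\<^bsub>\<O> X D\<^esub> res X N D (l j))"
      using gen[rule_format, OF V b(1)] by (elim exE conjE) (rule that)
    have "(\<lambda>j. e j \<otimes>\<^bsub>\<O> X D\<^esub> res X N D (l j)) \<in> {..<m} \<rightarrow> J D"
      using e l J_mult[OF D(1)] J_res[OF N(1) D(1)] D(3) V(2) by (auto simp: Pi_iff)
    from JM_finsum[OF D(1) this] show ?thesis
      using D e eq b(2) by (intro exI[of _ D] exI[of _ e]) simp
  qed
  have A: "(\<lambda>j. \<epsilon> (l j)) \<in> {..<m} \<rightarrow> carrier (sec JM N)" using l by auto
  have B: "\<forall>V s. opn X V \<longrightarrow> V \<subseteq> N \<longrightarrow> s \<in> carrier (sec JM V) \<longrightarrow> (\<forall>y\<in>V.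
    \<exists>D e. opn X D \<and> y \<in> D \<and> D \<subseteq> V \<and> e \<in> {..<m} \<rightarrow> carrier (\<O> X D) \<and>
      mres JM V D s = (\<Oplus>\<^bsub>sec JM D\<^esub>j\<in>{..<m}. e j \<odot>\<^bsub>sec JM D\<^esub> mres JM N D (\<epsilon> (l j))))"
    by (intro allI impI ballI, rule gen')
  show "\<exists>U (n::nat) g. opn X U \<and> x \<in> U \<and> g \<in> {..<n} \<rightarrow> carrier (sec JM U) \<and>
       (\<forall>V s. opn X V \<longrightarrow> V \<subseteq> U \<longrightarrow> s \<in> carrier (sec JM V) \<longrightarrow>
          (\<forall>y\<in>V. \<exists>W a. opn X W \<and> y \<in> W \<and> W \<subseteq> V \<and> a \<in> {..<n} \<rightarrow> carrier (\<O> X W) \<and>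
             mres JM V W s = (\<Oplus>\<^bsub>sec JM W\<^esub>i\<in>{..<n}. a i \<odot>\<^bsub>sec JM W\<^esub> mres JM U W (g i))))"
    by (rule exI[of _ N], rule exI[of _ m], rule exI[of _ "\<lambda>j. \<epsilon> (l j)"], intro conjI N A B)
qed

end

lemma (in cring) divide_unit_finsum:
  assumes u: "u \<in> Units R" and t: "t \<in> carrier R" and c: "c \<in> {..<m::nat} \<rightarrow> carrier R"
    and l: "l \<in> {..<m} \<rightarrow> carrier R" and eq: "u \<otimes> t = (\<Oplus>j\<in>{..<m}. c j \<otimes> l j)"
  shows "t = (\<Oplus>j\<in>{..<m}. (inv u \<otimes> c j) \<otimes> l j)"
proof -
  have v: "inv u \<in> carrier R" using u by simp
  have "t = inv u \<otimes> (u \<otimes> t)"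
    unfolding m_assoc[symmetric, OF v Units_closed[OF u] t] Units_l_inv[OF u] using t by simp
  also have "\<dots> = (\<Oplus>j\<in>{..<m}. inv u \<otimes> (c j \<otimes> l j))"
    unfolding eq by (rule finsum_rdistr) (use c l v in auto)
  also have "\<dots> = (\<Oplus>j\<in>{..<m}. (inv u \<otimes> c j) \<otimes> l j)"
    by (rule finsum_cong') (use c l v in \<open>auto simp: Pi_iff m_assoc\<close>)
  finally show ?thesis .
qed

section \<open>Relations between sections of an ideal sheaf\<close>

context ringed
begin

text \<open>The coefficients live on W, where the ring is going to be noetherian, while the sections
  \<delta> and the relation itself live on the smaller set V.\<close>

lemma relations_submodule:
  assumes W: "opn X W" and V: "opn X V" "V \<subseteq> W" and \<delta>: "\<delta> \<in> {..<n} \<rightarrow> carrier (\<O> X V)"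
  shows "submodule {b \<in> {..<n} \<rightarrow>\<^sub>E carrier (\<O> X W).
      (\<Oplus>\<^bsub>\<O> X V\<^esub>i\<in>{..<n}. res X W V (b i) \<otimes>\<^bsub>\<O> X V\<^esub> \<delta> i) = \<zero>\<^bsub>\<O> X V\<^esub>} (\<O> X W) (power_module (\<O> X W) n)"
    (is "submodule ?S _ _")
proof -
  interpret W: cring "\<O> X W" by (rule O_cring[OF W])
  interpret V: cring "\<O> X V" by (rule O_cring[OF V(1)])
  interpret P: module "\<O> X W" "power_module (\<O> X W) n" by (rule W.module_power_module)
  note rc = res_closed[OF W V]
  have \<delta>i: "\<delta> i \<in> carrier (\<O> X V)" if "i < n" for i using \<delta> that by auto
  have sm: "a \<odot>\<^bsub>power_module (\<O> X W) n\<^esub> b \<in> ?S" if a: "a \<in> carrier (\<O> X W)" and b: "b \<in> ?S" for a b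
  proof -
    have bi: "b i \<in> carrier (\<O> X W)" if "i < n" for i using b that by auto
    have "(\<Oplus>\<^bsub>\<O> X V\<^esub>i\<in>{..<n}. res X W V (a \<otimes>\<^bsub>\<O> X W\<^esub> b i) \<otimes>\<^bsub>\<O> X V\<^esub> \<delta> i)
      = (\<Oplus>\<^bsub>\<O> X V\<^esub>i\<in>{..<n}. res X W V a \<otimes>\<^bsub>\<O> X V\<^esub> (res X W V (b i) \<otimes>\<^bsub>\<O> X V\<^esub> \<delta> i))"
      by (rule V.finsum_cong') (use a bi \<delta>i rc res_mult[OF W V] in \<open>auto simp: V.m_assoc\<close>)
    also have "\<dots> = res X W V a \<otimes>\<^bsub>\<O> X V\<^esub> (\<Oplus>\<^bsub>\<O> X V\<^esub>i\<in>{..<n}. res X W V (b i) \<otimes>\<^bsub>\<O> X V\<^esub> \<delta> i)"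
      by (rule V.finsum_rdistr[symmetric]) (use a bi \<delta>i rc in auto)
    also have "\<dots> = \<zero>\<^bsub>\<O> X V\<^esub>" using b rc[OF a] by simp
    finally have "(\<Oplus>\<^bsub>\<O> X V\<^esub>i\<in>{..<n}. res X W V (a \<otimes>\<^bsub>\<O> X W\<^esub> b i) \<otimes>\<^bsub>\<O> X V\<^esub> \<delta> i) = \<zero>\<^bsub>\<O> X V\<^esub>" .
    moreover have "(\<Oplus>\<^bsub>\<O> X V\<^esub>i\<in>{..<n}. res X W V ((a \<odot>\<^bsub>power_module (\<O> X W) n\<^esub> b) i) \<otimes>\<^bsub>\<O> X V\<^esub> \<delta> i)
      = (\<Oplus>\<^bsub>\<O> X V\<^esub>i\<in>{..<n}. res X W V (a \<otimes>\<^bsub>\<O> X W\<^esub> b i) \<otimes>\<^bsub>\<O> X V\<^esub> \<delta> i)"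
      by (rule V.finsum_cong') (use a bi \<delta>i rc in auto)
    ultimately show ?thesis using a bi by auto
  qed
  show ?thesis
  proof (rule P.submoduleI)
    show "?S \<subseteq> carrier (power_module (\<O> X W) n)" by auto
    show "a \<odot>\<^bsub>power_module (\<O> X W) n\<^esub> b \<in> ?S" if "a \<in> carrier (\<O> X W)" "b \<in> ?S" for a b
      by (rule sm[OF that])
    show "\<ominus>\<^bsub>power_module (\<O> X W) n\<^esub> b \<in> ?S" if b: "b \<in> ?S" for b
    proof -
      have "b \<in> carrier (power_module (\<O> X W) n)" using b by auto
      then have "\<ominus>\<^bsub>power_module (\<O> X W) n\<^esub> b = (\<ominus>\<^bsub>\<O> X W\<^esub> \<one>\<^bsub>\<O> X W\<^esub>) \<odot>\<^bsub>power_module (\<O> X W) n\<^esub> b"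
        using P.smult_l_minus[OF W.one_closed] P.smult_one by simp
      then show ?thesis using sm[OF _ b] by simp
    qed
    show "\<zero>\<^bsub>power_module (\<O> X W) n\<^esub> \<in> ?S"
    proof -
      have "(\<Oplus>\<^bsub>\<O> X V\<^esub>i\<in>{..<n}. res X W V (\<zero>\<^bsub>power_module (\<O> X W) n\<^esub> i) \<otimes>\<^bsub>\<O> X V\<^esub> \<delta> i)
        = (\<Oplus>\<^bsub>\<O> X V\<^esub>i\<in>{..<n}. \<zero>\<^bsub>\<O> X V\<^esub>)"
        by (rule V.finsum_cong') (use \<delta>i res_zero[OF W V] in auto)
      then show ?thesis by (simp add: V.finsum_zero)
    qed
    show "a \<oplus>\<^bsub>power_module (\<O> X W) n\<^esub> b \<in> ?S" if a: "a \<in> ?S" and b: "b \<in> ?S" for a b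
    proof -
      have c: "a i \<in> carrier (\<O> X W)" "b i \<in> carrier (\<O> X W)" if "i < n" for i using a b that by auto
      have "(\<Oplus>\<^bsub>\<O> X V\<^esub>i\<in>{..<n}. res X W V ((a \<oplus>\<^bsub>power_module (\<O> X W) n\<^esub> b) i) \<otimes>\<^bsub>\<O> X V\<^esub> \<delta> i)
        = (\<Oplus>\<^bsub>\<O> X V\<^esub>i\<in>{..<n}. res X W V (a i) \<otimes>\<^bsub>\<O> X V\<^esub> \<delta> i \<oplus>\<^bsub>\<O> X V\<^esub> res X W V (b i) \<otimes>\<^bsub>\<O> X V\<^esub> \<delta> i)"
        by (rule V.finsum_cong') (use c \<delta>i rc res_add[OF W V] in \<open>auto simp: V.l_distr\<close>)
      also have "\<dots> = (\<Oplus>\<^bsub>\<O> X V\<^esub>i\<in>{..<n}. res X W V (a i) \<otimes>\<^bsub>\<O> X V\<^esub> \<delta> i) \<oplus>\<^bsub>\<O> X V\<^esub>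
          (\<Oplus>\<^bsub>\<O> X V\<^esub>i\<in>{..<n}. res X W V (b i) \<otimes>\<^bsub>\<O> X V\<^esub> \<delta> i)"
        by (rule V.finsum_addf) (use c \<delta>i rc in auto)
      also have "\<dots> = \<zero>\<^bsub>\<O> X V\<^esub>" using a b by simp
      finally show ?thesis using c by auto
    qed
  qed
qed

end

context ideal_sheaf
begin

text \<open>Near x take a noetherian W. The relations over U \<inter> W with coefficients in
  \<open>\<O> X W\<close> form a finitely generated module, and its generators, restricted, generate
  all local relations: a local relation t multiplied by a common denominator u has coefficients from
  W, is a combination of the generators, and u is invertible nearby.\<close>

lemma JM_relations:
  assumes U: "opn X U" and g: "g \<in> {..<n} \<rightarrow> carrier (sec JM U)"
  shows "finite_type_sheaf (open_subspace X U) (relation_sheaf X JM U n g)"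
proof -
  let ?K = "relation_sheaf X JM U n g"
  define \<gamma> where "\<gamma> i = inv_into UNIV \<epsilon> (g i)" for i
  have \<gamma>J: "\<gamma> i \<in> J U" "g i = \<epsilon> (\<gamma> i)" if "i < n" for i using g that by (force simp: \<gamma>_def Pi_iff)+
  have \<gamma>c: "\<gamma> i \<in> carrier (\<O> X U)" if "i < n" for i by (rule J_carrier[OF U \<gamma>J(1)[OF that]])
  have \<gamma>V: "(\<lambda>i. res X U V (\<gamma> i)) \<in> {..<n} \<rightarrow> carrier (\<O> X V)" if "opn X V" "V \<subseteq> U" for V
    using res_closed[OF U that] \<gamma>c by auto
  \<comment> \<open>Two open sets are involved: coefficients are functions on W, and the relation is
    tested on V. With W = V these are the sections of the relation sheaf.\<close>
  define S where "S W V = {b \<in> {..<n} \<rightarrow>\<^sub>E carrier (\<O> X W).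
      (\<Oplus>\<^bsub>\<O> X V\<^esub>i\<in>{..<n}. res X W V (b i) \<otimes>\<^bsub>\<O> X V\<^esub> res X U V (\<gamma> i)) = \<zero>\<^bsub>\<O> X V\<^esub>}" for W V
  have S_sub: "submodule (S W V) (\<O> X W) (power_module (\<O> X W) n)"
    if "opn X W" "opn X V" "V \<subseteq> W" "V \<subseteq> U" for W V
    unfolding S_def by (rule relations_submodule[OF that(1-3) \<gamma>V[OF that(2,4)]])
  \<comment> \<open>Undoing \<epsilon> turns a relation between the g i into one between functions.
    The sections thus form a submodule of a free module, from which they inherit the module
    laws.\<close>
  have secK: "sec ?K V = (power_module (\<O> X V) n)\<lparr>carrier := S V V\<rparr>" if V: "opn X V" "V \<subseteq> U" for V
  proof -
    have "(\<Oplus>\<^bsub>sec JM V\<^esub>i\<in>{..<n}. a i \<odot>\<^bsub>sec JM V\<^esub> mres JM U V (g i)) = \<zero>\<^bsub>sec JM V\<^esub> \<longleftrightarrow>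
      (\<Oplus>\<^bsub>\<O> X V\<^esub>i\<in>{..<n}. res X V V (a i) \<otimes>\<^bsub>\<O> X V\<^esub> res X U V (\<gamma> i)) = \<zero>\<^bsub>\<O> X V\<^esub>"
      if a: "a \<in> {..<n} \<rightarrow>\<^sub>E carrier (\<O> X V)" for a
    proof -
      interpret V: cring "\<O> X V" by (rule O_cring[OF V(1)])
      interpret M: module "\<O> X V" "sec JM V" by (rule sec_JM_module[OF V(1)])
      let ?b = "\<lambda>i. a i \<otimes>\<^bsub>\<O> X V\<^esub> res X U V (\<gamma> i)"
      have b: "?b \<in> {..<n} \<rightarrow> J V"
        using a J_mult[OF V(1)] J_res[OF U V] \<gamma>J(1) by (auto simp: PiE_iff)
      have "(\<Oplus>\<^bsub>sec JM V\<^esub>i\<in>{..<n}. a i \<odot>\<^bsub>sec JM V\<^esub> mres JM U V (g i)) = (\<Oplus>\<^bsub>sec JM V\<^esub>i\<in>{..<n}. \<epsilon> (?b i))"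
        by (rule M.finsum_cong') (use b \<gamma>J(2) in auto)
      also have "\<dots> = \<epsilon> (\<Oplus>\<^bsub>\<O> X V\<^esub>i\<in>{..<n}. ?b i)" by (rule JM_finsum[OF V(1) b])
      also have "(\<Oplus>\<^bsub>\<O> X V\<^esub>i\<in>{..<n}. ?b i) = (\<Oplus>\<^bsub>\<O> X V\<^esub>i\<in>{..<n}. res X V V (a i) \<otimes>\<^bsub>\<O> X V\<^esub> res X U V (\<gamma> i))"
        by (rule V.finsum_cong') (use a res_id[OF V(1)] \<gamma>V[OF V] in \<open>auto simp: PiE_iff Pi_iff\<close>)
      finally show ?thesis using inj_eq[OF inj] by simp
    qed
    then have "{a \<in> {..<n} \<rightarrow>\<^sub>E carrier (\<O> X V).
        (\<Oplus>\<^bsub>sec JM V\<^esub>i\<in>{..<n}. a i \<odot>\<^bsub>sec JM V\<^esub> mres JM U V (g i)) = \<zero>\<^bsub>sec JM V\<^esub>} = S V V"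
      unfolding S_def by (intro Collect_cong conj_cong refl)
    then show ?thesis
      unfolding relation_sheaf_def power_module_def by (simp del: ideal_module_simps)
  qed
  have K_add: "x \<oplus>\<^bsub>sec ?K V\<^esub> y = (\<lambda>i\<in>{..<n}. x i \<oplus>\<^bsub>\<O> X V\<^esub> y i)"
    and K_smult: "c \<odot>\<^bsub>sec ?K V\<^esub> x = (\<lambda>i\<in>{..<n}. c \<otimes>\<^bsub>\<O> X V\<^esub> x i)"
    and K_zero: "\<zero>\<^bsub>sec ?K V\<^esub> = (\<lambda>i\<in>{..<n}. \<zero>\<^bsub>\<O> X V\<^esub>)"
    and K_res: "mres ?K V V' x = (\<lambda>i\<in>{..<n}. res X V V' (x i))" for V V' x y c
    by (simp_all add: relation_sheaf_def)
  have K_carrier: "carrier (sec ?K V) = S V V" if "opn X V" "V \<subseteq> U" for V using secK[OF that] by simp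
  have K_module: "module (\<O> X V) (sec ?K V)" if V: "opn X V" "V \<subseteq> U" for V
    unfolding secK[OF V]
    by (rule submodule.submodule_is_module[OF S_sub[OF V(1) V(1) order_refl V(2)]
          cring.module_power_module[OF O_cring[OF V(1)]]])
  show ?thesis
    unfolding finite_type_sheaf_def open_subspace_simps openin_open_subspace[OF U] pts_open_subspace[OF U]
  proof
    fix x assume x: "x \<in> U"
    then have "x \<in> pts X" using openin_subset[OF U] by auto
    then obtain W where W: "opn X W" "x \<in> W" and noeth: "noetherian_ring (\<O> X W)" and fr: "has_fractions X W"
      using noetherian_nbhd by blast
    let ?U = "U \<inter> W"
    have U': "opn X ?U" "?U \<subseteq> U" "?U \<subseteq> W" "x \<in> ?U" using U W x by auto
    interpret W: cring "\<O> X W" by (rule O_cring[OF W(1)])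
    obtain m :: nat and l where l: "l \<in> {..<m} \<rightarrow> S W ?U"
      and gen: "\<And>t. t \<in> S W ?U \<Longrightarrow> \<exists>a \<in> {..<m} \<rightarrow> carrier (\<O> X W). \<forall>i<n. t i = (\<Oplus>\<^bsub>\<O> X W\<^esub>j\<in>{..<m}. a j \<otimes>\<^bsub>\<O> X W\<^esub> l j i)"
      by (rule W.tuple_generators[OF noeth S_sub[OF W(1) U'(1,3,2)]]) (rule that)
    have lW: "l j i \<in> carrier (\<O> X W)" if "j < m" "i < n" for i j
      using l that by (auto simp: S_def Pi_iff PiE_iff)
    define h where "h j = (\<lambda>i\<in>{..<n}. res X W ?U (l j i))" for j
    have hS: "h j \<in> S ?U ?U" if j: "j < m" for j
    proof -
      interpret OU: cring "\<O> X ?U" by (rule O_cring[OF U'(1)])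
      have "l j \<in> S W ?U" using l j by auto
      then have "(\<Oplus>\<^bsub>\<O> X ?U\<^esub>i\<in>{..<n}. res X W ?U (l j i) \<otimes>\<^bsub>\<O> X ?U\<^esub> res X U ?U (\<gamma> i)) = \<zero>\<^bsub>\<O> X ?U\<^esub>"
        by (simp add: S_def)
      moreover have "(\<Oplus>\<^bsub>\<O> X ?U\<^esub>i\<in>{..<n}. res X ?U ?U (h j i) \<otimes>\<^bsub>\<O> X ?U\<^esub> res X U ?U (\<gamma> i))
         = (\<Oplus>\<^bsub>\<O> X ?U\<^esub>i\<in>{..<n}. res X W ?U (l j i) \<otimes>\<^bsub>\<O> X ?U\<^esub> res X U ?U (\<gamma> i))"
        by (rule OU.finsum_cong')
           (use \<gamma>V[OF U'(1,2)] lW[OF j] res_closed[OF W(1) U'(1,3)] res_id[OF U'(1)] in \<open>auto simp: h_def Pi_iff\<close>)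
      ultimately show ?thesis using lW[OF j] res_closed[OF W(1) U'(1,3)] by (simp add: S_def h_def)
    qed
    have main: "\<exists>D e. (opn X D \<and> D \<subseteq> U) \<and> y \<in> D \<and> D \<subseteq> V \<and> e \<in> {..<m} \<rightarrow> carrier (\<O> X D) \<and>
        mres ?K V D t = (\<Oplus>\<^bsub>sec ?K D\<^esub>j\<in>{..<m}. e j \<odot>\<^bsub>sec ?K D\<^esub> mres ?K ?U D (h j))"
      if V: "opn X V \<and> V \<subseteq> U" "V \<subseteq> ?U" and t: "t \<in> carrier (sec ?K V)" and y: "y \<in> V" for V t y
    proof -
      have tS: "t \<in> S V V" using t K_carrier V by simp
      then have tV: "t i \<in> carrier (\<O> X V)" if "i < n" for i using that by (auto simp: S_def PiE_iff)
      have VW: "V \<subseteq> W" using V by auto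
      obtain D u a where D: "opn X D" "y \<in> D" "D \<subseteq> V" and u: "u \<in> carrier (\<O> X W)"
        and a: "a \<in> {..<n} \<rightarrow> carrier (\<O> X W)" and unit: "res X W D u \<in> Units (\<O> X D)"
        and eq: "\<forall>i<n. res X W D u \<otimes>\<^bsub>\<O> X D\<^esub> res X V D (t i) = res X W D (a i)"
      proof -
        have "t \<in> {..<n} \<rightarrow> carrier (\<O> X V)" using tV by auto
        from common_denominator[OF W(1) fr conjunct1[OF V(1)] VW y this]
        show thesis by (elim exE conjE) (rule that)
      qed
      have sub: "D \<subseteq> U" "D \<subseteq> W" "D \<subseteq> ?U" "D \<noteq> {}" using D V by auto
      interpret Dr: cring "\<O> X D" by (rule O_cring[OF D(1)])
      interpret OU: cring "\<O> X ?U" by (rule O_cring[OF U'(1)])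
      have uD: "res X W D u \<in> carrier (\<O> X D)" by (rule res_closed[OF W(1) D(1) sub(2) u])
      have tD: "res X V D (t i) \<in> carrier (\<O> X D)" if "i < n" for i
        by (rule res_closed[OF conjunct1[OF V(1)] D(1,3) tV[OF that]])
      have \<gamma>D: "res X U D (\<gamma> i) \<in> carrier (\<O> X D)" if "i < n" for i by (rule res_closed[OF U D(1) sub(1) \<gamma>c[OF that]])
      have aW: "a i \<in> carrier (\<O> X W)" if "i < n" for i using a that by auto
      \<comment> \<open>Over D the tuple a is u t, hence a relation. Restriction from U \<inter> W
        to the nonempty D is injective, so a is a relation over U \<inter> W and therefore a
        combination of the l j.\<close>
      have "(\<lambda>i\<in>{..<n}. a i) \<in> S W ?U"
      proof -
        let ?s = "\<Oplus>\<^bsub>\<O> X ?U\<^esub>i\<in>{..<n}. res X W ?U (a i) \<otimes>\<^bsub>\<O> X ?U\<^esub> res X U ?U (\<gamma> i)"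
        have sc: "(\<lambda>i. res X W ?U (a i) \<otimes>\<^bsub>\<O> X ?U\<^esub> res X U ?U (\<gamma> i)) \<in> {..<n} \<rightarrow> carrier (\<O> X ?U)"
          using \<gamma>V[OF U'(1,2)] res_closed[OF W(1) U'(1,3)] aW by (auto simp: Pi_iff)
        have "res X ?U D ?s = (\<Oplus>\<^bsub>\<O> X D\<^esub>i\<in>{..<n}. res X ?U D (res X W ?U (a i) \<otimes>\<^bsub>\<O> X ?U\<^esub> res X U ?U (\<gamma> i)))"
          by (rule res_finsum[OF U'(1) D(1) sub(3) sc])
        also have "\<dots> = (\<Oplus>\<^bsub>\<O> X D\<^esub>i\<in>{..<n}. res X W D u \<otimes>\<^bsub>\<O> X D\<^esub> (res X V D (t i) \<otimes>\<^bsub>\<O> X D\<^esub> res X U D (\<gamma> i)))"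
        proof (rule Dr.finsum_cong')
          fix i assume "i \<in> {..<n}"
          then have i: "i < n" by simp
          have "res X ?U D (res X W ?U (a i) \<otimes>\<^bsub>\<O> X ?U\<^esub> res X U ?U (\<gamma> i)) = res X W D (a i) \<otimes>\<^bsub>\<O> X D\<^esub> res X U D (\<gamma> i)"
            using res_mult[OF U'(1) D(1) sub(3) res_closed[OF W(1) U'(1,3) aW[OF i]] res_closed[OF U U'(1,2) \<gamma>c[OF i]]]
              res_res[OF W(1) U'(1) D(1) sub(3) U'(3) aW[OF i]] res_res[OF U U'(1) D(1) sub(3) U'(2) \<gamma>c[OF i]] by simp
          then show "res X ?U D (res X W ?U (a i) \<otimes>\<^bsub>\<O> X ?U\<^esub> res X U ?U (\<gamma> i)) =
              res X W D u \<otimes>\<^bsub>\<O> X D\<^esub> (res X V D (t i) \<otimes>\<^bsub>\<O> X D\<^esub> res X U D (\<gamma> i))"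
            using eq i uD tD[OF i] \<gamma>D[OF i] by (simp add: Dr.m_assoc[symmetric])
        qed (use uD tD \<gamma>D in auto)
        also have "\<dots> = res X W D u \<otimes>\<^bsub>\<O> X D\<^esub> (\<Oplus>\<^bsub>\<O> X D\<^esub>i\<in>{..<n}. res X V D (t i) \<otimes>\<^bsub>\<O> X D\<^esub> res X U D (\<gamma> i))"
          by (rule Dr.finsum_rdistr[symmetric]) (use uD tD \<gamma>D in auto)
        also have "(\<Oplus>\<^bsub>\<O> X D\<^esub>i\<in>{..<n}. res X V D (t i) \<otimes>\<^bsub>\<O> X D\<^esub> res X U D (\<gamma> i))
          = (\<Oplus>\<^bsub>\<O> X D\<^esub>i\<in>{..<n}. res X V D (res X V V (t i) \<otimes>\<^bsub>\<O> X V\<^esub> res X U V (\<gamma> i)))"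
        proof (rule Dr.finsum_cong')
          fix i assume "i \<in> {..<n}"
          then have i: "i < n" by simp
          note V1 = conjunct1[OF V(1)] conjunct2[OF V(1)]
          show "res X V D (t i) \<otimes>\<^bsub>\<O> X D\<^esub> res X U D (\<gamma> i) = res X V D (res X V V (t i) \<otimes>\<^bsub>\<O> X V\<^esub> res X U V (\<gamma> i))"
            using res_mult[OF V1(1) D(1,3) tV[OF i] res_closed[OF U V1 \<gamma>c[OF i]]] res_id[OF V1(1) tV[OF i]]
              res_res[OF U V1(1) D(1,3) V1(2) \<gamma>c[OF i]] by simp
        next
          note V1 = conjunct1[OF V(1)] conjunct2[OF V(1)]
          show "(\<lambda>i. res X V D (res X V V (t i) \<otimes>\<^bsub>\<O> X V\<^esub> res X U V (\<gamma> i))) \<in> {..<n} \<rightarrow> carrier (\<O> X D)"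
            using res_closed[OF V1(1) D(1,3)] O_mult_closed[OF V1(1)] tV res_id[OF V1(1)] \<gamma>V[OF V1] by (auto simp: Pi_iff)
        qed simp
        also have "\<dots> = res X V D (\<Oplus>\<^bsub>\<O> X V\<^esub>i\<in>{..<n}. res X V V (t i) \<otimes>\<^bsub>\<O> X V\<^esub> res X U V (\<gamma> i))"
        proof (rule res_finsum[symmetric])
          note V1 = conjunct1[OF V(1)] conjunct2[OF V(1)]
          show "(\<lambda>i. res X V V (t i) \<otimes>\<^bsub>\<O> X V\<^esub> res X U V (\<gamma> i)) \<in> {..<n} \<rightarrow> carrier (\<O> X V)"
            using O_mult_closed[OF V1(1)] tV res_id[OF V1(1)] \<gamma>V[OF V1] by (auto simp: Pi_iff)
        qed (use V D in auto)
        also have "\<dots> = \<zero>\<^bsub>\<O> X D\<^esub>"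
          using tS res_zero[OF conjunct1[OF V(1)] D(1,3)] by (simp add: S_def)
        finally have "res X ?U D ?s = res X ?U D \<zero>\<^bsub>\<O> X ?U\<^esub>"
          using uD res_zero[OF U'(1) D(1) sub(3)] by simp
        then have s0: "?s = \<zero>\<^bsub>\<O> X ?U\<^esub>"
          by (rule res_inj[OF U'(1) D(1) sub(3,4) OU.finsum_closed[OF sc] OU.zero_closed])
        have "(\<Oplus>\<^bsub>\<O> X ?U\<^esub>i\<in>{..<n}. res X W ?U ((\<lambda>i\<in>{..<n}. a i) i) \<otimes>\<^bsub>\<O> X ?U\<^esub> res X U ?U (\<gamma> i)) = ?s"
          by (rule OU.finsum_cong') (use sc in auto)
        then show ?thesis using s0 aW by (simp add: S_def)
      qed
      from gen[OF this] obtain e where e: "e \<in> {..<m} \<rightarrow> carrier (\<O> X W)"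
        and ae: "\<forall>i<n. a i = (\<Oplus>\<^bsub>\<O> X W\<^esub>j\<in>{..<m}. e j \<otimes>\<^bsub>\<O> X W\<^esub> l j i)" by auto
      \<comment> \<open>Dividing by u, a unit over D, turns the coefficients e of u t into
        coefficients of t.\<close>
      let ?e = "\<lambda>j. inv\<^bsub>\<O> X D\<^esub> (res X W D u) \<otimes>\<^bsub>\<O> X D\<^esub> res X W D (e j)"
      have eD: "(\<lambda>j. res X W D (e j)) \<in> {..<m} \<rightarrow> carrier (\<O> X D)" using e res_closed[OF W(1) D(1) sub(2)] by auto
      have e'D: "?e \<in> {..<m} \<rightarrow> carrier (\<O> X D)" using eD unit by (auto simp: Pi_iff)
      have lD: "(\<lambda>j. res X W D (l j i)) \<in> {..<m} \<rightarrow> carrier (\<O> X D)" if "i < n" for i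
        using lW[OF _ that] res_closed[OF W(1) D(1) sub(2)] by auto
      have comp: "res X V D (t i) = (\<Oplus>\<^bsub>\<O> X D\<^esub>j\<in>{..<m}. ?e j \<otimes>\<^bsub>\<O> X D\<^esub> res X W D (l j i))" if i: "i < n" for i
      proof (rule Dr.divide_unit_finsum[OF unit tD[OF i] eD lD[OF i]])
        have el: "(\<lambda>j. e j \<otimes>\<^bsub>\<O> X W\<^esub> l j i) \<in> {..<m} \<rightarrow> carrier (\<O> X W)" using e lW[OF _ i] by (auto simp: Pi_iff)
        have "res X W D u \<otimes>\<^bsub>\<O> X D\<^esub> res X V D (t i) = res X W D (\<Oplus>\<^bsub>\<O> X W\<^esub>j\<in>{..<m}. e j \<otimes>\<^bsub>\<O> X W\<^esub> l j i)"
          using eq ae i by simp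
        also have "\<dots> = (\<Oplus>\<^bsub>\<O> X D\<^esub>j\<in>{..<m}. res X W D (e j \<otimes>\<^bsub>\<O> X W\<^esub> l j i))"
          by (rule res_finsum[OF W(1) D(1) sub(2) el])
        also have "\<dots> = (\<Oplus>\<^bsub>\<O> X D\<^esub>j\<in>{..<m}. res X W D (e j) \<otimes>\<^bsub>\<O> X D\<^esub> res X W D (l j i))"
          by (rule Dr.finsum_cong') (use e lW[OF _ i] res_mult[OF W(1) D(1) sub(2)] eD lD[OF i] in \<open>auto simp: Pi_iff\<close>)
        finally show "res X W D u \<otimes>\<^bsub>\<O> X D\<^esub> res X V D (t i) =
            (\<Oplus>\<^bsub>\<O> X D\<^esub>j\<in>{..<m}. res X W D (e j) \<otimes>\<^bsub>\<O> X D\<^esub> res X W D (l j i))" .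
      qed
      interpret KD: module "\<O> X D" "sec ?K D" by (rule K_module[OF D(1) sub(1)])
      have hD: "mres ?K ?U D (h j) = (\<lambda>i\<in>{..<n}. res X W D (l j i))" if j: "j < m" for j
        unfolding K_res h_def
        by (rule restrict_ext) (use res_res[OF W(1) U'(1) D(1) sub(3) U'(3) lW[OF j]] in auto)
      \<comment> \<open>The restricted generators have to be relations over D, because sums in the
        module of sections over D are governed by its carrier.\<close>
      have hDc: "mres ?K ?U D (h j) \<in> carrier (sec ?K D)" if j: "j < m" for j
      proof -
        have lS: "l j \<in> S W ?U" using l j by auto
        let ?f = "\<lambda>i. res X W ?U (l j i) \<otimes>\<^bsub>\<O> X ?U\<^esub> res X U ?U (\<gamma> i)"
        have fc: "?f \<in> {..<n} \<rightarrow> carrier (\<O> X ?U)"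
          using \<gamma>V[OF U'(1,2)] res_closed[OF W(1) U'(1,3)] lW[OF j] by (auto simp: Pi_iff)
        have "\<zero>\<^bsub>\<O> X D\<^esub> = res X ?U D (\<Oplus>\<^bsub>\<O> X ?U\<^esub>i\<in>{..<n}. ?f i)"
          using lS res_zero[OF U'(1) D(1) sub(3)] by (simp add: S_def)
        also have "\<dots> = (\<Oplus>\<^bsub>\<O> X D\<^esub>i\<in>{..<n}. res X ?U D (?f i))" by (rule res_finsum[OF U'(1) D(1) sub(3) fc])
        also have "\<dots> = (\<Oplus>\<^bsub>\<O> X D\<^esub>i\<in>{..<n}. res X D D ((\<lambda>i\<in>{..<n}. res X W D (l j i)) i) \<otimes>\<^bsub>\<O> X D\<^esub> res X U D (\<gamma> i))"
        proof (rule Dr.finsum_cong')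
          fix i assume "i \<in> {..<n}"
          then have i: "i < n" by simp
          have "res X W D (l j i) \<in> carrier (\<O> X D)" using lD[OF i] j by auto
          then show "res X ?U D (?f i) = res X D D ((\<lambda>i\<in>{..<n}. res X W D (l j i)) i) \<otimes>\<^bsub>\<O> X D\<^esub> res X U D (\<gamma> i)"
            using res_mult[OF U'(1) D(1) sub(3) res_closed[OF W(1) U'(1,3) lW[OF j i]] res_closed[OF U U'(1,2) \<gamma>c[OF i]]]
              res_res[OF W(1) U'(1) D(1) sub(3) U'(3) lW[OF j i]] res_res[OF U U'(1) D(1) sub(3) U'(2) \<gamma>c[OF i]]
              res_id[OF D(1)] i by simp
        next
          show "(\<lambda>i. res X D D ((\<lambda>i\<in>{..<n}. res X W D (l j i)) i) \<otimes>\<^bsub>\<O> X D\<^esub> res X U D (\<gamma> i)) \<in> {..<n} \<rightarrow> carrier (\<O> X D)"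
            using lD j \<gamma>D res_id[OF D(1)] by (auto simp: Pi_iff)
        qed simp
        finally show ?thesis unfolding K_carrier[OF D(1) sub(1)] hD[OF j] S_def using lD j by (auto simp: Pi_iff)
      qed
      let ?k = "\<lambda>j. ?e j \<odot>\<^bsub>sec ?K D\<^esub> mres ?K ?U D (h j)"
      have kc: "?k \<in> {..<m} \<rightarrow> carrier (sec ?K D)" using e'D hDc KD.smult_closed by (auto simp: Pi_iff)
      \<comment> \<open>Sections of the relation sheaf are tuples, so the equation is checked
        coordinate by coordinate.\<close>
      have "mres ?K V D t = (\<Oplus>\<^bsub>sec ?K D\<^esub>j\<in>{..<m}. ?k j)"
      proof (rule Dr.power_module_eqI[of _ n])
        show "mres ?K V D t \<in> {..<n} \<rightarrow>\<^sub>E carrier (\<O> X D)" unfolding K_res using tD by auto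
        show "(\<Oplus>\<^bsub>sec ?K D\<^esub>j\<in>{..<m}. ?k j) \<in> {..<n} \<rightarrow>\<^sub>E carrier (\<O> X D)"
          using KD.finsum_closed[OF kc] unfolding K_carrier[OF D(1) sub(1)] S_def by blast
        fix i assume i: "i < n"
        have "(\<Oplus>\<^bsub>sec ?K D\<^esub>j\<in>{..<m}. ?k j) i = (\<Oplus>\<^bsub>\<O> X D\<^esub>j\<in>{..<m}. ?k j i)"
          by (rule finsum_hom_lessThan[OF KD.M.abelian_monoid_axioms O_abelian_monoid[OF D(1)] _ _ _ kc, of "\<lambda>x. x i"])
             (use i in \<open>auto simp: K_add K_zero K_carrier[OF D(1) sub(1)] S_def\<close>)
        also have "\<dots> = (\<Oplus>\<^bsub>\<O> X D\<^esub>j\<in>{..<m}. ?e j \<otimes>\<^bsub>\<O> X D\<^esub> res X W D (l j i))"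
          by (rule Dr.finsum_cong') (use hD i lD[OF i] e'D in \<open>auto simp: K_smult Pi_iff\<close>)
        finally show "mres ?K V D t i = (\<Oplus>\<^bsub>sec ?K D\<^esub>j\<in>{..<m}. ?k j) i"
          using comp[OF i] i by (simp add: K_res)
      qed
      then show ?thesis using D sub e'D by (intro exI[of _ D] exI[of _ ?e] conjI)
    qed
    have A: "h \<in> {..<m} \<rightarrow> carrier (sec ?K ?U)" using hS K_carrier[OF U'(1,2)] by auto
    have B: "\<forall>V s. opn X V \<and> V \<subseteq> U \<longrightarrow> V \<subseteq> ?U \<longrightarrow> s \<in> carrier (sec ?K V) \<longrightarrow> (\<forall>y\<in>V.
      \<exists>D e. (opn X D \<and> D \<subseteq> U) \<and> y \<in> D \<and> D \<subseteq> V \<and> e \<in> {..<m} \<rightarrow> carrier (\<O> X D) \<and>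
        mres ?K V D s = (\<Oplus>\<^bsub>sec ?K D\<^esub>j\<in>{..<m}. e j \<odot>\<^bsub>sec ?K D\<^esub> mres ?K ?U D (h j)))"
      by (intro allI impI ballI, rule main)
    show "\<exists>U' (n'::nat) g'. (opn X U' \<and> U' \<subseteq> U) \<and> x \<in> U' \<and> g' \<in> {..<n'} \<rightarrow> carrier (sec ?K U') \<and>
       (\<forall>V s. opn X V \<and> V \<subseteq> U \<longrightarrow> V \<subseteq> U' \<longrightarrow> s \<in> carrier (sec ?K V) \<longrightarrow>
          (\<forall>y\<in>V. \<exists>W a. (opn X W \<and> W \<subseteq> U) \<and> y \<in> W \<and> W \<subseteq> V \<and> a \<in> {..<n'} \<rightarrow> carrier (\<O> X W) \<and>
             mres ?K V W s = (\<Oplus>\<^bsub>sec ?K W\<^esub>i\<in>{..<n'}. a i \<odot>\<^bsub>sec ?K W\<^esub> mres ?K U' W (g' i))))"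
      by (rule exI[of _ ?U], rule exI[of _ m], rule exI[of _ h], intro conjI U' A B)
  qed
qed

section \<open>The dual and the bidual of an ideal sheaf\<close>

definition incl :: "'x set \<Rightarrow> 'x set \<Rightarrow> 'm \<Rightarrow> 'r" where
  "incl U = hom_ext (open_subspace X U) JM (\<lambda>V x. inv_into UNIV \<epsilon> x)"

lemma incl_closed: "opn X U \<Longrightarrow> incl U \<in> carrier (sec (dual X JM) U)"
  unfolding incl_def dual_simps
  by (rule sheaf_hom_hom_extI[OF _ JM.module_closed]) (auto simp: J_carrier)

lemma incl_apply: "opn X U \<Longrightarrow> opn X V \<Longrightarrow> V \<subseteq> U \<Longrightarrow> a \<in> J V \<Longrightarrow> incl U V (\<epsilon> a) = a"
  unfolding incl_def by (subst hom_ext_apply_sub) auto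

lemma incl_res:
  assumes "opn X U" "opn X V" "V \<subseteq> U"
  shows "mres (dual X JM) U V (incl U) = incl V"
  unfolding dual_simps incl_def
  by (rule hom_ext_eqI[OF assms(2)]) (use assms in \<open>auto simp: hom_ext_apply_sub\<close>)

text \<open>Where J is the whole structure sheaf, a functional is determined by its value at 1. The
  dual is then free of rank one, with the inclusion of J as basis.\<close>

lemma dual_multiple_incl:
  assumes N: "opn X N" and triv: "\<And>V. opn X V \<Longrightarrow> V \<subseteq> N \<Longrightarrow> J V = carrier (\<O> X V)"
    and h: "h \<in> carrier (sec (dual X JM) N)"
  shows "h = h N (\<epsilon> \<one>\<^bsub>\<O> X N\<^esub>) \<odot>\<^bsub>sec (dual X JM) N\<^esub> incl N"
proof (rule sheaf_hom_eqI[OF N h[unfolded dual_simps]])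
  note h' = h[unfolded dual_simps]
  have 1: "\<epsilon> \<one>\<^bsub>\<O> X N\<^esub> \<in> carrier (sec JM N)" using triv[OF N order_refl] O_one_closed[OF N] by simp
  have c: "h N (\<epsilon> \<one>\<^bsub>\<O> X N\<^esub>) \<in> carrier (\<O> X N)" by (rule dual_closed[OF h' N N order_refl 1])
  show "h N (\<epsilon> \<one>\<^bsub>\<O> X N\<^esub>) \<odot>\<^bsub>sec (dual X JM) N\<^esub> incl N \<in> sheaf_hom (open_subspace X N) JM (structure_module X)"
    using module_closedD(2)[OF module_closed_dual[OF JM.module_closed] N incl_closed[OF N] c]
    unfolding dual_simps(1) .
  fix V x assume V: "opn X V" "V \<subseteq> N" and x: "x \<in> carrier (sec JM V)"
  interpret V: cring "\<O> X V" by (rule O_cring[OF V(1)])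
  obtain b where b: "b \<in> J V" "x = \<epsilon> b" using x by auto
  have bV: "b \<in> carrier (\<O> X V)" by (rule J_carrier[OF V(1) b(1)])
  have 1: "\<epsilon> \<one>\<^bsub>\<O> X V\<^esub> \<in> carrier (sec JM V)" using triv[OF V] by simp
  have "h V x = h V (b \<odot>\<^bsub>sec JM V\<^esub> \<epsilon> \<one>\<^bsub>\<O> X V\<^esub>)" using b bV by simp
  also have "\<dots> = b \<otimes>\<^bsub>\<O> X V\<^esub> h V (\<epsilon> \<one>\<^bsub>\<O> X V\<^esub>)" by (rule dual_smult[OF h' N V bV 1])
  also have "h V (\<epsilon> \<one>\<^bsub>\<O> X V\<^esub>) = res X N V (h N (\<epsilon> \<one>\<^bsub>\<O> X N\<^esub>))"
    using dual_res[OF h' N N order_refl V \<open>\<epsilon> \<one>\<^bsub>\<O> X N\<^esub> \<in> carrier (sec JM N)\<close>] res_one[OF N V] by simp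
  also have "b \<otimes>\<^bsub>\<O> X V\<^esub> res X N V (h N (\<epsilon> \<one>\<^bsub>\<O> X N\<^esub>)) = res X N V (h N (\<epsilon> \<one>\<^bsub>\<O> X N\<^esub>)) \<otimes>\<^bsub>\<O> X V\<^esub> incl N V x"
    using incl_apply[OF N V b(1)] b(2) V.m_comm[OF bV res_closed[OF N V c]] by simp
  also have "\<dots> = (h N (\<epsilon> \<one>\<^bsub>\<O> X N\<^esub>) \<odot>\<^bsub>sec (dual X JM) N\<^esub> incl N) V x"
    unfolding dual_simps(3) hom_ext_apply_sub[OF N V x] ..
  finally show "h V x = (h N (\<epsilon> \<one>\<^bsub>\<O> X N\<^esub>) \<odot>\<^bsub>sec (dual X JM) N\<^esub> incl N) V x" .
qed

text \<open>By linearity \<phi> over N is determined by its value on the basis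
  \<open>incl N\<close>, and that value is the restriction of a function on the larger set U, where
  J may be nontrivial.\<close>

lemma bidual_on_trivial:
  assumes N: "opn X N" and triv: "\<And>V. opn X V \<Longrightarrow> V \<subseteq> N \<Longrightarrow> J V = carrier (\<O> X V)"
    and U: "opn X U" "N \<subseteq> U" and \<phi>: "\<phi> \<in> carrier (sec (dual X (dual X JM)) U)"
    and h: "h \<in> carrier (sec (dual X JM) N)"
  shows "\<phi> N h = h N (\<epsilon> \<one>\<^bsub>\<O> X N\<^esub>) \<otimes>\<^bsub>\<O> X N\<^esub> res X U N (\<phi> U (incl U))"
proof -
  note h' = h[unfolded dual_simps] and \<phi>' = \<phi>[unfolded dual_simps(1)[of X "dual X JM"]]
  have 1: "\<epsilon> \<one>\<^bsub>\<O> X N\<^esub> \<in> carrier (sec JM N)" using triv[OF N order_refl] O_one_closed[OF N] by simp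
  have c: "h N (\<epsilon> \<one>\<^bsub>\<O> X N\<^esub>) \<in> carrier (\<O> X N)" by (rule dual_closed[OF h' N N order_refl 1])
  have "\<phi> N h = \<phi> N (h N (\<epsilon> \<one>\<^bsub>\<O> X N\<^esub>) \<odot>\<^bsub>sec (dual X JM) N\<^esub> incl N)"
    using dual_multiple_incl[OF N triv h] by simp
  also have "\<dots> = h N (\<epsilon> \<one>\<^bsub>\<O> X N\<^esub>) \<otimes>\<^bsub>\<O> X N\<^esub> \<phi> N (incl N)"
    by (rule dual_smult[OF \<phi>' U(1) N U(2) c incl_closed[OF N]])
  also have "\<phi> N (incl N) = res X U N (\<phi> U (incl U))"
    using dual_res[OF \<phi>' U(1) U(1) order_refl N U(2) incl_closed[OF U(1)]] incl_res[OF U(1) N U(2)] by simp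
  finally show ?thesis .
qed

text \<open>Since \<open>J\<close> is trivial over \<open>U0\<close> and restrictions are injective, an element of the bidual is
  determined by its value on the inclusion of \<open>J\<close> in the structure sheaf.\<close>

lemma JM_reflexive:
  assumes U0: "opn X U0" "U0 \<noteq> {}" and triv: "\<And>V. opn X V \<Longrightarrow> V \<subseteq> U0 \<Longrightarrow> J V = carrier (\<O> X V)"
    and bidual: "\<And>U \<phi>. opn X U \<Longrightarrow> \<phi> \<in> carrier (sec (dual X (dual X JM)) U) \<Longrightarrow> \<phi> U (incl U) \<in> J U"
    and ft: "finite_type_sheaf X JM"
  shows "reflexive_sheaf X JM"
proof -
  have coh: "coherent_sheaf X JM"
    unfolding coherent_sheaf_def by (intro conjI allI impI JM_sheaf_of_modules ft JM_relations)
  have "bij_betw (to_bidual X JM U) (carrier (sec JM U)) (carrier (sec (dual X (dual X JM)) U))"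
    if U: "opn X U" for U
  proof (rule bij_betw_imageI)
    \<comment> \<open>Evaluation at the inclusion is a left inverse of \<open>to_bidual\<close>.
      This gives injectivity and singles out the only possible preimage for surjectivity.\<close>
    have ev: "to_bidual X JM U (\<epsilon> a) U (incl U) = a" if a: "a \<in> J U" for a
    proof -
      have "to_bidual X JM U (\<epsilon> a) U (incl U) = incl U U (mres JM U U (\<epsilon> a))"
        by (rule to_bidual_apply[OF U _ U order_refl incl_closed[OF U]]) (use a in auto)
      then show ?thesis using incl_apply[OF U U order_refl a] res_id[OF U J_carrier[OF U a]] by simp
    qed
    show "inj_on (to_bidual X JM U) (carrier (sec JM U))"
    proof (rule inj_onI)
      fix x y assume "x \<in> carrier (sec JM U)" "y \<in> carrier (sec JM U)" and eq: "to_bidual X JM U x = to_bidual X JM U y"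
      then obtain a b where ab: "a \<in> J U" "x = \<epsilon> a" "b \<in> J U" "y = \<epsilon> b" by auto
      have "a = to_bidual X JM U x U (incl U)" unfolding ab(2) by (rule ev[OF ab(1), symmetric])
      also have "\<dots> = b" unfolding eq ab(4) by (rule ev[OF ab(3)])
      finally show "x = y" unfolding ab(2,4) by (rule arg_cong)
    qed
    show "to_bidual X JM U ` carrier (sec JM U) = carrier (sec (dual X (dual X JM)) U)"
    proof
      show "to_bidual X JM U ` carrier (sec JM U) \<subseteq> carrier (sec (dual X (dual X JM)) U)"
        using JM.to_bidual_closed[OF U] by blast
      show "carrier (sec (dual X (dual X JM)) U) \<subseteq> to_bidual X JM U ` carrier (sec JM U)"
      proof
        fix \<phi> assume \<phi>: "\<phi> \<in> carrier (sec (dual X (dual X JM)) U)"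
        note \<phi>' = \<phi>[unfolded dual_simps(1)[of X "dual X JM"]]
        let ?a = "\<phi> U (incl U)"
        have a: "?a \<in> J U" by (rule bidual[OF U \<phi>])
        have aO: "?a \<in> carrier (\<O> X U)" by (rule J_carrier[OF U a])
        have sa: "\<epsilon> ?a \<in> carrier (sec JM U)" using a by simp
        have "\<phi> = to_bidual X JM U (\<epsilon> ?a)"
        proof (rule JM.bidual_eqI[OF U \<phi> JM.to_bidual_closed[OF U sa]])
          fix V h assume V: "opn X V" "V \<subseteq> U" and h: "h \<in> carrier (sec (dual X JM) V)"
          note h' = h[unfolded dual_simps]
          let ?r = "res X U V ?a"
          have r: "\<epsilon> ?r \<in> carrier (sec JM V)" using J_res[OF U V a] by simp
          have c1: "\<phi> V h \<in> carrier (\<O> X V)" by (rule dual_closed[OF \<phi>' U V h])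
          have c2: "h V (\<epsilon> ?r) \<in> carrier (\<O> X V)" by (rule dual_closed[OF h' V(1) V(1) order_refl r])
          have "\<phi> V h = h V (\<epsilon> ?r)"
          proof (cases "V = {}")
            case True
            then show ?thesis using O_empty c1 c2 by auto
          next
            case False
            \<comment> \<open>Over N both values equal h at 1 times the restriction of \<phi> at the
              inclusion: on the left by \<open>bidual_on_trivial\<close>, on the right by linearity
              of h.\<close>
            let ?N = "V \<inter> U0"
            have N: "opn X ?N" "?N \<subseteq> V" "?N \<subseteq> U" "?N \<subseteq> U0" "?N \<noteq> {}"
              using V U0 irreducible[OF V(1) U0(1) False U0(2)] by auto
            have trivN: "J W = carrier (\<O> X W)" if "opn X W" "W \<subseteq> ?N" for W using triv that by auto
            let ?h = "mres (dual X JM) V ?N h"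
            have hN: "?h \<in> carrier (sec (dual X JM) ?N)"
              by (rule module_closedD(3)[OF module_closed_dual[OF JM.module_closed] V(1) h N(1,2)])
            have 1: "\<epsilon> \<one>\<^bsub>\<O> X ?N\<^esub> \<in> carrier (sec JM ?N)"
              using trivN[OF N(1) order_refl] O_one_closed[OF N(1)] by simp
            have aN: "res X U ?N ?a \<in> carrier (\<O> X ?N)" by (rule res_closed[OF U N(1,3) aO])
            have h1: "?h ?N (\<epsilon> \<one>\<^bsub>\<O> X ?N\<^esub>) = h ?N (\<epsilon> \<one>\<^bsub>\<O> X ?N\<^esub>)"
              unfolding dual_simps(4) by (rule hom_ext_apply_sub[OF N(1) N(1) order_refl 1])
            have h1c: "h ?N (\<epsilon> \<one>\<^bsub>\<O> X ?N\<^esub>) \<in> carrier (\<O> X ?N)" by (rule dual_closed[OF h' V(1) N(1,2) 1])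
            interpret Nr: cring "\<O> X ?N" by (rule O_cring[OF N(1)])
            have "res X V ?N (\<phi> V h) = \<phi> ?N ?h"
              by (rule dual_res[OF \<phi>' U V N(1,2) h, symmetric])
            also have "\<dots> = h ?N (\<epsilon> \<one>\<^bsub>\<O> X ?N\<^esub>) \<otimes>\<^bsub>\<O> X ?N\<^esub> res X U ?N ?a"
              unfolding h1[symmetric] by (rule bidual_on_trivial[OF N(1) _ U N(3) \<phi> hN]) (rule trivN)
            also have "\<dots> = res X U ?N ?a \<otimes>\<^bsub>\<O> X ?N\<^esub> h ?N (\<epsilon> \<one>\<^bsub>\<O> X ?N\<^esub>)" by (rule Nr.m_comm[OF h1c aN])
            also have "\<dots> = h ?N (res X U ?N ?a \<odot>\<^bsub>sec JM ?N\<^esub> \<epsilon> \<one>\<^bsub>\<O> X ?N\<^esub>)"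
              by (rule dual_smult[OF h' V(1) N(1,2) aN 1, symmetric])
            also have "res X U ?N ?a \<odot>\<^bsub>sec JM ?N\<^esub> \<epsilon> \<one>\<^bsub>\<O> X ?N\<^esub> = mres JM V ?N (\<epsilon> ?r)"
              using aN res_res[OF U V(1) N(1,2) V(2) aO] by simp
            also have "h ?N (mres JM V ?N (\<epsilon> ?r)) = res X V ?N (h V (\<epsilon> ?r))"
              by (rule dual_res[OF h' V(1) V(1) order_refl N(1,2) r])
            finally show ?thesis by (rule res_inj[OF V(1) N(1,2,5) c1 c2])
          qed
          then show "\<phi> V h = to_bidual X JM U (\<epsilon> ?a) V h"
            using to_bidual_apply[OF U sa V h] by simp
        qed
        then show "\<phi> \<in> to_bidual X JM U ` carrier (sec JM U)" using sa by blast
      qed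
    qed
  qed
  then have "to_bidual X JM \<in> sheaf_iso X JM (dual X (dual X JM))"
    unfolding sheaf_iso_def using JM.to_bidual_hom by simp
  then show ?thesis unfolding reflexive_sheaf_def using coh by simp
qed

end

context noetherian_ringed
begin

lemma ideal_sheaf_structure:
  assumes "inj \<epsilon>"
  shows "ideal_sheaf X \<epsilon> (\<lambda>U. carrier (\<O> X U))"
proof (intro ideal_sheaf.intro ideal_sheaf_axioms.intro)
  show "noetherian_ringed X" by (rule noetherian_ringed_axioms)
  show "ideal (carrier (\<O> X U)) (\<O> X U)" if "opn X U" for U
    by (rule ring.oneideal[OF cring.axioms(1)[OF O_cring[OF that]]])
  show "res X U V a \<in> carrier (\<O> X V)"
    if "opn X U" "opn X V" "V \<subseteq> U" "a \<in> carrier (\<O> X U)" for U V a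
    by (rule res_closed[OF that])
qed (use assms in simp_all)

text \<open>The case J = \<open>\<O>\<close>: the ideal is trivial over the whole space, the
  condition on the bidual says only that values are functions, and 1 is a single generator.\<close>

lemma structure_copy_reflexive:
  assumes \<epsilon>: "inj \<epsilon>" and ne: "pts X \<noteq> {}"
  shows "reflexive_sheaf X (ideal_module X \<epsilon> (\<lambda>U. carrier (\<O> X U)))"
proof -
  interpret S: ideal_sheaf X \<epsilon> "\<lambda>U. carrier (\<O> X U)" by (rule ideal_sheaf_structure[OF \<epsilon>])
  show ?thesis
  proof (rule S.JM_reflexive[OF opn_pts ne refl])
    show "\<phi> U (S.incl U) \<in> carrier (\<O> X U)"
      if "opn X U" "\<phi> \<in> carrier (sec (dual X (dual X S.JM)) U)" for U \<phi>
      by (rule dual_closed[OF that(2)[unfolded dual_simps(1)[of X "dual X S.JM"]] that(1,1) order_refl S.incl_closed[OF that(1)]])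
    show "finite_type_sheaf X S.JM"
    proof (rule S.JM_finite_type)
      fix x assume x: "x \<in> pts X"
      have "\<exists>D e. opn X D \<and> y \<in> D \<and> D \<subseteq> V \<and> e \<in> {..<1::nat} \<rightarrow> carrier (\<O> X D) \<and>
        res X V D b = (\<Oplus>\<^bsub>\<O> X D\<^esub>j\<in>{..<1}. e j \<otimes>\<^bsub>\<O> X D\<^esub> res X (pts X) D \<one>\<^bsub>\<O> X (pts X)\<^esub>)"
        if V: "opn X V" "V \<subseteq> pts X" "y \<in> V" "b \<in> carrier (\<O> X V)" for V y b
      proof -
        interpret V: cring "\<O> X V" by (rule O_cring[OF V(1)])
        show ?thesis
          using V res_one[OF opn_pts V(1,2)] res_id[OF V(1)]
          by (intro exI[of _ V] exI[of _ "\<lambda>j. b"]) (simp add: lessThan_Suc)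
      qed
      then show "\<exists>N (m::nat) l. opn X N \<and> x \<in> N \<and> l \<in> {..<m} \<rightarrow> carrier (\<O> X N) \<and>
        (\<forall>V y b. opn X V \<longrightarrow> V \<subseteq> N \<longrightarrow> y \<in> V \<longrightarrow> b \<in> carrier (\<O> X V) \<longrightarrow>
          (\<exists>D e. opn X D \<and> y \<in> D \<and> D \<subseteq> V \<and> e \<in> {..<m} \<rightarrow> carrier (\<O> X D) \<and>
            res X V D b = (\<Oplus>\<^bsub>\<O> X D\<^esub>j\<in>{..<m}. e j \<otimes>\<^bsub>\<O> X D\<^esub> res X N D (l j))))"
        using x O_one_closed[OF opn_pts]
        by - (rule exI[of _ "pts X"], rule exI[of _ 1], rule exI[of _ "\<lambda>j. \<one>\<^bsub>\<O> X (pts X)\<^esub>"],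
          intro conjI allI impI, simp_all only: opn_pts, auto)
    qed
  qed
qed

end

section \<open>The conductor of a section\<close>

text \<open>U and s stay fixed throughout the construction. The values of \<epsilon> have a type of
  their own; it is identified with that of the sections of F only where both sheaves have to be
  objects of one category.\<close>

locale reflexive_section = noetherian_ringed X for X :: "('x, 'r) ringed_space" +
  fixes F :: "('x, 'r, 'm) mod_sheaf" and \<epsilon> :: "'r \<Rightarrow> 'n" and U :: "'x set" and s :: 'm
  assumes inj: "inj \<epsilon>" and reflexive: "reflexive_sheaf X F"
    and U: "opn X U" "U \<noteq> {}" and s: "s \<in> carrier (sec F U)"

sublocale reflexive_section \<subseteq> sheaf_module X F
  by unfold_locales (use reflexive in \<open>simp add: reflexive_sheaf_def coherent_sheaf_def\<close>)

context reflexive_section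
begin

lemma bidual_bij:
  "opn X V \<Longrightarrow> bij_betw (to_bidual X F V) (carrier (sec F V)) (carrier (sec (dual X (dual X F)) V))"
  using reflexive by (simp add: reflexive_sheaf_def sheaf_iso_def)

text \<open>Sections of F embed in the bidual, where they act on functionals over smaller open sets
  Z. The values are functions on Z, and a function on a nonempty Z is determined by its restriction
  to V \<inter> Z.\<close>

lemma sec_inj:
  assumes W: "opn X W" and V: "opn X V" "V \<subseteq> W" "V \<noteq> {}"
    and f: "f \<in> carrier (sec F W)" "f' \<in> carrier (sec F W)" and eq: "mres F W V f = mres F W V f'"
  shows "f = f'"
proof -
  have "to_bidual X F W f = to_bidual X F W f'"
  proof (rule bidual_eqI[OF W to_bidual_closed[OF W f(1)] to_bidual_closed[OF W f(2)]])
    fix Z h assume Z: "opn X Z" "Z \<subseteq> W" and h: "h \<in> carrier (sec (dual X F) Z)"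
    note h' = h[unfolded dual_simps]
    note fZ = mres_closed[OF W Z f(1)] mres_closed[OF W Z f(2)]
    note c = dual_closed[OF h' Z(1) Z(1) order_refl fZ(1)] dual_closed[OF h' Z(1) Z(1) order_refl fZ(2)]
    have "h Z (mres F W Z f) = h Z (mres F W Z f')"
    proof (cases "Z = {}")
      case True
      then show ?thesis using O_empty c by auto
    next
      case False
      let ?N = "V \<inter> Z"
      have N: "opn X ?N" "?N \<subseteq> Z" "?N \<subseteq> V" "?N \<noteq> {}"
        using V Z irreducible[OF V(1) Z(1) V(3) False] by auto
      have "res X Z ?N (h Z (mres F W Z f)) = h ?N (mres F Z ?N (mres F W Z f))"
        by (rule dual_res[OF h' Z(1) Z(1) order_refl N(1,2) fZ(1), symmetric])
      also have "mres F Z ?N (mres F W Z f) = mres F V ?N (mres F W V f)"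
        unfolding mres_mres[OF W Z(1) N(1,2) Z(2) f(1)] mres_mres[OF W V(1) N(1,3) V(2) f(1)] ..
      also have "\<dots> = mres F Z ?N (mres F W Z f')"
        unfolding eq mres_mres[OF W Z(1) N(1,2) Z(2) f(2)] mres_mres[OF W V(1) N(1,3) V(2) f(2)] ..
      also have "h ?N (mres F Z ?N (mres F W Z f')) = res X Z ?N (h Z (mres F W Z f'))"
        by (rule dual_res[OF h' Z(1) Z(1) order_refl N(1,2) fZ(2)])
      finally show ?thesis by (rule res_inj[OF Z(1) N(1,2,4) c])
    qed
    then show "to_bidual X F W f Z h = to_bidual X F W f' Z h"
      unfolding to_bidual_apply[OF W f(1) Z h] to_bidual_apply[OF W f(2) Z h] .
  qed
  then show ?thesis by (rule inj_onD[OF bij_betw_imp_inj_on[OF bidual_bij[OF W]] _ f])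
qed

text \<open>The pairs (b, f) are the sections over V of the kernel in the overview: the target is
  the direct image of F restricted to U, and the homomorphism sends (b, f) to b s - f over U
  \<inter> V.\<close>

definition lifts :: "'x set \<Rightarrow> 'r \<Rightarrow> 'm \<Rightarrow> bool" where
  "lifts V b f \<longleftrightarrow> f \<in> carrier (sec F V) \<and>
     mres F V (U \<inter> V) f = res X V (U \<inter> V) b \<odot>\<^bsub>sec F (U \<inter> V)\<^esub> mres F U (U \<inter> V) s"

definition conductor :: "'x set \<Rightarrow> 'r set" where
  "conductor V = {b \<in> carrier (\<O> X V). \<exists>f. lifts V b f}"

lemma conductorI: "b \<in> carrier (\<O> X V) \<Longrightarrow> lifts V b f \<Longrightarrow> b \<in> conductor V"
  unfolding conductor_def by blast

lemma conductorE:
  assumes "b \<in> conductor V"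
  obtains f where "b \<in> carrier (\<O> X V)" "lifts V b f"
  using assms unfolding conductor_def by blast

lemma open_Int_U: "opn X V \<Longrightarrow> opn X (U \<inter> V)"
  using U(1) by auto

lemma s_res: "opn X V \<Longrightarrow> V \<subseteq> U \<Longrightarrow> mres F U V s \<in> carrier (sec F V)"
  by (rule mres_closed[OF U(1) _ _ s])

lemma lifts_carrier: "lifts V b f \<Longrightarrow> f \<in> carrier (sec F V)"
  by (simp add: lifts_def)

text \<open>The projection from pairs (b, f) to b is injective, because U \<inter> V is nonempty for
  nonempty V and sections of F are determined there. This identifies the kernel with an
  ideal.\<close>

lemma lifts_unique:
  assumes V: "opn X V" and l: "lifts V b f" "lifts V b f'"
  shows "f = f'"
proof (cases "V = {}")
  case True
  have "f \<in> carrier (sec F {})" "f' \<in> carrier (sec F {})"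
    using lifts_carrier[OF l(1)] lifts_carrier[OF l(2)] unfolding True .
  then show ?thesis by (rule sec_empty)
next
  case False
  show ?thesis
  proof (rule sec_inj[OF V open_Int_U[OF V] Int_lower2])
    show "U \<inter> V \<noteq> {}" by (rule irreducible[OF U(1) V U(2) False])
    show "mres F V (U \<inter> V) f = mres F V (U \<inter> V) f'" using l unfolding lifts_def by simp
  qed (rule lifts_carrier[OF l(1)], rule lifts_carrier[OF l(2)])
qed

lemma lifts_zero: "opn X V \<Longrightarrow> lifts V \<zero>\<^bsub>\<O> X V\<^esub> \<zero>\<^bsub>sec F V\<^esub>"
  using res_zero[OF _ open_Int_U, of V] mres_zero[OF _ open_Int_U, of V] sec_zero_closed[of V]
    module.smult_l_null[OF sec_module[OF open_Int_U] s_res[OF open_Int_U], of V]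
  by (simp add: lifts_def)

lemma lifts_add:
  assumes V: "opn X V" and b: "b \<in> carrier (\<O> X V)" "b' \<in> carrier (\<O> X V)"
    and l: "lifts V b f" "lifts V b' f'"
  shows "lifts V (b \<oplus>\<^bsub>\<O> X V\<^esub> b') (f \<oplus>\<^bsub>sec F V\<^esub> f')"
proof -
  note V' = open_Int_U[OF V] Int_lower2[of U V]
  interpret M: module "\<O> X (U \<inter> V)" "sec F (U \<inter> V)" by (rule sec_module[OF V'(1)])
  show ?thesis
    using l sec_add_closed[OF V] mres_add[OF V V'] res_add[OF V V' b] res_closed[OF V V' b(1)]
      res_closed[OF V V' b(2)] s_res[OF V'(1) Int_lower1] by (simp add: lifts_def M.smult_l_distr)
qed

lemma lifts_smult:
  assumes V: "opn X V" and b: "b \<in> carrier (\<O> X V)" and c: "c \<in> carrier (\<O> X V)" and l: "lifts V b f"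
  shows "lifts V (c \<otimes>\<^bsub>\<O> X V\<^esub> b) (c \<odot>\<^bsub>sec F V\<^esub> f)"
proof -
  note V' = open_Int_U[OF V] Int_lower2[of U V]
  interpret M: module "\<O> X (U \<inter> V)" "sec F (U \<inter> V)" by (rule sec_module[OF V'(1)])
  show ?thesis
    using l sec_smult_closed[OF V c] mres_smult[OF V V' c] res_mult[OF V V' c b] res_closed[OF V V' b]
      res_closed[OF V V' c] s_res[OF V'(1) Int_lower1] by (simp add: lifts_def M.smult_assoc1)
qed

lemma lifts_res:
  assumes V: "opn X V" and W: "opn X W" "W \<subseteq> V" and b: "b \<in> carrier (\<O> X V)" and l: "lifts V b f"
  shows "lifts W (res X V W b) (mres F V W f)"
proof -
  have f: "f \<in> carrier (sec F V)" using l by (simp add: lifts_def)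
  note V' = open_Int_U[OF V] and W' = open_Int_U[OF W(1)]
  have sub: "U \<inter> W \<subseteq> W" "U \<inter> W \<subseteq> U \<inter> V" "U \<inter> V \<subseteq> V" "U \<inter> V \<subseteq> U" "U \<inter> W \<subseteq> V" using W by auto
  have "mres F W (U \<inter> W) (mres F V W f) = mres F (U \<inter> V) (U \<inter> W) (mres F V (U \<inter> V) f)"
    unfolding mres_mres[OF V W(1) W' sub(1) W(2) f] mres_mres[OF V V' W' sub(2,3) f] ..
  also have "\<dots> = mres F (U \<inter> V) (U \<inter> W) (res X V (U \<inter> V) b \<odot>\<^bsub>sec F (U \<inter> V)\<^esub> mres F U (U \<inter> V) s)"
    using l by (simp add: lifts_def)
  also have "\<dots> = res X V (U \<inter> W) b \<odot>\<^bsub>sec F (U \<inter> W)\<^esub> mres F U (U \<inter> W) s"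
    unfolding mres_smult[OF V' W' sub(2) res_closed[OF V V' sub(3) b] s_res[OF V' sub(4)]]
      res_res[OF V V' W' sub(2,3) b] mres_mres[OF U(1) V' W' sub(2,4) s] ..
  also have "res X V (U \<inter> W) b = res X W (U \<inter> W) (res X V W b)"
    by (rule res_res[OF V W(1) W' sub(1) W(2) b, symmetric])
  finally show ?thesis using mres_closed[OF V W f] by (simp add: lifts_def)
qed

text \<open>Local lifts agree on overlaps by uniqueness and therefore glue; that the result is a
  lift is again a local question.\<close>

lemma lifts_local:
  assumes V: "opn X V" and b: "b \<in> carrier (\<O> X V)"
    and loc: "\<And>x. x \<in> V \<Longrightarrow> \<exists>W f. opn X W \<and> x \<in> W \<and> W \<subseteq> V \<and> lifts W (res X V W b) f"
  shows "\<exists>f. lifts V b f"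
proof -
  \<comment> \<open>The cover consists of all open sets that admit a lift. Choosing one lift on each
    is harmless, since lifts are unique.\<close>
  let ?\<W> = "{W. opn X W \<and> W \<subseteq> V \<and> (\<exists>f. lifts W (res X V W b) f)}"
  define t where "t W = (SOME f. lifts W (res X V W b) f)" for W
  have t: "lifts W (res X V W b) (t W)" if "W \<in> ?\<W>" for W
    unfolding t_def by (rule someI_ex) (use that in blast)
  have un: "\<Union>?\<W> = V" using loc by blast
  have "\<exists>!f. f \<in> carrier (sec F (\<Union>?\<W>)) \<and> (\<forall>W\<in>?\<W>. mres F (\<Union>?\<W>) W f = t W)"
  proof (rule sheaf_glue[OF sec_sheaf])
    show "t W \<in> carrier (sec F W)" if "W \<in> ?\<W>" for W by (rule lifts_carrier[OF t[OF that]])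
    fix W W' assume W: "W \<in> ?\<W>" "W' \<in> ?\<W>"
    then have o: "opn X W" "W \<subseteq> V" "opn X W'" "W' \<subseteq> V" "opn X (W \<inter> W')" by auto
    have "lifts (W \<inter> W') (res X V (W \<inter> W') b) (mres F W (W \<inter> W') (t W))"
      using lifts_res[OF o(1,5) Int_lower1 res_closed[OF V o(1,2) b] t[OF W(1)]]
      unfolding res_res[OF V o(1,5) Int_lower1 o(2) b] .
    moreover have "lifts (W \<inter> W') (res X V (W \<inter> W') b) (mres F W' (W \<inter> W') (t W'))"
      using lifts_res[OF o(3,5) Int_lower2 res_closed[OF V o(3,4) b] t[OF W(2)]]
      unfolding res_res[OF V o(3,5) Int_lower2 o(4) b] .
    ultimately show "mres F W (W \<inter> W') (t W) = mres F W' (W \<inter> W') (t W')" by (rule lifts_unique[OF o(5)])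
  qed simp
  then have "\<exists>f. f \<in> carrier (sec F V) \<and> (\<forall>W\<in>?\<W>. mres F V W f = t W)"
    unfolding un by (rule ex1_implies_ex)
  then obtain f where f: "f \<in> carrier (sec F V)" "\<forall>W\<in>?\<W>. mres F V W f = t W" by (elim exE conjE) (rule that)
  note V' = open_Int_U[OF V] Int_lower2[of U V]
  have "mres F V (U \<inter> V) f = res X V (U \<inter> V) b \<odot>\<^bsub>sec F (U \<inter> V)\<^esub> mres F U (U \<inter> V) s" (is "?l = ?r")
  proof (rule sec_locality[OF V'(1) mres_closed[OF V V' f(1)]])
    have rb: "res X V (U \<inter> V) b \<in> carrier (\<O> X (U \<inter> V))" by (rule res_closed[OF V V' b])
    have ms: "mres F U (U \<inter> V) s \<in> carrier (sec F (U \<inter> V))" by (rule s_res[OF V'(1) Int_lower1])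
    show "?r \<in> carrier (sec F (U \<inter> V))" by (rule sec_smult_closed[OF V'(1) rb ms])
    fix x assume x: "x \<in> U \<inter> V"
    then have "x \<in> V" by simp
    from loc[OF this] obtain W where W: "W \<in> ?\<W>" "x \<in> W" by blast
    then have o: "opn X W" "W \<subseteq> V" by auto
    note W' = open_Int_U[OF o(1)]
    have sub: "U \<inter> W \<subseteq> W" "U \<inter> W \<subseteq> U \<inter> V" "U \<inter> W \<subseteq> V" "U \<inter> W \<subseteq> U" using o by auto
    have "mres F (U \<inter> V) (U \<inter> W) ?l = mres F W (U \<inter> W) (mres F V W f)"
      unfolding mres_mres[OF V V'(1) W' sub(2) V'(2) f(1)] mres_mres[OF V o(1) W' sub(1) o(2) f(1)] ..
    also have "mres F V W f = t W" using f(2) W(1) by blast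
    also have "mres F W (U \<inter> W) (t W) = res X W (U \<inter> W) (res X V W b) \<odot>\<^bsub>sec F (U \<inter> W)\<^esub> mres F U (U \<inter> W) s"
      using t[OF W(1)] by (simp add: lifts_def)
    also have "\<dots> = mres F (U \<inter> V) (U \<inter> W) ?r"
      unfolding mres_smult[OF V'(1) W' sub(2) rb ms] res_res[OF V V'(1) W' sub(2) V'(2) b]
        res_res[OF V o(1) W' sub(1) o(2) b] mres_mres[OF U(1) V'(1) W' sub(2) Int_lower1 s] ..
    finally show "\<exists>W. opn X W \<and> x \<in> W \<and> W \<subseteq> U \<inter> V \<and> mres F (U \<inter> V) W ?l = mres F (U \<inter> V) W ?r"
      using W' sub(2) W(2) x by (intro exI[of _ "U \<inter> W"] conjI) auto
  qed
  then show ?thesis using f(1) by (auto simp: lifts_def)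
qed

lemma conductor_ideal:
  assumes V: "opn X V"
  shows "ideal (conductor V) (\<O> X V)"
proof -
  interpret V: cring "\<O> X V" by (rule O_cring[OF V])
  have l: "c \<otimes>\<^bsub>\<O> X V\<^esub> b \<in> conductor V" if "b \<in> conductor V" "c \<in> carrier (\<O> X V)" for b c
    using that lifts_smult[OF V] by (auto simp: conductor_def)
  show ?thesis
  proof (rule idealI[OF V.ring_axioms])
    show "c \<otimes>\<^bsub>\<O> X V\<^esub> b \<in> conductor V" "b \<otimes>\<^bsub>\<O> X V\<^esub> c \<in> conductor V"
      if "b \<in> conductor V" "c \<in> carrier (\<O> X V)" for b c
      using l[OF that] V.m_comm[of b c] that by (auto simp: conductor_def)
    show "subgroup (conductor V) (add_monoid (\<O> X V))"
    proof (rule V.add.subgroupI)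
      show "conductor V \<subseteq> carrier (\<O> X V)" by (auto simp: conductor_def)
      show "conductor V \<noteq> {}" using conductorI[OF V.zero_closed lifts_zero[OF V]] by blast
      show "\<ominus>\<^bsub>\<O> X V\<^esub> b \<in> conductor V" if "b \<in> conductor V" for b
      proof -
        have "b \<in> carrier (\<O> X V)" using that by (simp add: conductor_def)
        then have "\<ominus>\<^bsub>\<O> X V\<^esub> b = (\<ominus>\<^bsub>\<O> X V\<^esub> \<one>\<^bsub>\<O> X V\<^esub>) \<otimes>\<^bsub>\<O> X V\<^esub> b" by (simp add: V.l_minus)
        then show ?thesis using l[OF that, of "\<ominus>\<^bsub>\<O> X V\<^esub> \<one>\<^bsub>\<O> X V\<^esub>"] by simp
      qed
      show "b \<oplus>\<^bsub>\<O> X V\<^esub> c \<in> conductor V" if bc: "b \<in> conductor V" "c \<in> conductor V" for b c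
      proof -
        obtain f f' where f: "lifts V b f" "lifts V c f'" and c: "b \<in> carrier (\<O> X V)" "c \<in> carrier (\<O> X V)"
          using bc unfolding conductor_def by blast
        show ?thesis by (rule conductorI[OF _ lifts_add[OF V c f]]) (use c in simp)
      qed
    qed
  qed
qed

end

sublocale reflexive_section \<subseteq> C: ideal_sheaf X \<epsilon> conductor
proof (intro ideal_sheaf.intro ideal_sheaf_axioms.intro)
  show "noetherian_ringed X" by (rule noetherian_ringed_axioms)
  show "inj \<epsilon>" by (rule inj)
  show "ideal (conductor V) (\<O> X V)" if "opn X V" for V by (rule conductor_ideal[OF that])
  show "res X V W b \<in> conductor W" if V: "opn X V" "opn X W" "W \<subseteq> V" and b: "b \<in> conductor V" for V W b
    by (rule conductorE[OF b]) (rule conductorI[OF res_closed[OF V] lifts_res[OF V]])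
  show "b \<in> conductor V" if V: "opn X V" and b: "b \<in> carrier (\<O> X V)"
    and loc: "\<And>x. x \<in> V \<Longrightarrow> \<exists>W. opn X W \<and> x \<in> W \<and> W \<subseteq> V \<and> res X V W b \<in> conductor W" for V b
  proof -
    have "\<exists>f. lifts V b f"
    proof (rule lifts_local[OF V b])
      fix x assume "x \<in> V"
      from loc[OF this] obtain W where W: "opn X W" "x \<in> W" "W \<subseteq> V" "res X V W b \<in> conductor W" by blast
      from W(4) obtain f where "lifts W (res X V W b) f" by (rule conductorE)
      then show "\<exists>W f. opn X W \<and> x \<in> W \<and> W \<subseteq> V \<and> lifts W (res X V W b) f"
        using W by blast
    qed
    then show ?thesis using conductorI[OF b] by blast
  qed
qed

lemma (in sheaf_module) mres_finsum:
  assumes "opn X U" "opn X V" "V \<subseteq> U" "h \<in> {..<k::nat} \<rightarrow> carrier (sec F U)"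
  shows "mres F U V (\<Oplus>\<^bsub>sec F U\<^esub>i\<in>{..<k}. h i) = (\<Oplus>\<^bsub>sec F V\<^esub>i\<in>{..<k}. mres F U V (h i))"
  by (rule finsum_hom_lessThan[OF sec_abelian_monoid[OF assms(1)] sec_abelian_monoid[OF assms(2)]
        mres_zero[OF assms(1-3)] mres_closed[OF assms(1-3)] mres_add[OF assms(1-3)] assms(4)])

section \<open>Finite generation and reflexivity of the conductor\<close>

context reflexive_section
begin

text \<open>The equation that defines a lift over N lives on U \<inter> N, and sections of F there
  are determined by their restrictions to U \<inter> D, which is nonempty. This is how a statement
  reached after shrinking is carried back to N.\<close>

lemma lifts_of_res:
  assumes N: "opn X N" and D: "opn X D" "D \<subseteq> N" "D \<noteq> {}" and b: "b \<in> carrier (\<O> X N)"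
    and f: "f \<in> carrier (sec F N)" and l: "lifts D (res X N D b) (mres F N D f)"
  shows "lifts N b f"
proof -
  note N' = open_Int_U[OF N] and D' = open_Int_U[OF D(1)]
  have sub: "U \<inter> D \<subseteq> U \<inter> N" "U \<inter> N \<subseteq> N" "U \<inter> D \<subseteq> D" "U \<inter> N \<subseteq> U" using D by auto
  have ne: "U \<inter> D \<noteq> {}" by (rule irreducible[OF U(1) D(1) U(2) D(3)])
  have rb: "res X N (U \<inter> N) b \<in> carrier (\<O> X (U \<inter> N))" by (rule res_closed[OF N N' sub(2) b])
  have ms: "mres F U (U \<inter> N) s \<in> carrier (sec F (U \<inter> N))" by (rule s_res[OF N' sub(4)])
  have "mres F N (U \<inter> N) f = res X N (U \<inter> N) b \<odot>\<^bsub>sec F (U \<inter> N)\<^esub> mres F U (U \<inter> N) s"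
  proof (rule sec_inj[OF N' D' sub(1) ne mres_closed[OF N N' sub(2) f] sec_smult_closed[OF N' rb ms]])
    have "mres F (U \<inter> N) (U \<inter> D) (mres F N (U \<inter> N) f) = mres F D (U \<inter> D) (mres F N D f)"
      unfolding mres_mres[OF N N' D' sub(1,2) f] mres_mres[OF N D(1) D' sub(3) D(2) f] ..
    also have "\<dots> = res X D (U \<inter> D) (res X N D b) \<odot>\<^bsub>sec F (U \<inter> D)\<^esub> mres F U (U \<inter> D) s"
      using l by (simp add: lifts_def)
    also have "\<dots> = mres F (U \<inter> N) (U \<inter> D) (res X N (U \<inter> N) b \<odot>\<^bsub>sec F (U \<inter> N)\<^esub> mres F U (U \<inter> N) s)"
      unfolding mres_smult[OF N' D' sub(1) rb ms] res_res[OF N N' D' sub(1,2) b]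
        res_res[OF N D(1) D' sub(3) D(2) b] mres_mres[OF U(1) N' D' sub(1,4) s] ..
    finally show "mres F (U \<inter> N) (U \<inter> D) (mres F N (U \<inter> N) f) =
      mres F (U \<inter> N) (U \<inter> D) (res X N (U \<inter> N) b \<odot>\<^bsub>sec F (U \<inter> N)\<^esub> mres F U (U \<inter> N) s)" .
  qed
  then show ?thesis using f by (simp add: lifts_def)
qed

text \<open>For b in the conductor over V the lift f is locally a combination of generators g of F.
  Clearing the denominators of b and of the coefficients of f at once makes u b a function on W and
  u f a section over N = W \<inter> U1, so u b comes from the finitely generated ideal I of
  functions on W whose restriction to N lies in the conductor. Division by u expresses b.\<close>

lemma conductor_finite_type: "finite_type_sheaf X C.JM"
proof (rule C.JM_finite_type)
  fix x assume x: "x \<in> pts X"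
  obtain W where W: "opn X W" "x \<in> W" and noeth: "noetherian_ring (\<O> X W)" and fr: "has_fractions X W"
    using noetherian_nbhd[OF x] by blast
  have "finite_type_sheaf X F" using reflexive by (simp add: reflexive_sheaf_def coherent_sheaf_def)
  then obtain U1 and n :: nat and g where U1: "opn X U1" "x \<in> U1" and g: "g \<in> {..<n} \<rightarrow> carrier (sec F U1)"
    and gen: "\<forall>V s. opn X V \<longrightarrow> V \<subseteq> U1 \<longrightarrow> s \<in> carrier (sec F V) \<longrightarrow>
      (\<forall>y\<in>V. \<exists>W a. opn X W \<and> y \<in> W \<and> W \<subseteq> V \<and> a \<in> {..<n} \<rightarrow> carrier (\<O> X W) \<and>
         mres F V W s = (\<Oplus>\<^bsub>sec F W\<^esub>i\<in>{..<n}. a i \<odot>\<^bsub>sec F W\<^esub> mres F U1 W (g i)))"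
    using x unfolding finite_type_sheaf_def by (elim ballE[of _ _ x] exE conjE) (rule that, auto)
  let ?N = "W \<inter> U1"
  have N: "opn X ?N" "x \<in> ?N" "?N \<subseteq> W" "?N \<subseteq> U1" using W U1 by auto
  interpret Wr: cring "\<O> X W" by (rule O_cring[OF W(1)])
  interpret Nr: cring "\<O> X ?N" by (rule O_cring[OF N(1)])
  interpret r: ring_hom_ring "\<O> X W" "\<O> X ?N" "res X W ?N"
    by (rule ring_hom_ringI2[OF Wr.ring_axioms Nr.ring_axioms res_hom[OF W(1) N(1,3)]])
  \<comment> \<open>The preimage under restriction lies in the noetherian ring of W; about the ring
    of N nothing of the kind is known.\<close>
  let ?I = "{b \<in> carrier (\<O> X W). res X W ?N b \<in> conductor ?N}"
  obtain m :: nat and l where l: "l \<in> {..<m} \<rightarrow> ?I"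
    and lgen: "\<And>t. t \<in> ?I \<Longrightarrow> \<exists>a \<in> {..<m} \<rightarrow> carrier (\<O> X W). t = (\<Oplus>\<^bsub>\<O> X W\<^esub>j\<in>{..<m}. a j \<otimes>\<^bsub>\<O> X W\<^esub> l j)"
    by (rule Wr.ideal_generators[OF noeth r.ideal_vimage[OF conductor_ideal[OF N(1)]]]) (rule that)
  have lW: "l j \<in> carrier (\<O> X W)" "res X W ?N (l j) \<in> conductor ?N" if "j < m" for j using l that by auto
  have gU: "g i \<in> carrier (sec F U1)" if "i < n" for i using g that by auto
  have main: "\<exists>D e. opn X D \<and> y \<in> D \<and> D \<subseteq> V \<and> e \<in> {..<m} \<rightarrow> carrier (\<O> X D) \<and>
      res X V D b = (\<Oplus>\<^bsub>\<O> X D\<^esub>j\<in>{..<m}. e j \<otimes>\<^bsub>\<O> X D\<^esub> res X ?N D (res X W ?N (l j)))"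
    if V: "opn X V" "V \<subseteq> ?N" "y \<in> V" and b: "b \<in> conductor V" for V y b
  proof -
    obtain f where bV: "b \<in> carrier (\<O> X V)" and f: "lifts V b f" using b by (rule conductorE)
    have fV: "f \<in> carrier (sec F V)" by (rule lifts_carrier[OF f])
    have VU1: "V \<subseteq> U1" "V \<subseteq> W" using V by auto
    obtain D1 c where D1: "opn X D1" "y \<in> D1" "D1 \<subseteq> V" and c: "c \<in> {..<n} \<rightarrow> carrier (\<O> X D1)"
      and fc: "mres F V D1 f = (\<Oplus>\<^bsub>sec F D1\<^esub>i\<in>{..<n}. c i \<odot>\<^bsub>sec F D1\<^esub> mres F U1 D1 (g i))"
      using gen[rule_format, OF V(1) VU1(1) fV V(3)] by (elim exE conjE) (rule that)
    have D1W: "D1 \<subseteq> W" "D1 \<subseteq> U1" using D1 VU1 by auto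
    have cD1: "c i \<in> carrier (\<O> X D1)" if "i < n" for i using c that by auto
    \<comment> \<open>Index n is reserved for b, so a single common denominator clears b and the n
      coefficients of its lift.\<close>
    let ?\<tau> = "\<lambda>i. if i < n then c i else res X V D1 b"
    have \<tau>: "?\<tau> \<in> {..<Suc n} \<rightarrow> carrier (\<O> X D1)" using cD1 res_closed[OF V(1) D1(1,3) bV] by auto
    obtain D u a where D: "opn X D" "y \<in> D" "D \<subseteq> D1" and u: "u \<in> carrier (\<O> X W)"
      and a: "a \<in> {..<Suc n} \<rightarrow> carrier (\<O> X W)" and unit: "res X W D u \<in> Units (\<O> X D)"
      and eq: "\<forall>i<Suc n. res X W D u \<otimes>\<^bsub>\<O> X D\<^esub> res X D1 D (?\<tau> i) = res X W D (a i)"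
      using common_denominator[OF W(1) fr D1(1) D1W(1) D1(2) \<tau>] by (elim exE conjE) (rule that)
    have sub: "D \<subseteq> V" "D \<subseteq> W" "D \<subseteq> U1" "D \<subseteq> ?N" "D \<noteq> {}" using D D1 D1W V by auto
    have aW: "a i \<in> carrier (\<O> X W)" if "i < Suc n" for i using a that by auto
    interpret Dr: cring "\<O> X D" by (rule O_cring[OF D(1)])
    interpret FD: module "\<O> X D" "sec F D" by (rule sec_module[OF D(1)])
    interpret FN: module "\<O> X ?N" "sec F ?N" by (rule sec_module[OF N(1)])
    let ?u = "res X W D u"
    have uD: "?u \<in> carrier (\<O> X D)" by (rule res_closed[OF W(1) D(1) sub(2) u])
    have eqb: "?u \<otimes>\<^bsub>\<O> X D\<^esub> res X V D b = res X W D (a n)"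
      using eq[rule_format, of n] res_res[OF V(1) D1(1) D(1,3) D1(3) bV] by simp
    have eqc: "?u \<otimes>\<^bsub>\<O> X D\<^esub> res X D1 D (c i) = res X W D (a i)" if "i < n" for i
      using eq[rule_format, of i] that by simp
    \<comment> \<open>The numerators a i with i < n combine the generators to the candidate lift of
      the last numerator a n over N; over D it is u f.\<close>
    let ?t = "\<lambda>i. res X W ?N (a i) \<odot>\<^bsub>sec F ?N\<^esub> mres F U1 ?N (g i)"
    have tN: "?t \<in> {..<n} \<rightarrow> carrier (sec F ?N)"
      using sec_smult_closed[OF N(1) res_closed[OF W(1) N(1,3) aW] mres_closed[OF U1(1) N(1,4) gU]] by auto
    let ?f = "\<Oplus>\<^bsub>sec F ?N\<^esub>i\<in>{..<n}. ?t i"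
    have fN: "?f \<in> carrier (sec F ?N)" by (rule FN.finsum_closed[OF tN])
    let ?k = "\<lambda>i. res X D1 D (c i) \<odot>\<^bsub>sec F D\<^esub> mres F U1 D (g i)"
    have kD: "?k \<in> {..<n} \<rightarrow> carrier (sec F D)"
      using sec_smult_closed[OF D(1) res_closed[OF D1(1) D(1,3) cD1] mres_closed[OF U1(1) D(1) sub(3) gU]] by auto
    have "mres F V D f = mres F D1 D (mres F V D1 f)"
      by (rule mres_mres[OF V(1) D1(1) D(1,3) D1(3) fV, symmetric])
    also have "\<dots> = (\<Oplus>\<^bsub>sec F D\<^esub>i\<in>{..<n}. mres F D1 D (c i \<odot>\<^bsub>sec F D1\<^esub> mres F U1 D1 (g i)))"
      unfolding fc
    proof (rule mres_finsum[OF D1(1) D(1,3)])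
      show "(\<lambda>i. c i \<odot>\<^bsub>sec F D1\<^esub> mres F U1 D1 (g i)) \<in> {..<n} \<rightarrow> carrier (sec F D1)"
        using sec_smult_closed[OF D1(1) cD1 mres_closed[OF U1(1) D1(1) D1W(2) gU]] by auto
    qed
    also have "\<dots> = (\<Oplus>\<^bsub>sec F D\<^esub>i\<in>{..<n}. ?k i)"
    proof (rule FD.finsum_cong'[OF refl kD])
      fix i assume "i \<in> {..<n}"
      then have i: "i < n" by simp
      show "mres F D1 D (c i \<odot>\<^bsub>sec F D1\<^esub> mres F U1 D1 (g i)) = ?k i"
        unfolding mres_smult[OF D1(1) D(1,3) cD1[OF i] mres_closed[OF U1(1) D1(1) D1W(2) gU[OF i]]]
          mres_mres[OF U1(1) D1(1) D(1,3) D1W(2) gU[OF i]] ..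
    qed
    finally have fD: "mres F V D f = (\<Oplus>\<^bsub>sec F D\<^esub>i\<in>{..<n}. ?k i)" .
    have "mres F ?N D ?f = (\<Oplus>\<^bsub>sec F D\<^esub>i\<in>{..<n}. mres F ?N D (?t i))"
      by (rule mres_finsum[OF N(1) D(1) sub(4) tN])
    also have "\<dots> = (\<Oplus>\<^bsub>sec F D\<^esub>i\<in>{..<n}. ?u \<odot>\<^bsub>sec F D\<^esub> ?k i)"
    proof (rule FD.finsum_cong'[OF refl])
      show "(\<lambda>i. ?u \<odot>\<^bsub>sec F D\<^esub> ?k i) \<in> {..<n} \<rightarrow> carrier (sec F D)"
        using kD sec_smult_closed[OF D(1) uD] by (auto simp: Pi_iff)
      fix i assume "i \<in> {..<n}"
      then have i: "i < n" "i < Suc n" by auto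
      have "mres F ?N D (?t i) = res X W D (a i) \<odot>\<^bsub>sec F D\<^esub> mres F U1 D (g i)"
        unfolding mres_smult[OF N(1) D(1) sub(4) res_closed[OF W(1) N(1,3) aW[OF i(2)]] mres_closed[OF U1(1) N(1,4) gU[OF i(1)]]]
          mres_mres[OF U1(1) N(1) D(1) sub(4) N(4) gU[OF i(1)]] res_res[OF W(1) N(1) D(1) sub(4) N(3) aW[OF i(2)]] ..
      then show "mres F ?N D (?t i) = ?u \<odot>\<^bsub>sec F D\<^esub> ?k i"
        unfolding eqc[OF i(1), symmetric]
          FD.smult_assoc1[OF uD res_closed[OF D1(1) D(1,3) cD1[OF i(1)]] mres_closed[OF U1(1) D(1) sub(3) gU[OF i(1)]]] .
    qed
    also have "\<dots> = ?u \<odot>\<^bsub>sec F D\<^esub> mres F V D f"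
      unfolding fD by (rule FD.finsum_smult_ldistr[symmetric]) (use uD kD in auto)
    finally have fND: "mres F ?N D ?f = ?u \<odot>\<^bsub>sec F D\<^esub> mres F V D f" .
    have "lifts D (?u \<otimes>\<^bsub>\<O> X D\<^esub> res X V D b) (?u \<odot>\<^bsub>sec F D\<^esub> mres F V D f)"
      by (rule lifts_smult[OF D(1) res_closed[OF V(1) D(1) sub(1) bV] uD lifts_res[OF V(1) D(1) sub(1) bV f]])
    then have "lifts D (res X ?N D (res X W ?N (a n))) (mres F ?N D ?f)"
      unfolding eqb fND res_res[OF W(1) N(1) D(1) sub(4) N(3) aW[OF lessI]] .
    then have "lifts ?N (res X W ?N (a n)) ?f"
      by (rule lifts_of_res[OF N(1) D(1) sub(4,5) res_closed[OF W(1) N(1,3) aW[OF lessI]] fN])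
    then have "a n \<in> ?I"
      using conductorI[OF res_closed[OF W(1) N(1,3) aW[OF lessI]]] aW[OF lessI] by simp
    from lgen[OF this] obtain e where e: "e \<in> {..<m} \<rightarrow> carrier (\<O> X W)"
      and an: "a n = (\<Oplus>\<^bsub>\<O> X W\<^esub>j\<in>{..<m}. e j \<otimes>\<^bsub>\<O> X W\<^esub> l j)" by (elim bexE) (rule that)
    have eW: "e j \<in> carrier (\<O> X W)" if "j < m" for j using e that by auto
    have eD: "(\<lambda>j. res X W D (e j)) \<in> {..<m} \<rightarrow> carrier (\<O> X D)" using eW res_closed[OF W(1) D(1) sub(2)] by auto
    have lD: "(\<lambda>j. res X ?N D (res X W ?N (l j))) \<in> {..<m} \<rightarrow> carrier (\<O> X D)"
      using res_closed[OF N(1) D(1) sub(4) res_closed[OF W(1) N(1,3) lW(1)]] by auto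
    have "?u \<otimes>\<^bsub>\<O> X D\<^esub> res X V D b = (\<Oplus>\<^bsub>\<O> X D\<^esub>j\<in>{..<m}. res X W D (e j \<otimes>\<^bsub>\<O> X W\<^esub> l j))"
      unfolding eqb an by (rule res_finsum[OF W(1) D(1) sub(2)]) (use eW lW(1) in auto)
    also have "\<dots> = (\<Oplus>\<^bsub>\<O> X D\<^esub>j\<in>{..<m}. res X W D (e j) \<otimes>\<^bsub>\<O> X D\<^esub> res X ?N D (res X W ?N (l j)))"
    proof (rule Dr.finsum_cong'[OF refl])
      show "(\<lambda>j. res X W D (e j) \<otimes>\<^bsub>\<O> X D\<^esub> res X ?N D (res X W ?N (l j))) \<in> {..<m} \<rightarrow> carrier (\<O> X D)"
        using eD lD by (auto simp: Pi_iff)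
      fix j assume "j \<in> {..<m}"
      then have j: "j < m" by simp
      show "res X W D (e j \<otimes>\<^bsub>\<O> X W\<^esub> l j) = res X W D (e j) \<otimes>\<^bsub>\<O> X D\<^esub> res X ?N D (res X W ?N (l j))"
        unfolding res_mult[OF W(1) D(1) sub(2) eW[OF j] lW(1)[OF j]] res_res[OF W(1) N(1) D(1) sub(4) N(3) lW(1)[OF j]] ..
    qed
    finally have "res X V D b = (\<Oplus>\<^bsub>\<O> X D\<^esub>j\<in>{..<m}. (inv\<^bsub>\<O> X D\<^esub> ?u \<otimes>\<^bsub>\<O> X D\<^esub> res X W D (e j)) \<otimes>\<^bsub>\<O> X D\<^esub>
        res X ?N D (res X W ?N (l j)))"
      by (rule Dr.divide_unit_finsum[OF unit res_closed[OF V(1) D(1) sub(1) bV] eD lD])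
    moreover have "(\<lambda>j. inv\<^bsub>\<O> X D\<^esub> ?u \<otimes>\<^bsub>\<O> X D\<^esub> res X W D (e j)) \<in> {..<m} \<rightarrow> carrier (\<O> X D)"
      using eD Dr.Units_inv_closed[OF unit] by (auto simp: Pi_iff)
    ultimately show ?thesis
      using D sub(1) by (intro exI[of _ D] exI[of _ "\<lambda>j. inv\<^bsub>\<O> X D\<^esub> ?u \<otimes>\<^bsub>\<O> X D\<^esub> res X W D (e j)"] conjI)
  qed
  have A: "(\<lambda>j. res X W ?N (l j)) \<in> {..<m} \<rightarrow> conductor ?N" using lW(2) by auto
  have B: "\<forall>V y b. opn X V \<longrightarrow> V \<subseteq> ?N \<longrightarrow> y \<in> V \<longrightarrow> b \<in> conductor V \<longrightarrow>
      (\<exists>D e. opn X D \<and> y \<in> D \<and> D \<subseteq> V \<and> e \<in> {..<m} \<rightarrow> carrier (\<O> X D) \<and>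
        res X V D b = (\<Oplus>\<^bsub>\<O> X D\<^esub>j\<in>{..<m}. e j \<otimes>\<^bsub>\<O> X D\<^esub> res X ?N D (res X W ?N (l j))))"
    by (intro allI impI) (rule main)
  show "\<exists>N (m::nat) l. opn X N \<and> x \<in> N \<and> l \<in> {..<m} \<rightarrow> conductor N \<and>
    (\<forall>V y b. opn X V \<longrightarrow> V \<subseteq> N \<longrightarrow> y \<in> V \<longrightarrow> b \<in> conductor V \<longrightarrow>
      (\<exists>D e. opn X D \<and> y \<in> D \<and> D \<subseteq> V \<and> e \<in> {..<m} \<rightarrow> carrier (\<O> X D) \<and>
        res X V D b = (\<Oplus>\<^bsub>\<O> X D\<^esub>j\<in>{..<m}. e j \<otimes>\<^bsub>\<O> X D\<^esub> res X N D (l j))))"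
    by (rule exI[of _ ?N], rule exI[of _ m], rule exI[of _ "\<lambda>j. res X W ?N (l j)"], intro conjI N A B)
qed

text \<open>Multiplication by s. Where V is not contained in U the product b s makes sense only as
  the lift of b, which is unique.\<close>

definition proj :: "'x set \<Rightarrow> 'n \<Rightarrow> 'm" where
  "proj V x = (THE f. lifts V (inv_into UNIV \<epsilon> x) f)"

lemma proj_eq: "opn X V \<Longrightarrow> lifts V b f \<Longrightarrow> proj V (\<epsilon> b) = f"
  unfolding proj_def C.inv_\<epsilon> by (rule the_equality) (auto intro: lifts_unique)

lemma lifts_proj: "opn X V \<Longrightarrow> b \<in> conductor V \<Longrightarrow> lifts V b (proj V (\<epsilon> b))"
  by (erule conductorE) (simp add: proj_eq)

text \<open>Each law is uniqueness of lifts, applied to the corresponding closure property of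
  \<open>lifts\<close>.\<close>

lemma proj_hom:
  assumes W: "opn X W"
  shows "hom_ext (open_subspace X W) C.JM proj \<in> sheaf_hom (open_subspace X W) C.JM F"
proof (rule sheaf_hom_hom_extI[OF W C.JM.module_closed])
  fix V x assume V: "opn X V" "V \<subseteq> W" and x: "x \<in> carrier (sec C.JM V)"
  obtain b where b: "b \<in> conductor V" "x = \<epsilon> b" using x by auto
  note l = lifts_proj[OF V(1) b(1)] and bV = C.J_carrier[OF V(1) b(1)]
  show "proj V x \<in> carrier (sec F V)" unfolding b(2) by (rule lifts_carrier[OF l])
  show "proj V (x \<oplus>\<^bsub>sec C.JM V\<^esub> y) = proj V x \<oplus>\<^bsub>sec F V\<^esub> proj V y" if y: "y \<in> carrier (sec C.JM V)" for y
  proof -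
    obtain c where c: "c \<in> conductor V" "y = \<epsilon> c" using y by auto
    show ?thesis
      using proj_eq[OF V(1) lifts_add[OF V(1) bV C.J_carrier[OF V(1) c(1)] l lifts_proj[OF V(1) c(1)]]] b(2) c(2)
      by simp
  qed
  show "proj V (a \<odot>\<^bsub>sec C.JM V\<^esub> x) = a \<odot>\<^bsub>sec F V\<^esub> proj V x" if a: "a \<in> carrier (\<O> X V)" for a
    using proj_eq[OF V(1) lifts_smult[OF V(1) bV a l]] b(2) by simp
  show "proj Z (mres C.JM V Z x) = mres F V Z (proj V x)" if Z: "opn X Z" "Z \<subseteq> V" for Z
    using proj_eq[OF Z(1) lifts_res[OF V(1) Z bV l]] b(2) by simp
qed

lemma lifts_on_U:
  assumes V: "opn X V" "V \<subseteq> U" and b: "b \<in> carrier (\<O> X V)"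
  shows "lifts V b (b \<odot>\<^bsub>sec F V\<^esub> mres F U V s)"
proof -
  have "U \<inter> V = V" using V by auto
  then show ?thesis
    using sec_smult_closed[OF V(1) b s_res[OF V]] mres_id[OF V(1)] res_id[OF V(1) b] by (simp add: lifts_def)
qed

lemma conductor_on_U: "opn X V \<Longrightarrow> V \<subseteq> U \<Longrightarrow> conductor V = carrier (\<O> X V)"
  using lifts_on_U conductorI C.J_carrier by blast

lemma proj_one:
  assumes V: "opn X V" "V \<subseteq> U"
  shows "proj V (\<epsilon> \<one>\<^bsub>\<O> X V\<^esub>) = mres F U V s"
  using proj_eq[OF V(1) lifts_on_U[OF V O_one_closed[OF V(1)]]] module.smult_one[OF sec_module[OF V(1)] s_res[OF V]]
  by simp

text \<open>The transpose of \<open>proj\<close>, from functionals on F to functionals on the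
  conductor.\<close>

definition pullback :: "'x set \<Rightarrow> ('x set \<Rightarrow> 'm \<Rightarrow> 'r) \<Rightarrow> 'x set \<Rightarrow> 'n \<Rightarrow> 'r" where
  "pullback V \<psi> = hom_ext (open_subspace X V) C.JM (\<lambda>W x. \<psi> W (proj W x))"

lemma pullback_apply:
  "opn X V \<Longrightarrow> opn X W \<Longrightarrow> W \<subseteq> V \<Longrightarrow> x \<in> carrier (sec C.JM W) \<Longrightarrow> pullback V \<psi> W x = \<psi> W (proj W x)"
  unfolding pullback_def by (rule hom_ext_apply_sub)

text \<open>The laws of \<open>proj_hom\<close> freed from the normalization, because
  \<open>proj\<close> itself is not extensional.\<close>

lemma proj_props:
  assumes W: "opn X W" and x: "x \<in> carrier (sec C.JM W)"
  shows proj_closed: "proj W x \<in> carrier (sec F W)"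
    and proj_add: "y \<in> carrier (sec C.JM W) \<Longrightarrow> proj W (x \<oplus>\<^bsub>sec C.JM W\<^esub> y) = proj W x \<oplus>\<^bsub>sec F W\<^esub> proj W y"
    and proj_smult: "a \<in> carrier (\<O> X W) \<Longrightarrow> proj W (a \<odot>\<^bsub>sec C.JM W\<^esub> x) = a \<odot>\<^bsub>sec F W\<^esub> proj W x"
    and proj_res: "opn X Z \<Longrightarrow> Z \<subseteq> W \<Longrightarrow> proj Z (mres C.JM W Z x) = mres F W Z (proj W x)"
proof -
  have e: "hom_ext (open_subspace X W) C.JM proj Z z = proj Z z"
    if "opn X Z" "Z \<subseteq> W" "z \<in> carrier (sec C.JM Z)" for Z z
    by (rule hom_ext_apply_sub[OF W that])
  note h = proj_hom[OF W]
  show "proj W x \<in> carrier (sec F W)"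
    using sheaf_hom_closed[OF h W W order_refl x] unfolding e[OF W order_refl x] .
  show "proj W (x \<oplus>\<^bsub>sec C.JM W\<^esub> y) = proj W x \<oplus>\<^bsub>sec F W\<^esub> proj W y" if y: "y \<in> carrier (sec C.JM W)"
    using sheaf_hom_add[OF h W W order_refl x y]
    unfolding e[OF W order_refl x] e[OF W order_refl y] e[OF W order_refl C.JM.sec_add_closed[OF W x y]] .
  show "proj W (a \<odot>\<^bsub>sec C.JM W\<^esub> x) = a \<odot>\<^bsub>sec F W\<^esub> proj W x" if a: "a \<in> carrier (\<O> X W)"
    using sheaf_hom_smult[OF h W W order_refl a x]
    unfolding e[OF W order_refl x] e[OF W order_refl C.JM.sec_smult_closed[OF W a x]] .
  show "proj Z (mres C.JM W Z x) = mres F W Z (proj W x)" if Z: "opn X Z" "Z \<subseteq> W"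
    using sheaf_hom_res[OF h W W order_refl Z x]
    unfolding e[OF W order_refl x] e[OF Z C.JM.mres_closed[OF W Z x]] .
qed

lemma pullback_closed:
  assumes V: "opn X V" and \<psi>: "\<psi> \<in> carrier (sec (dual X F) V)"
  shows "pullback V \<psi> \<in> carrier (sec (dual X C.JM) V)"
  unfolding pullback_def dual_simps
proof (rule sheaf_hom_hom_extI[OF V C.JM.module_closed])
  note \<psi>' = \<psi>[unfolded dual_simps]
  fix W x assume W: "opn X W" "W \<subseteq> V" and x: "x \<in> carrier (sec C.JM W)"
  note px = proj_closed[OF W(1) x]
  show "\<psi> W (proj W x) \<in> carrier (sec (structure_module X) W)"
    using dual_closed[OF \<psi>' V W px] by simp
  show "\<psi> W (proj W (x \<oplus>\<^bsub>sec C.JM W\<^esub> y)) = \<psi> W (proj W x) \<oplus>\<^bsub>sec (structure_module X) W\<^esub> \<psi> W (proj W y)"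
    if y: "y \<in> carrier (sec C.JM W)" for y
    unfolding proj_add[OF W(1) x y] structure_module_simps
    by (rule dual_add[OF \<psi>' V W px proj_closed[OF W(1) y]])
  show "\<psi> W (proj W (a \<odot>\<^bsub>sec C.JM W\<^esub> x)) = a \<odot>\<^bsub>sec (structure_module X) W\<^esub> \<psi> W (proj W x)"
    if a: "a \<in> carrier (\<O> X W)" for a
    unfolding proj_smult[OF W(1) x a] structure_module_simps by (rule dual_smult[OF \<psi>' V W a px])
  show "\<psi> Z (proj Z (mres C.JM W Z x)) = mres (structure_module X) W Z (\<psi> W (proj W x))"
    if Z: "opn X Z" "Z \<subseteq> W" for Z
    unfolding proj_res[OF W(1) x Z] structure_module_simps by (rule dual_res[OF \<psi>' V W Z px])
qed

text \<open>The double transpose of \<open>proj\<close>, applied to \<phi>. Linearity of \<phi>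
  reduces everything to linearity of \<open>pullback\<close> in the functional.\<close>

lemma pullback_bidual:
  assumes V: "opn X V" and \<phi>: "\<phi> \<in> carrier (sec (dual X (dual X C.JM)) V)"
  shows "hom_ext (open_subspace X V) (dual X F) (\<lambda>W \<psi>. \<phi> W (pullback W \<psi>)) \<in> carrier (sec (dual X (dual X F)) V)"
  unfolding dual_simps(1)[of X "dual X F"]
proof (rule sheaf_hom_hom_extI[OF V module_closed_dual[OF module_closed]])
  note \<phi>' = \<phi>[unfolded dual_simps(1)[of X "dual X C.JM"]]
  fix W \<psi> assume W: "opn X W" "W \<subseteq> V" and \<psi>: "\<psi> \<in> carrier (sec (dual X F) W)"
  note p = pullback_closed[OF W(1) \<psi>]
  show "\<phi> W (pullback W \<psi>) \<in> carrier (sec (structure_module X) W)"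
    using dual_closed[OF \<phi>' V W p] by simp
  show "\<phi> W (pullback W (\<psi> \<oplus>\<^bsub>sec (dual X F) W\<^esub> \<chi>)) =
      \<phi> W (pullback W \<psi>) \<oplus>\<^bsub>sec (structure_module X) W\<^esub> \<phi> W (pullback W \<chi>)"
    if \<chi>: "\<chi> \<in> carrier (sec (dual X F) W)" for \<chi>
  proof -
    have "pullback W (\<psi> \<oplus>\<^bsub>sec (dual X F) W\<^esub> \<chi>) = pullback W \<psi> \<oplus>\<^bsub>sec (dual X C.JM) W\<^esub> pullback W \<chi>"
      unfolding dual_simps(2) pullback_def[of W "hom_ext (open_subspace X W) F _"]
      by (rule hom_ext_eqI[OF W(1)])
         (simp only: pullback_apply[OF W(1)] hom_ext_apply_sub[OF W(1)] proj_closed)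
    then show ?thesis using dual_add[OF \<phi>' V W p pullback_closed[OF W(1) \<chi>]] by simp
  qed
  show "\<phi> W (pullback W (a \<odot>\<^bsub>sec (dual X F) W\<^esub> \<psi>)) = a \<odot>\<^bsub>sec (structure_module X) W\<^esub> \<phi> W (pullback W \<psi>)"
    if a: "a \<in> carrier (\<O> X W)" for a
  proof -
    have "pullback W (a \<odot>\<^bsub>sec (dual X F) W\<^esub> \<psi>) = a \<odot>\<^bsub>sec (dual X C.JM) W\<^esub> pullback W \<psi>"
      unfolding dual_simps(3) pullback_def[of W "hom_ext (open_subspace X W) F _"]
      by (rule hom_ext_eqI[OF W(1)])
         (simp only: pullback_apply[OF W(1)] hom_ext_apply_sub[OF W(1)] proj_closed)
    then show ?thesis using dual_smult[OF \<phi>' V W a p] by simp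
  qed
  show "\<phi> Z (pullback Z (mres (dual X F) W Z \<psi>)) = mres (structure_module X) W Z (\<phi> W (pullback W \<psi>))"
    if Z: "opn X Z" "Z \<subseteq> W" for Z
  proof -
    have ZW: "opn X T \<Longrightarrow> T \<subseteq> Z \<Longrightarrow> T \<subseteq> W" for T using Z by auto
    have "pullback Z (mres (dual X F) W Z \<psi>) = mres (dual X C.JM) W Z (pullback W \<psi>)"
      unfolding dual_simps(4) pullback_def[of Z "hom_ext (open_subspace X Z) F _"]
      by (rule hom_ext_eqI[OF Z(1)])
         (simp only: pullback_apply[OF W(1)] hom_ext_apply_sub[OF Z(1)] proj_closed ZW)
    then show ?thesis using dual_res[OF \<phi>' V W Z p] by simp
  qed
qed

text \<open>The double transpose of \<open>proj\<close> sends \<phi> to an element of the bidual of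
  F, which by reflexivity is evaluation at a section f over V. This f is the lift of the function
  that \<phi> assigns to the inclusion.\<close>

lemma bidual_incl_in_conductor:
  assumes V: "opn X V" and \<phi>: "\<phi> \<in> carrier (sec (dual X (dual X C.JM)) V)"
  shows "\<phi> V (C.incl V) \<in> conductor V"
proof -
  note \<phi>' = \<phi>[unfolded dual_simps(1)[of X "dual X C.JM"]]
  let ?a = "\<phi> V (C.incl V)"
  have a: "?a \<in> carrier (\<O> X V)" by (rule dual_closed[OF \<phi>' V V order_refl C.incl_closed[OF V]])
  let ?\<Phi> = "hom_ext (open_subspace X V) (dual X F) (\<lambda>W \<psi>. \<phi> W (pullback W \<psi>))"
  have "?\<Phi> \<in> to_bidual X F V ` carrier (sec F V)"
    unfolding bij_betw_imp_surj_on[OF bidual_bij[OF V]] by (rule pullback_bidual[OF V \<phi>])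
  then obtain f where f: "f \<in> carrier (sec F V)" "?\<Phi> = to_bidual X F V f" by (elim imageE) (rule that)
  let ?N = "U \<inter> V"
  have N: "opn X ?N" "?N \<subseteq> V" "?N \<subseteq> U" using open_Int_U[OF V] by auto
  have aN: "res X V ?N ?a \<in> carrier (\<O> X ?N)" by (rule res_closed[OF V N(1,2) a])
  note sN = s_res[OF N(1,3)]
  have fN: "mres F V ?N f \<in> carrier (sec F ?N)" by (rule mres_closed[OF V N(1,2) f(1)])
  have asN: "res X V ?N ?a \<odot>\<^bsub>sec F ?N\<^esub> mres F U ?N s \<in> carrier (sec F ?N)" by (rule sec_smult_closed[OF N(1) aN sN])
  \<comment> \<open>F embeds in its bidual, so the lifting equation may be tested on functionals
    \<psi>. They live over subsets of U, where the conductor is trivial and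
    \<open>bidual_on_trivial\<close> computes \<phi> on the pullback of \<psi>.\<close>
  have "to_bidual X F ?N (mres F V ?N f) = to_bidual X F ?N (res X V ?N ?a \<odot>\<^bsub>sec F ?N\<^esub> mres F U ?N s)"
  proof (rule bidual_eqI[OF N(1) to_bidual_closed[OF N(1) fN] to_bidual_closed[OF N(1) asN]])
    fix Z \<psi> assume Z: "opn X Z" "Z \<subseteq> ?N" and \<psi>: "\<psi> \<in> carrier (sec (dual X F) Z)"
    note \<psi>' = \<psi>[unfolded dual_simps]
    have sub: "Z \<subseteq> V" "Z \<subseteq> U" using Z by auto
    interpret Zr: cring "\<O> X Z" by (rule O_cring[OF Z(1)])
    have sZ: "mres F U Z s \<in> carrier (sec F Z)" by (rule s_res[OF Z(1) sub(2)])
    have aZ: "res X V Z ?a \<in> carrier (\<O> X Z)" by (rule res_closed[OF V Z(1) sub(1) a])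
    have triv: "conductor T = carrier (\<O> X T)" if "opn X T" "T \<subseteq> Z" for T
      by (rule conductor_on_U) (use that sub in auto)
    have one: "\<epsilon> \<one>\<^bsub>\<O> X Z\<^esub> \<in> carrier (sec C.JM Z)" using triv[OF Z(1) order_refl] by simp
    have "to_bidual X F ?N (mres F V ?N f) Z \<psi> = \<psi> Z (mres F V Z f)"
      unfolding to_bidual_apply[OF N(1) fN Z \<psi>] mres_mres[OF V N(1) Z N(2) f(1)] ..
    also have "\<dots> = ?\<Phi> Z \<psi>"
      unfolding f(2) to_bidual_apply[OF V f(1) Z(1) sub(1) \<psi>] ..
    also have "\<dots> = \<phi> Z (pullback Z \<psi>)" by (rule hom_ext_apply_sub[OF V Z(1) sub(1) \<psi>])
    also have "\<dots> = pullback Z \<psi> Z (\<epsilon> \<one>\<^bsub>\<O> X Z\<^esub>) \<otimes>\<^bsub>\<O> X Z\<^esub> res X V Z ?a"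
      by (rule C.bidual_on_trivial[OF Z(1) _ V sub(1) \<phi> pullback_closed[OF Z(1) \<psi>]]) (rule triv)
    also have "pullback Z \<psi> Z (\<epsilon> \<one>\<^bsub>\<O> X Z\<^esub>) = \<psi> Z (mres F U Z s)"
      unfolding pullback_apply[OF Z(1) Z(1) order_refl one] proj_one[OF Z(1) sub(2)] ..
    also have "\<psi> Z (mres F U Z s) \<otimes>\<^bsub>\<O> X Z\<^esub> res X V Z ?a = res X V Z ?a \<otimes>\<^bsub>\<O> X Z\<^esub> \<psi> Z (mres F U Z s)"
      by (rule Zr.m_comm[OF dual_closed[OF \<psi>' Z(1) Z(1) order_refl sZ] aZ])
    also have "\<dots> = \<psi> Z (res X V Z ?a \<odot>\<^bsub>sec F Z\<^esub> mres F U Z s)"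
      by (rule dual_smult[OF \<psi>' Z(1) Z(1) order_refl aZ sZ, symmetric])
    also have "\<dots> = to_bidual X F ?N (res X V ?N ?a \<odot>\<^bsub>sec F ?N\<^esub> mres F U ?N s) Z \<psi>"
      unfolding to_bidual_apply[OF N(1) asN Z \<psi>] mres_smult[OF N(1) Z aN sN]
        res_res[OF V N(1) Z N(2) a] mres_mres[OF U(1) N(1) Z N(3) s] ..
    finally show "to_bidual X F ?N (mres F V ?N f) Z \<psi> =
        to_bidual X F ?N (res X V ?N ?a \<odot>\<^bsub>sec F ?N\<^esub> mres F U ?N s) Z \<psi>" .
  qed
  then have "mres F V ?N f = res X V ?N ?a \<odot>\<^bsub>sec F ?N\<^esub> mres F U ?N s"
    by (rule inj_onD[OF bij_betw_imp_inj_on[OF bidual_bij[OF N(1)]] _ fN asN])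
  then have "lifts V ?a f" using f(1) by (simp add: lifts_def)
  then show ?thesis by (rule conductorI[OF a])
qed

text \<open>U itself serves as the nonempty open set over which the ideal is trivial.\<close>

lemma conductor_reflexive: "reflexive_sheaf X C.JM"
  by (rule C.JM_reflexive[OF U _ _ conductor_finite_type])
     (rule conductor_on_U bidual_incl_in_conductor; assumption)+

end

section \<open>The center\<close>

lemma Ref_simps [simp]:
  "Obj (Ref X) = {F. reflexive_sheaf X F}" "Hom (Ref X) = sheaf_hom X"
  "Comp (Ref X) F G H g f = hom_ext X F (\<lambda>U s. g U (f U s))"
  "Ident (Ref X) F = hom_ext X F (\<lambda>U s. s)"
  "Plus (Ref X) F G f g = hom_ext X F (\<lambda>U s. f U s \<oplus>\<^bsub>sec G U\<^esub> g U s)"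
  by (simp_all add: Ref_def)

lemma center_carrier_iff:
  "z \<in> carrier (center C) \<longleftrightarrow> z \<in> (\<Pi>\<^sub>E A\<in>Obj C. Hom C A A) \<and>
    (\<forall>A\<in>Obj C. \<forall>B\<in>Obj C. \<forall>f\<in>Hom C A B. Comp C A B B (z B) f = Comp C A A B f (z A))"
  by (simp add: center_def)

lemma sheaf_homD:
  assumes h: "h \<in> sheaf_hom X F G" and V: "opn X V"
  shows sheaf_homD_closed: "s \<in> carrier (sec F V) \<Longrightarrow> h V s \<in> carrier (sec G V)"
    and sheaf_homD_smult: "a \<in> carrier (\<O> X V) \<Longrightarrow> s \<in> carrier (sec F V) \<Longrightarrow>
      h V (a \<odot>\<^bsub>sec F V\<^esub> s) = a \<odot>\<^bsub>sec G V\<^esub> h V s"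
    and sheaf_homD_res: "opn X W \<Longrightarrow> W \<subseteq> V \<Longrightarrow> s \<in> carrier (sec F V) \<Longrightarrow> h W (mres F V W s) = mres G V W (h V s)"
  using sheaf_hom_open[of h X "pts X", OF _ _ V openin_subset[OF V]] h by simp_all

lemma hom_ext_cong:
  "(\<And>V s. opn X V \<Longrightarrow> s \<in> carrier (sec F V) \<Longrightarrow> h V s = k V s) \<Longrightarrow> hom_ext X F h = hom_ext X F k"
  by (auto simp: hom_ext_def fun_eq_iff)

lemma center_natural:
  assumes "z \<in> carrier (center (Ref X))" "reflexive_sheaf X F" "reflexive_sheaf X G" "f \<in> sheaf_hom X F G"
    "opn X V" "s \<in> carrier (sec F V)"
  shows "z G V (f V s) = f V (z F V s)"
proof -
  have "hom_ext X F (\<lambda>U s. z G U (f U s)) = hom_ext X F (\<lambda>U s. f U (z F U s))"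
    using assms(1-4) unfolding center_carrier_iff by simp
  then have "hom_ext X F (\<lambda>U s. z G U (f U s)) V s = hom_ext X F (\<lambda>U s. f U (z F U s)) V s" by simp
  then show ?thesis unfolding hom_ext_apply[OF assms(5,6)] .
qed

lemma center_component: "z \<in> carrier (center (Ref X)) \<Longrightarrow> reflexive_sheaf X F \<Longrightarrow> z F \<in> sheaf_hom X F F"
  unfolding center_carrier_iff by auto

lemma reflexive_imp_sheaf_of_modules: "reflexive_sheaf X F \<Longrightarrow> sheaf_of_modules X F"
  by (simp add: reflexive_sheaf_def coherent_sheaf_def)

lemma scalar_action_apply:
  "reflexive_sheaf X F \<Longrightarrow> opn X V \<Longrightarrow> s \<in> carrier (sec F V) \<Longrightarrow>
    scalar_action X a F V s = res X (pts X) V a \<odot>\<^bsub>sec F V\<^esub> s"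
  by (simp add: scalar_action_def hom_ext_apply)

section \<open>Global functions act centrally\<close>

context ringed
begin

lemma scalar_action_hom:
  assumes a: "a \<in> carrier (\<O> X (pts X))" and F: "reflexive_sheaf X F"
  shows "scalar_action X a F \<in> sheaf_hom X F F"
proof -
  interpret sheaf_module X F by unfold_locales (rule reflexive_imp_sheaf_of_modules[OF F])
  have "hom_ext (open_subspace X (pts X)) F (\<lambda>U s. res X (pts X) U a \<odot>\<^bsub>sec F U\<^esub> s)
      \<in> sheaf_hom (open_subspace X (pts X)) F F"
  proof (rule sheaf_hom_hom_extI[OF opn_pts module_closed])
    fix V s assume V: "opn X V" "V \<subseteq> pts X" and s: "s \<in> carrier (sec F V)"
    interpret M: module "\<O> X V" "sec F V" by (rule sec_module[OF V(1)])
    have aV: "res X (pts X) V a \<in> carrier (\<O> X V)" by (rule res_closed[OF opn_pts V a])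
    show "res X (pts X) V a \<odot>\<^bsub>sec F V\<^esub> s \<in> carrier (sec F V)" using aV s by simp
    show "res X (pts X) V a \<odot>\<^bsub>sec F V\<^esub> (s \<oplus>\<^bsub>sec F V\<^esub> t) =
        res X (pts X) V a \<odot>\<^bsub>sec F V\<^esub> s \<oplus>\<^bsub>sec F V\<^esub> res X (pts X) V a \<odot>\<^bsub>sec F V\<^esub> t" if "t \<in> carrier (sec F V)" for t
      by (rule M.smult_r_distr[OF aV s that])
    show "res X (pts X) V a \<odot>\<^bsub>sec F V\<^esub> (b \<odot>\<^bsub>sec F V\<^esub> s) = b \<odot>\<^bsub>sec F V\<^esub> (res X (pts X) V a \<odot>\<^bsub>sec F V\<^esub> s)"
      if b: "b \<in> carrier (\<O> X V)" for b
      unfolding M.smult_assoc1[OF aV b s, symmetric] M.smult_assoc1[OF b aV s, symmetric] M.R.m_comm[OF aV b] ..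
    show "res X (pts X) W a \<odot>\<^bsub>sec F W\<^esub> mres F V W s = mres F V W (res X (pts X) V a \<odot>\<^bsub>sec F V\<^esub> s)"
      if W: "opn X W" "W \<subseteq> V" for W
      unfolding mres_smult[OF V(1) W aV s] res_res[OF opn_pts V(1) W V(2) a] ..
  qed
  then show ?thesis using F by (simp add: scalar_action_def)
qed

text \<open>Naturality of multiplication by a is the linearity of homomorphisms over the
  restrictions of a.\<close>

lemma scalar_action_center:
  assumes a: "a \<in> carrier (\<O> X (pts X))"
  shows "scalar_action X a \<in> carrier (center (Ref X))"
  unfolding center_carrier_iff
proof (intro conjI ballI)
  show "scalar_action X a \<in> (\<Pi>\<^sub>E F\<in>Obj (Ref X). Hom (Ref X) F F)"
  proof (rule PiE_I)
    show "scalar_action X a F \<in> Hom (Ref X) F F" if "F \<in> Obj (Ref X)" for F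
      using scalar_action_hom[OF a] that by simp
    show "scalar_action X a F = undefined" if "F \<notin> Obj (Ref X)" for F
      using that by (simp add: scalar_action_def)
  qed
  fix F G f assume FG: "F \<in> Obj (Ref X)" "G \<in> Obj (Ref X)" and f: "f \<in> Hom (Ref X) F G"
  then have FG: "reflexive_sheaf X F" "reflexive_sheaf X G" and f: "f \<in> sheaf_hom X F G" by simp_all
  show "Comp (Ref X) F G G (scalar_action X a G) f = Comp (Ref X) F F G f (scalar_action X a F)"
    unfolding Ref_simps
  proof (rule hom_ext_cong)
    fix V s assume V: "opn X V" and s: "s \<in> carrier (sec F V)"
    have aV: "res X (pts X) V a \<in> carrier (\<O> X V)" by (rule res_closed[OF opn_pts V openin_subset[OF V] a])
    show "scalar_action X a G V (f V s) = f V (scalar_action X a F V s)"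
      unfolding scalar_action_apply[OF FG(1) V s] scalar_action_apply[OF FG(2) V sheaf_homD_closed[OF f V s]]
      by (rule sheaf_homD_smult[OF f V aV s, symmetric])
  qed
qed

lemma scalar_action_ring_hom: "scalar_action X \<in> ring_hom (\<O> X (pts X)) (center (Ref X))"
proof (rule ring_hom_memI)
  fix a assume a: "a \<in> carrier (\<O> X (pts X))"
  show "scalar_action X a \<in> carrier (center (Ref X))" by (rule scalar_action_center[OF a])
  fix b assume b: "b \<in> carrier (\<O> X (pts X))"
  have main: "scalar_action X (a \<otimes>\<^bsub>\<O> X (pts X)\<^esub> b) F V s = scalar_action X a F V (scalar_action X b F V s) \<and>
      scalar_action X (a \<oplus>\<^bsub>\<O> X (pts X)\<^esub> b) F V s = scalar_action X a F V s \<oplus>\<^bsub>sec F V\<^esub> scalar_action X b F V s"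
    if F: "reflexive_sheaf X F" and V: "opn X V" and s: "s \<in> carrier (sec F V)" for F V s
  proof -
    interpret sheaf_module X F by unfold_locales (rule reflexive_imp_sheaf_of_modules[OF F])
    interpret M: module "\<O> X V" "sec F V" by (rule sec_module[OF V])
    note V' = opn_pts V openin_subset[OF V]
    note ab = res_closed[OF V' a] res_closed[OF V' b]
    show ?thesis
      unfolding scalar_action_apply[OF F V s] scalar_action_apply[OF F V M.smult_closed[OF ab(2) s]]
        res_mult[OF V' a b] res_add[OF V' a b]
      using M.smult_assoc1[OF ab s] M.smult_l_distr[OF ab s] by simp
  qed
  \<comment> \<open>Components of the action are normalized, so agreement on sections gives equality
    of functions.\<close>
  have ext: "hom_ext X F (scalar_action X c F) = scalar_action X c F" if "reflexive_sheaf X F" for F c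
    using that by (simp add: scalar_action_def hom_ext_idem)
  show "scalar_action X (a \<otimes>\<^bsub>\<O> X (pts X)\<^esub> b) = scalar_action X a \<otimes>\<^bsub>center (Ref X)\<^esub> scalar_action X b"
  proof
    fix F
    show "scalar_action X (a \<otimes>\<^bsub>\<O> X (pts X)\<^esub> b) F = (scalar_action X a \<otimes>\<^bsub>center (Ref X)\<^esub> scalar_action X b) F"
    proof (cases "reflexive_sheaf X F")
      case True
      have "hom_ext X F (scalar_action X (a \<otimes>\<^bsub>\<O> X (pts X)\<^esub> b) F) =
          hom_ext X F (\<lambda>V s. scalar_action X a F V (scalar_action X b F V s))"
        by (rule hom_ext_cong) (use main[OF True] in blast)
      then show ?thesis using True ext[OF True] by (simp add: center_def)
    qed (simp add: center_def scalar_action_def)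
  qed
  show "scalar_action X (a \<oplus>\<^bsub>\<O> X (pts X)\<^esub> b) = scalar_action X a \<oplus>\<^bsub>center (Ref X)\<^esub> scalar_action X b"
  proof
    fix F
    show "scalar_action X (a \<oplus>\<^bsub>\<O> X (pts X)\<^esub> b) F = (scalar_action X a \<oplus>\<^bsub>center (Ref X)\<^esub> scalar_action X b) F"
    proof (cases "reflexive_sheaf X F")
      case True
      have "hom_ext X F (scalar_action X (a \<oplus>\<^bsub>\<O> X (pts X)\<^esub> b) F) =
          hom_ext X F (\<lambda>V s. scalar_action X a F V s \<oplus>\<^bsub>sec F V\<^esub> scalar_action X b F V s)"
        by (rule hom_ext_cong) (use main[OF True] in blast)
      then show ?thesis using True ext[OF True] by (simp add: center_def)
    qed (simp add: center_def scalar_action_def)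
  qed
next
  show "scalar_action X \<one>\<^bsub>\<O> X (pts X)\<^esub> = \<one>\<^bsub>center (Ref X)\<^esub>"
  proof
    fix F
    show "scalar_action X \<one>\<^bsub>\<O> X (pts X)\<^esub> F = \<one>\<^bsub>center (Ref X)\<^esub> F"
    proof (cases "reflexive_sheaf X F")
      case True
      interpret sheaf_module X F by unfold_locales (rule reflexive_imp_sheaf_of_modules[OF True])
      have "hom_ext X F (\<lambda>V s. res X (pts X) V \<one>\<^bsub>\<O> X (pts X)\<^esub> \<odot>\<^bsub>sec F V\<^esub> s) = hom_ext X F (\<lambda>V s. s)"
        by (rule hom_ext_cong) (simp add: res_one[OF opn_pts] openin_subset module.smult_one[OF sec_module])
      then show ?thesis using True by (simp add: center_def scalar_action_def)
    qed (simp add: center_def scalar_action_def)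
  qed
qed

end

section \<open>Central elements are global functions\<close>

context noetherian_ringed
begin

lemma center_eq_scalar_action:
  fixes F :: "('x, 'r, 'm) mod_sheaf" and \<epsilon> :: "'r \<Rightarrow> 'm"
  assumes \<epsilon>: "inj \<epsilon>" and ne: "pts X \<noteq> {}" and z: "z \<in> carrier (center (Ref X))"
    and a: "a \<in> carrier (\<O> X (pts X))"
    and za: "z (ideal_module X \<epsilon> (\<lambda>U. carrier (\<O> X U))) (pts X) (\<epsilon> \<one>\<^bsub>\<O> X (pts X)\<^esub>) = \<epsilon> a"
    and F: "reflexive_sheaf X F" and U: "opn X U" and s: "s \<in> carrier (sec F U)"
  shows "z F U s = res X (pts X) U a \<odot>\<^bsub>sec F U\<^esub> s"
proof -
  interpret F: sheaf_module X F by unfold_locales (rule reflexive_imp_sheaf_of_modules[OF F])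
  note U' = opn_pts U openin_subset[OF U]
  have aU: "res X (pts X) U a \<in> carrier (\<O> X U)" by (rule res_closed[OF U' a])
  have c: "z F U s \<in> carrier (sec F U)" "res X (pts X) U a \<odot>\<^bsub>sec F U\<^esub> s \<in> carrier (sec F U)"
    by (rule sheaf_homD_closed[OF center_component[OF z F] U s], rule F.sec_smult_closed[OF U aU s])
  show ?thesis
  \<comment> \<open>The conductor is formed for nonempty U only; over the empty set there is just
    one section.\<close>
  proof (cases "U = {}")
    case True
    show ?thesis by (rule F.sec_empty[OF c[unfolded True], folded True])
  next
    case False
    \<comment> \<open>Here \<epsilon> takes values in the type of the sections of F, so that the
      conductor is an object of the same category as F.\<close>
    interpret R: reflexive_section X F \<epsilon> U s
      by (intro reflexive_section.intro reflexive_section_axioms.intro noetherian_ringed_axioms \<epsilon> F U False s)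
    interpret S: ideal_sheaf X \<epsilon> "\<lambda>U. carrier (\<O> X U)" by (rule ideal_sheaf_structure[OF \<epsilon>])
    note refl_S = structure_copy_reflexive[OF \<epsilon> ne] and refl_C = R.conductor_reflexive
    let ?i = "hom_ext X R.C.JM (\<lambda>V x. x)" and ?p = "hom_ext X R.C.JM R.proj"
    have i: "?i \<in> sheaf_hom X R.C.JM S.JM"
    proof -
      have "hom_ext (open_subspace X (pts X)) R.C.JM (\<lambda>V x. x) \<in> sheaf_hom (open_subspace X (pts X)) R.C.JM S.JM"
        by (rule sheaf_hom_hom_extI[OF opn_pts R.C.JM.module_closed]) (auto simp: R.C.J_carrier)
      then show ?thesis by simp
    qed
    have p: "?p \<in> sheaf_hom X R.C.JM F" using R.proj_hom[OF opn_pts] by simp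
    have triv: "conductor_U = carrier (\<O> X U)" if "conductor_U = R.conductor U" for conductor_U
      unfolding that by (rule R.conductor_on_U[OF U order_refl])
    let ?e = "\<epsilon> \<one>\<^bsub>\<O> X U\<^esub>"
    have one: "?e \<in> carrier (sec R.C.JM U)" using triv[OF refl] O_one_closed[OF U] by simp
    have "z R.C.JM U ?e \<in> carrier (sec R.C.JM U)"
      by (rule sheaf_homD_closed[OF center_component[OF z refl_C] U one])
    \<comment> \<open>At this point b is unknown. Comparison with the structure sheaf will identify
      it with the restriction of a, and comparison with F will express z on s through it.\<close>
    then obtain b where b: "b \<in> R.conductor U" "z R.C.JM U ?e = \<epsilon> b" by auto
    have bU: "b \<in> carrier (\<O> X U)" by (rule R.C.J_carrier[OF U b(1)])
    have onep: "\<epsilon> \<one>\<^bsub>\<O> X (pts X)\<^esub> \<in> carrier (sec S.JM (pts X))" using O_one_closed[OF opn_pts] by simp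
    \<comment> \<open>The assumption on a concerns the whole space; compatibility of z with
      restriction brings it down to U.\<close>
    have "z S.JM U (mres S.JM (pts X) U (\<epsilon> \<one>\<^bsub>\<O> X (pts X)\<^esub>)) = mres S.JM (pts X) U (\<epsilon> a)"
      unfolding za[symmetric] by (rule sheaf_homD_res[OF center_component[OF z refl_S] U' onep])
    then have zU: "z S.JM U ?e = \<epsilon> (res X (pts X) U a)" using res_one[OF U'] by simp
    have bC: "\<epsilon> b \<in> carrier (sec R.C.JM U)" using b(1) by simp
    have "z S.JM U (?i U ?e) = ?i U (\<epsilon> b)"
      unfolding b(2)[symmetric] by (rule center_natural[OF z refl_C refl_S i U one])
    then have "\<epsilon> (res X (pts X) U a) = \<epsilon> b"
      unfolding hom_ext_apply[OF U one] hom_ext_apply[OF U bC] zU .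
    then have ab: "b = res X (pts X) U a" using inj_eq[OF \<epsilon>] by simp
    have "z F U (?p U ?e) = ?p U (\<epsilon> b)"
      unfolding b(2)[symmetric] by (rule center_natural[OF z refl_C F p U one])
    then have "z F U (R.proj U ?e) = R.proj U (\<epsilon> b)"
      unfolding hom_ext_apply[OF U one] hom_ext_apply[OF U bC] .
    then show ?thesis
      unfolding R.proj_one[OF U order_refl] R.proj_eq[OF U R.lifts_on_U[OF U order_refl bU]]
        F.mres_id[OF U s] unfolding ab .
  qed
qed

text \<open>A function is recovered from its action by evaluation at 1 on the copy of the structure
  sheaf. The same evaluation yields the only candidate a for a given central z.\<close>

lemma scalar_action_ring_iso:
  fixes \<epsilon> :: "'r \<Rightarrow> 'm"
  assumes \<epsilon>: "inj \<epsilon>" and ne: "pts X \<noteq> {}"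
  shows "scalar_action X \<in> ring_iso (\<O> X (pts X))
    (center (Ref X :: (('x, 'r, 'm) mod_sheaf, 'x set \<Rightarrow> 'm \<Rightarrow> 'm) precat))"
proof (rule ring_iso_memI)
  let ?C = "center (Ref X :: (('x, 'r, 'm) mod_sheaf, 'x set \<Rightarrow> 'm \<Rightarrow> 'm) precat)"
  note hom = scalar_action_ring_hom
  show "scalar_action X a \<in> carrier ?C" if "a \<in> carrier (\<O> X (pts X))" for a
    by (rule ring_hom_closed[OF hom that])
  show "scalar_action X (a \<otimes>\<^bsub>\<O> X (pts X)\<^esub> b) = scalar_action X a \<otimes>\<^bsub>?C\<^esub> scalar_action X b"
    "scalar_action X (a \<oplus>\<^bsub>\<O> X (pts X)\<^esub> b) = scalar_action X a \<oplus>\<^bsub>?C\<^esub> scalar_action X b"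
    if "a \<in> carrier (\<O> X (pts X))" "b \<in> carrier (\<O> X (pts X))" for a b
    by (rule ring_hom_mult[OF hom that], rule ring_hom_add[OF hom that])
  show "scalar_action X \<one>\<^bsub>\<O> X (pts X)\<^esub> = \<one>\<^bsub>?C\<^esub>" by (rule ring_hom_one[OF hom])
  interpret S: ideal_sheaf X \<epsilon> "\<lambda>U. carrier (\<O> X U)" by (rule ideal_sheaf_structure[OF \<epsilon>])
  interpret O: cring "\<O> X (pts X)" by (rule O_cring[OF opn_pts])
  note refl_S = structure_copy_reflexive[OF \<epsilon> ne]
  let ?e = "\<epsilon> \<one>\<^bsub>\<O> X (pts X)\<^esub>"
  have one: "?e \<in> carrier (sec S.JM (pts X))" by simp
  have at_one: "scalar_action X a S.JM (pts X) ?e = \<epsilon> a" if "a \<in> carrier (\<O> X (pts X))" for a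
    unfolding scalar_action_apply[OF refl_S opn_pts one] using that res_id[OF opn_pts that] by simp
  show "bij_betw (scalar_action X) (carrier (\<O> X (pts X))) (carrier ?C)"
  proof (rule bij_betw_imageI)
    show "inj_on (scalar_action X :: 'r \<Rightarrow> ('x, 'r, 'm) mod_sheaf \<Rightarrow> 'x set \<Rightarrow> 'm \<Rightarrow> 'm) (carrier (\<O> X (pts X)))"
    proof (rule inj_onI)
      fix a b assume ab: "a \<in> carrier (\<O> X (pts X))" "b \<in> carrier (\<O> X (pts X))"
        and eq: "(scalar_action X a :: ('x, 'r, 'm) mod_sheaf \<Rightarrow> 'x set \<Rightarrow> 'm \<Rightarrow> 'm) = scalar_action X b"
      have "\<epsilon> a = \<epsilon> b" unfolding at_one[OF ab(1), symmetric] at_one[OF ab(2), symmetric] eq ..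
      then show "a = b" using inj_eq[OF \<epsilon>] by simp
    qed
    show "scalar_action X ` carrier (\<O> X (pts X)) = carrier ?C"
    proof
      show "scalar_action X ` carrier (\<O> X (pts X)) \<subseteq> carrier ?C"
        using ring_hom_closed[OF hom] by blast
      show "carrier ?C \<subseteq> scalar_action X ` carrier (\<O> X (pts X))"
      proof
        fix z assume z: "z \<in> carrier ?C"
        have "z S.JM (pts X) ?e \<in> carrier (sec S.JM (pts X))"
          by (rule sheaf_homD_closed[OF center_component[OF z refl_S] opn_pts one])
        then obtain a where a: "a \<in> carrier (\<O> X (pts X))" "z S.JM (pts X) ?e = \<epsilon> a" by auto
        have "z = scalar_action X a"
        proof
          fix F :: "('x, 'r, 'm) mod_sheaf"
          show "z F = scalar_action X a F"
          proof (cases "reflexive_sheaf X F")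
            case True
            have "hom_ext X F (z F) = hom_ext X F (scalar_action X a F)"
            proof (rule hom_ext_cong)
              fix V s assume V: "opn X V" and s: "s \<in> carrier (sec F V)"
              show "z F V s = scalar_action X a F V s"
                unfolding scalar_action_apply[OF True V s]
                by (rule center_eq_scalar_action[OF \<epsilon> ne z a True V s])
            qed
            then show ?thesis
              unfolding sheaf_hom_ext_id[OF center_component[OF z True]]
                sheaf_hom_ext_id[OF scalar_action_hom[OF a(1) True]] .
          next
            case False
            \<comment> \<open>Off the objects both families take the value \<open>undefined\<close>,
              as equality of total functions demands.\<close>
            have "z \<in> extensional (Obj (Ref X))" using z unfolding center_carrier_iff PiE_iff by blast
            then have "z F = undefined" by (rule extensional_arb) (simp add: False)
            then show ?thesis by (simp add: scalar_action_def False)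
          qed
        qed
        then show "z \<in> scalar_action X ` carrier (\<O> X (pts X))" using a(1) by blast
      qed
    qed
  qed
qed

end

theorem proposition4p15:
  fixes k :: "'k ring"
    and X :: "('x, 'r) ringed_space"
    and \<pi> :: "('x, 'r, 'k set, 'k set \<Rightarrow> ('k \<times> 'k) set) rs_mor"
    and \<epsilon> :: "'r \<Rightarrow> 'm"
  assumes "field k"
    and "normal_surface k X \<pi>"
    and "inj \<epsilon>"
  shows "scalar_action X \<in> ring_iso (\<O> X (pts X))
           (center (Ref X :: (('x, 'r, 'm) mod_sheaf, 'x set \<Rightarrow> 'm \<Rightarrow> 'm) precat))"
proof -
  interpret noetherian_ringed X by (rule normal_surface_noetherian_ringed[OF assms(1,2)])
  \<comment> \<open>Irreducibility includes being nonempty; reflexivity of the copy of the structure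
    sheaf is shown from a nonempty open set over which it is trivial, here the whole space.\<close>
  have "pts X \<noteq> {}" using assms(2) by (simp add: normal_surface_def irreducible_subset_def)
  then show ?thesis by (rule scalar_action_ring_iso[OF assms(3)])
qed

end
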